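(* Let $\Phi^{RA}$ be a bipartite quantum channel from $R_0A_0$ to $R_1A_1$ and $\Psi^{RB}$ a bipartite quantum channel from $R_0B_0$ to $R_1B_1$. Put $d_X=d_{R_0}^2$, $d_Y=d_{R_1}^2$. Let $\{|\varphi_x\rangle\langle\varphi_x|\}_{x=1}^{d_X}$ be a basis of the real space of Hermitian operators on $\mathcal H^{R_0}$ consisting of normalized rank-one projectors, and let $\{E_y\}_{y=1}^{d_Y}$ be an informationally complete POVM on $\mathcal H^{R_1}$ which is a basis of $\mathcal B(\mathcal H^{R_1})$. Define the CP maps $$\Phi^A_{y|x}(\rho)=\mathrm{Tr}_{R_1}\big[(E_y\otimes I^{A_1})\,\Phi^{RA}(|\varphi_x\rangle\langle\varphi_x|\otimes\rho)\big]\quad(\rho\in\mathcal B(\mathcal H^{A_0})),$$ $$\Psi^B_{y|x}(\rho)=\mathrm{Tr}_{R_1}\big[(E_y\otimes I^{B_1})\,\Psi^{RB}(|\varphi_x\rangle\langle\varphi_x|\otimes\rho)\big]\quad(\rho\in\mathcal B(\mathcal H^{B_0})).$$ Let $\tilde B=(\tilde B_0,\tilde B_1)$ be a copy of $B=(B_0,B_1)$ and let $\Psi^{\tilde B}_{y|x}$ denote the copy of $\Psi^B_{y|x}$ on $\tilde B$. For every family $\Lambda=\{\Lambda^B_{y|x}\}_{1\le x\le d_X,\,1\le y\le d_Y}$ of CP maps from $B_0$ to $B_1$ such that $\sum_{y=1}^{d_Y}\Lambda^B_{y|x}$ is CPTP for each $x$, define the bipartite CP maps $$\Lambda_\Phi^{AB}=\frac1{d_X}\sum_{x=1}^{d_X}\sum_{y=1}^{d_Y}\Phi^A_{y|x}\otimes\Lambda^B_{y|x},\qquad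 \Lambda_\Psi^{\tilde BB}=\frac1{d_X}\sum_{x=1}^{d_X}\sum_{y=1}^{d_Y}\Psi^{\tilde B}_{y|x}\otimes\Lambda^B_{y|x}.$$ Then there exists a superchannel $\Theta:\mathcal L^A\to\mathcal L^B$ with $\Psi^{RB}=(\mathbb 1^R\otimes\Theta)[\Phi^{RA}]$ if and only if, for every such family $\Lambda$, $$H^{\rm ext}_{\min}(B|A)_{\Lambda_\Phi}\le H^{\rm ext}_{\min}(B|\tilde B)_{\Lambda_\Psi}.$$
   Context: All Hilbert spaces are finite-dimensional; $d_S=\dim\mathcal H^S$, and $\mathcal B(\mathcal H)$ is the algebra of operators on $\mathcal H$. Each party $A$ has an input system $A_0$ and an output system $A_1$, and $A$ as a label of operators means the joint system $A_0A_1$. $\mathcal L^A$ is the space of linear maps $\mathcal B(\mathcal H^{A_0})\to\mathcal B(\mathcal H^{A_1})$; for two parties, $\mathcal L^{AB}=\mathcal L^A\otimes\mathcal L^B$ is the space of linear maps $\mathcal B(\mathcal H^{A_0B_0})\to\mathcal B(\mathcal H^{A_1B_1})$. A (quantum) channel is a completely positive trace-preserving (CPTP) map. $\mathbb 1^R$ is the identity map on $\mathcal L^R$. Superchannel: a linear map $\Theta:\mathcal L^A\to\mathcal L^B$ such that (i) for every party $C=(C_0,C_1)$, $\mathbb 1^C\otimes\Theta$ sends completely positive maps to completely positive maps, and (ii) $\Theta$ sends trace-preserving maps to trace-preserving maps. Marginals: deleting system labels from an operator denotes partial trace over the deleted systems. $u^S=I^S/d_S$ is the maximally mixed state. Extended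 conditional min-entropy: for a bipartite CP map $\Omega^{AB}$ from $A_0B_0$ to $A_1B_1$ (not necessarily trace preserving), let $\omega^{AB}=\frac1{d_{A_0}d_{B_0}}(\mathrm{id}^{A_0B_0}\otimes\Omega^{\tilde A_0\tilde B_0\to A_1B_1})(\phi_+^{A_0\tilde A_0}\otimes\phi_+^{B_0\tilde B_0})$, where $\phi_+^{S\tilde S}=\sum_{i,j}|i\rangle\langle j|^S\otimes|i\rangle\langle j|^{\tilde S}$ and $\tilde S$ is a copy of $S$. Then $$H^{\rm ext}_{\min}(B|A)_\Omega=-\log_2\min\big\{\mathrm{Tr}[\gamma^{AB_0}]:\ \gamma^{AB_0}\otimes I^{B_1}\ge\omega^{AB},\ \gamma^{A_0B_0}=u^{A_0}\otimes\gamma^{B_0}\big\},$$ the minimum being over Hermitian operators $\gamma^{AB_0}$ on $\mathcal H^{A_0A_1B_0}$. *)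

theory Defs
  imports "HOL-Analysis.Analysis"
begin

text \<open>
  A system is given by the labels of an orthonormal basis, a composite system by pairs of labels;
  operators are matrices in these bases. Fixed systems are finite types. Operators are functions
  rather than elements of the type \<open>complex ^ 'i ^ 'i\<close> because complete positivity and the notion of
  superchannel quantify over auxiliary systems of arbitrary dimension: these carry the labels
  \<open>{..<n} :: nat set\<close>, so that operators live on a finite set \<open>S\<close> of labels.
\<close>

type_synonym 'i opr = "'i \<Rightarrow> 'i \<Rightarrow> complex"

definition opers :: "'i set \<Rightarrow> 'i opr set" where
  "opers S = {X. \<forall>i j. i \<notin> S \<or> j \<notin> S \<longrightarrow> X i j = 0}"

definition psd :: "'i set \<Rightarrow> 'i opr set" where
  "psd S = {X \<in> opers S. \<forall>v. (\<Sum>i\<in>S. \<Sum>j\<in>S. cnj (v i) * X i j * v j) \<in> \<real>\<^sub>\<ge>\<^sub>0}"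

definition hermitian :: "'i opr \<Rightarrow> bool" where
  "hermitian X \<longleftrightarrow> (\<forall>i j. X i j = cnj (X j i))"

definition id_op :: "'i opr" where
  "id_op = (\<lambda>i j. if i = j then 1 else 0)"

definition op_mult :: "'i::finite opr \<Rightarrow> 'i opr \<Rightarrow> 'i opr" where
  "op_mult X Y = (\<lambda>i j. \<Sum>k\<in>UNIV. X i k * Y k j)"

definition tr :: "'i::finite opr \<Rightarrow> complex" where
  "tr X = (\<Sum>i\<in>UNIV. X i i)"

definition ptrace_fst :: "('i::finite \<times> 'j) opr \<Rightarrow> 'j opr" where
  "ptrace_fst X = (\<lambda>j j'. \<Sum>i\<in>UNIV. X (i, j) (i, j'))"

definition op_tensor :: "'i opr \<Rightarrow> 'j opr \<Rightarrow> ('i \<times> 'j) opr" (infixr "\<otimes>\<^sub>o" 75) where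
  "X \<otimes>\<^sub>o Y = (\<lambda>(i, j) (i', j'). X i i' * Y j j')"

text \<open>Change of the order and bracketing of tensor factors.\<close>

definition relabel :: "('j \<Rightarrow> 'i) \<Rightarrow> 'i opr \<Rightarrow> 'j opr" where
  "relabel f X = (\<lambda>j j'. X (f j) (f j'))"

definition matrix_unit :: "'i \<Rightarrow> 'i \<Rightarrow> 'i opr" where
  "matrix_unit i j = (\<lambda>p q. if p = i \<and> q = j then 1 else 0)"

definition rank1 :: "('i \<Rightarrow> complex) \<Rightarrow> 'i opr" where
  "rank1 v = (\<lambda>i j. v i * cnj (v j))"

definition normalized :: "('i::finite \<Rightarrow> complex) \<Rightarrow> bool" where
  "normalized v \<longleftrightarrow> (\<Sum>i\<in>UNIV. (cmod (v i))\<^sup>2) = 1"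

definition max_mixed :: "'i::finite opr" where
  "max_mixed = (\<lambda>i j. id_op i j / of_nat CARD('i))"

definition phi_plus :: "('i::finite \<times> 'i) opr" where
  "phi_plus = (\<lambda>p q. \<Sum>i\<in>UNIV. \<Sum>j\<in>UNIV. (matrix_unit i j \<otimes>\<^sub>o matrix_unit i j) p q)"


section \<open>Maps between operator spaces\<close>

text \<open>
  Only the values of a map on \<open>opers S\<close> are relevant; for \<open>S = UNIV\<close> this is every operator.
\<close>

definition linear_maps :: "'i set \<Rightarrow> 'j set \<Rightarrow> ('i opr \<Rightarrow> 'j opr) set" where
  "linear_maps S T = {N. (\<forall>X\<in>opers S. N X \<in> opers T) \<and>
     (\<forall>X\<in>opers S. \<forall>Y\<in>opers S. \<forall>c.
        N (\<lambda>i j. c * X i j + Y i j) = (\<lambda>i j. c * N X i j + N Y i j))}"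

text \<open>
  For linear maps this is the usual tensor product, applied factor by factor; see
  \<open>map_tensor_op_tensor\<close> below.
\<close>

definition map_tensor ::
    "('i opr \<Rightarrow> 'j opr) \<Rightarrow> ('k opr \<Rightarrow> 'l opr) \<Rightarrow> ('i \<times> 'k) opr \<Rightarrow> ('j \<times> 'l) opr"
    (infixr "\<otimes>\<^sub>m" 75) where
  "N \<otimes>\<^sub>m M = (\<lambda>X. \<lambda>(j, l) (j', l').
     N (\<lambda>i i'. M (\<lambda>k k'. X (i, k) (i', k')) l l') j j')"

definition cp_maps :: "'i set \<Rightarrow> 'j set \<Rightarrow> ('i opr \<Rightarrow> 'j opr) set" where
  "cp_maps S T = {N \<in> linear_maps S T.
     \<forall>n::nat. \<forall>X \<in> psd ({..<n} \<times> S). ((\<lambda>Y. Y) \<otimes>\<^sub>m N) X \<in> psd ({..<n} \<times> T)}"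

definition trace_preserving :: "('i::finite opr \<Rightarrow> 'j::finite opr) \<Rightarrow> bool" where
  "trace_preserving N \<longleftrightarrow> (\<forall>X. tr (N X) = tr X)"

definition channels :: "('i::finite opr \<Rightarrow> 'j::finite opr) set" where
  "channels = {N \<in> cp_maps UNIV UNIV. trace_preserving N}"


section \<open>Superchannels\<close>

definition linear_super ::
    "(('a0 opr \<Rightarrow> 'a1 opr) \<Rightarrow> ('b0 opr \<Rightarrow> 'b1 opr)) \<Rightarrow> bool" where
  "linear_super \<Theta> \<longleftrightarrow>
     (\<forall>N \<in> linear_maps UNIV UNIV. \<Theta> N \<in> linear_maps UNIV UNIV) \<and>
     (\<forall>N \<in> linear_maps UNIV UNIV. \<forall>M \<in> linear_maps UNIV UNIV. \<forall>c.
        \<Theta> (\<lambda>X i j. c * N X i j + M X i j) = (\<lambda>X i j. c * \<Theta> N X i j + \<Theta> M X i j))"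

text \<open>
  The map \<open>id \<otimes> \<Theta>\<close> on \<open>L\<^sup>C \<otimes> L\<^sup>A\<close>, where \<open>C0\<close> is the set of labels of the input system of \<open>C\<close>.
  A map \<open>N\<close> in this space is expanded in the basis of \<open>L\<^sup>C\<close> formed by the maps which send the
  matrix unit \<open>(i, i')\<close> to the matrix unit \<open>(k, k')\<close> and all other ones to \<open>0\<close>. The coefficients of
  \<open>N\<close> are the maps \<open>\<rho> \<mapsto> \<langle>k| N (|i\<rangle>\<langle>i'| \<otimes> \<rho>) |k'\<rangle>\<close> in \<open>L\<^sup>A\<close>, to which \<open>\<Theta>\<close> is applied; see
  \<open>id_super_tensor\<close> below.
\<close>

definition id_super ::
    "'c0 set \<Rightarrow> (('a0 opr \<Rightarrow> 'a1 opr) \<Rightarrow> ('b0 opr \<Rightarrow> 'b1 opr)) \<Rightarrow>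
     (('c0 \<times> 'a0) opr \<Rightarrow> ('c1 \<times> 'a1) opr) \<Rightarrow> (('c0 \<times> 'b0) opr \<Rightarrow> ('c1 \<times> 'b1) opr)" where
  "id_super C0 \<Theta> N = (\<lambda>X. \<lambda>(k, b) (k', b'). \<Sum>i\<in>C0. \<Sum>i'\<in>C0.
     \<Theta> (\<lambda>\<rho> a a'. N (matrix_unit i i' \<otimes>\<^sub>o \<rho>) (k, a) (k', a')) (\<lambda>r s. X (i, r) (i', s)) b b')"

definition superchannel ::
    "(('a0::finite opr \<Rightarrow> 'a1::finite opr) \<Rightarrow> ('b0::finite opr \<Rightarrow> 'b1::finite opr)) \<Rightarrow> bool" where
  "superchannel \<Theta> \<longleftrightarrow> linear_super \<Theta> \<and>
     (\<forall>(m::nat) (n::nat). \<forall>N \<in> cp_maps ({..<m} \<times> UNIV) ({..<n} \<times> UNIV).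
        id_super {..<m} \<Theta> N \<in> cp_maps ({..<m} \<times> UNIV) ({..<n} \<times> UNIV)) \<and>
     (\<forall>N \<in> linear_maps UNIV UNIV. trace_preserving N \<longrightarrow> trace_preserving (\<Theta> N))"

lemma opers_UNIV [simp]: "opers UNIV = UNIV"
  by (simp add: opers_def)

lemma linear_maps_scale:
  assumes "N \<in> linear_maps UNIV UNIV"
  shows "N (\<lambda>i j. c * X i j) = (\<lambda>i j. c * N X i j)"
proof -
  have lin: "N (\<lambda>i j. c * X i j + Y i j) = (\<lambda>i j. c * N X i j + N Y i j)" for c X Y
    using assms by (simp add: linear_maps_def)
  have "N (\<lambda>i j. 0) = (\<lambda>i j. 0)"
    using lin[of "-1" "\<lambda>i j. 0" "\<lambda>i j. 0"] by simp
  then show ?thesis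
    using lin[of c X "\<lambda>i j. 0"] by simp
qed

lemma map_tensor_op_tensor:
  assumes "N \<in> linear_maps UNIV UNIV" "M \<in> linear_maps UNIV UNIV"
  shows "(N \<otimes>\<^sub>m M) (X \<otimes>\<^sub>o Y) = N X \<otimes>\<^sub>o M Y"
proof -
  have "N (\<lambda>i i'. X i i' * M Y l l') = (\<lambda>j j'. N X j j' * M Y l l')" for l l'
    using linear_maps_scale[OF assms(1), of "M Y l l'" X] by (simp add: mult.commute)
  then show ?thesis
    by (simp add: map_tensor_def op_tensor_def linear_maps_scale[OF assms(2)])
qed

lemma linear_maps_expand:
  fixes M :: "'c::finite opr \<Rightarrow> 'd opr"
  assumes "M \<in> linear_maps UNIV UNIV"
  shows "M Z k k' = (\<Sum>i\<in>UNIV. \<Sum>i'\<in>UNIV. Z i i' * M (matrix_unit i i') k k')"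
proof -
  have lin: "M (\<lambda>i j. c * X i j + Y i j) = (\<lambda>i j. c * M X i j + M Y i j)" for c X Y
    using assms by (simp add: linear_maps_def)
  have zero: "M (\<lambda>i j. 0) = (\<lambda>i j. 0)"
    using linear_maps_scale[OF assms, of 0] by simp
  have sum: "M (\<lambda>p q. \<Sum>t\<in>T. Z (fst t) (snd t) * matrix_unit (fst t) (snd t) p q) k k' =
      (\<Sum>t\<in>T. Z (fst t) (snd t) * M (matrix_unit (fst t) (snd t)) k k')" if "finite T" for T
    using that by (induction T rule: finite_induct) (simp_all add: zero lin)
  have "(\<lambda>p q. \<Sum>t\<in>UNIV. Z (fst t) (snd t) * matrix_unit (fst t) (snd t) p q) = Z"
  proof (intro ext)
    fix p q
    have "(\<Sum>t\<in>UNIV. Z (fst t) (snd t) * matrix_unit (fst t) (snd t) p q) =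
        (\<Sum>t\<in>UNIV. if t = (p, q) then Z p q else 0)"
      by (rule sum.cong) (auto simp: matrix_unit_def)
    then show "(\<Sum>t\<in>UNIV. Z (fst t) (snd t) * matrix_unit (fst t) (snd t) p q) = Z p q"
      by simp
  qed
  then show ?thesis
    using sum[of UNIV] by (simp add: sum.cartesian_product case_prod_unfold)
qed

lemma id_super_tensor:
  fixes M :: "'c::finite opr \<Rightarrow> 'd opr"
  assumes "linear_super \<Theta>" "M \<in> linear_maps UNIV UNIV" "N \<in> linear_maps UNIV UNIV"
  shows "id_super UNIV \<Theta> (M \<otimes>\<^sub>m N) = M \<otimes>\<^sub>m \<Theta> N"
proof -
  have lin: "\<Theta> (\<lambda>X i j. c * N X i j + N' X i j) = (\<lambda>X i j. c * \<Theta> N X i j + \<Theta> N' X i j)"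
    if "N' \<in> linear_maps UNIV UNIV" for c N'
    using assms(1,3) that unfolding linear_super_def by blast
  have "(\<lambda>X i j. 0) \<in> linear_maps UNIV UNIV"
    by (simp add: linear_maps_def)
  from lin[OF this] lin[OF assms(3), of "-1"]
  have scale: "\<Theta> (\<lambda>X i j. c * N X i j) = (\<lambda>X i j. c * \<Theta> N X i j)" for c
    by simp
  have coeff: "\<Theta> (\<lambda>\<rho> a a'. (M \<otimes>\<^sub>m N) (matrix_unit i i' \<otimes>\<^sub>o \<rho>) (k, a) (k', a')) =
      (\<lambda>X b b'. M (matrix_unit i i') k k' * \<Theta> N X b b')" for i i' k k'
    unfolding map_tensor_op_tensor[OF assms(2,3)] by (simp add: op_tensor_def scale)
  have "id_super UNIV \<Theta> (M \<otimes>\<^sub>m N) X (k, b) (k', b') = (M \<otimes>\<^sub>m \<Theta> N) X (k, b) (k', b')" for X k b k' b'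
  proof -
    have "id_super UNIV \<Theta> (M \<otimes>\<^sub>m N) X (k, b) (k', b') = (\<Sum>i\<in>UNIV. \<Sum>i'\<in>UNIV.
        \<Theta> N (\<lambda>r s. X (i, r) (i', s)) b b' * M (matrix_unit i i') k k')"
      by (simp add: id_super_def coeff mult.commute)
    also have "\<dots> = (M \<otimes>\<^sub>m \<Theta> N) X (k, b) (k', b')"
      by (simp add: map_tensor_def
          linear_maps_expand[OF assms(2), of "\<lambda>i i'. \<Theta> N (\<lambda>r s. X (i, r) (i', s)) b b'"])
    finally show ?thesis .
  qed
  then show ?thesis
    by (intro ext) (metis surj_pair)
qed


section \<open>Extended conditional min-entropy\<close>

text \<open>The normalized Choi operator of a map from \<open>A0 B0\<close> to \<open>A1 B1\<close>, on the systems \<open>A0 A1\<close>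
  and \<open>B0 B1\<close>.\<close>

definition choi_state ::
    "(('a0::finite \<times> 'b0::finite) opr \<Rightarrow> ('a1 \<times> 'b1) opr) \<Rightarrow> (('a0 \<times> 'a1) \<times> ('b0 \<times> 'b1)) opr" where
  "choi_state \<Omega> =
     relabel (\<lambda>((a0, a1), (b0, b1)). ((a0, b0), (a1, b1)))
      (\<lambda>p q. 1 / (of_nat CARD('a0) * of_nat CARD('b0)) *
        ((\<lambda>Y. Y) \<otimes>\<^sub>m \<Omega>)
          (relabel (\<lambda>((a, b), (a', b')). ((a, a'), (b, b'))) (phi_plus \<otimes>\<^sub>o phi_plus)) p q)"

definition hmin_feasible ::
    "(('a0::finite \<times> 'b0::finite) opr \<Rightarrow> ('a1::finite \<times> 'b1::finite) opr) \<Rightarrow>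
     (('a0 \<times> 'a1) \<times> 'b0) opr set" where
  "hmin_feasible \<Omega> = {\<gamma>. hermitian \<gamma> \<and>
     (\<lambda>p q. relabel (\<lambda>(a, (b0, b1)). ((a, b0), b1)) (\<gamma> \<otimes>\<^sub>o id_op) p q - choi_state \<Omega> p q)
       \<in> psd UNIV \<and>
     ptrace_fst (relabel (\<lambda>(a1, (a0, b0)). ((a0, a1), b0)) \<gamma>) = max_mixed \<otimes>\<^sub>o ptrace_fst \<gamma>}"

text \<open>
  \<open>Hmin_ext \<Omega>\<close> is the entropy of the second party conditioned on the first one. The minimum is \<open>0\<close>
  for \<open>\<Omega> = 0\<close>, hence the values are extended reals, with \<open>- log 2 0 = \<infinity>\<close>.
\<close>

definition Hmin_ext ::
    "(('a0::finite \<times> 'b0::finite) opr \<Rightarrow> ('a1::finite \<times> 'b1::finite) opr) \<Rightarrow> ereal" where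
  "Hmin_ext \<Omega> =
     (let t = (LEAST t. \<exists>\<gamma> \<in> hmin_feasible \<Omega>. t = Re (tr \<gamma>))
      in if t = 0 then \<infinity> else ereal (- log 2 t))"


section \<open>Bases, measurements and classical-quantum families\<close>

text \<open>\<open>K\<close> is the set of scalars, the reals or all complex numbers.\<close>

definition op_basis :: "complex set \<Rightarrow> 'i opr set \<Rightarrow> nat \<Rightarrow> (nat \<Rightarrow> 'i opr) \<Rightarrow> bool" where
  "op_basis K V n F \<longleftrightarrow> (\<forall>x\<in>{1..n}. F x \<in> V) \<and>
     (\<forall>X\<in>V. \<exists>c. (\<forall>x\<in>{1..n}. c x \<in> K) \<and> X = (\<lambda>i j. \<Sum>x=1..n. c x * F x i j)) \<and>
     (\<forall>c. (\<forall>x\<in>{1..n}. c x \<in> K) \<and> (\<lambda>i j. \<Sum>x=1..n. c x * F x i j) = (\<lambda>i j. 0) \<longrightarrow>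
        (\<forall>x\<in>{1..n}. c x = 0))"

definition povm :: "nat \<Rightarrow> (nat \<Rightarrow> 'i::finite opr) \<Rightarrow> bool" where
  "povm n E \<longleftrightarrow> (\<forall>y\<in>{1..n}. E y \<in> psd UNIV) \<and> (\<lambda>i j. \<Sum>y=1..n. E y i j) = id_op"

definition informationally_complete :: "nat \<Rightarrow> (nat \<Rightarrow> 'i::finite opr) \<Rightarrow> bool" where
  "informationally_complete n E \<longleftrightarrow>
     (\<forall>\<rho> \<in> psd UNIV. \<forall>\<sigma> \<in> psd UNIV. tr \<rho> = 1 \<and> tr \<sigma> = 1 \<and>
        (\<forall>y\<in>{1..n}. tr (op_mult (E y) \<rho>) = tr (op_mult (E y) \<sigma>)) \<longrightarrow> \<rho> = \<sigma>)"

definition cond_map ::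
    "(('r0 \<times> 'a0) opr \<Rightarrow> ('r1::finite \<times> 'a1::finite) opr) \<Rightarrow> 'r0 opr \<Rightarrow> 'r1 opr \<Rightarrow>
     'a0 opr \<Rightarrow> 'a1 opr" where
  "cond_map \<Phi> P E = (\<lambda>\<rho>. ptrace_fst (op_mult (E \<otimes>\<^sub>o id_op) (\<Phi> (P \<otimes>\<^sub>o \<rho>))))"

definition instrument_family ::
    "nat \<Rightarrow> nat \<Rightarrow> (nat \<Rightarrow> nat \<Rightarrow> 'b0::finite opr \<Rightarrow> 'b1::finite opr) \<Rightarrow> bool" where
  "instrument_family dX dY \<Lambda> \<longleftrightarrow>
     (\<forall>x\<in>{1..dX}. \<forall>y\<in>{1..dY}. \<Lambda> x y \<in> cp_maps UNIV UNIV) \<and>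
     (\<forall>x\<in>{1..dX}. (\<lambda>\<rho> i j. \<Sum>y=1..dY. \<Lambda> x y \<rho> i j) \<in> channels)"

definition paired_map ::
    "nat \<Rightarrow> nat \<Rightarrow> (nat \<Rightarrow> nat \<Rightarrow> 'a0 opr \<Rightarrow> 'a1 opr) \<Rightarrow> (nat \<Rightarrow> nat \<Rightarrow> 'b0 opr \<Rightarrow> 'b1 opr) \<Rightarrow>
     ('a0 \<times> 'b0) opr \<Rightarrow> ('a1 \<times> 'b1) opr" where
  "paired_map dX dY F \<Lambda> =
     (\<lambda>X p q. 1 / of_nat dX * (\<Sum>x=1..dX. \<Sum>y=1..dY. (F x y \<otimes>\<^sub>m \<Lambda> x y) X p q))"

end

theory Submission imports Defs begin

text \<open>
  In terms of its Choi operator \<open>J\<close>, a superchannel is a positive semidefinite operator subject to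
  affine conditions, and it acts by contraction with \<open>J\<close>. Contraction with \<open>J\<close> turns a feasible
  operator \<open>\<gamma>\<close> of the min-entropy program of \<open>\<Lambda>\<^sub>\<Phi>\<close> into one of the same trace for \<open>\<Lambda>\<^sub>\<Psi>\<close>; this gives
  the monotonicity. Conversely, if no superchannel maps \<open>\<Phi>\<close> to \<open>\<Psi>\<close>, then the affine conditions,
  which fix the trace of \<open>J\<close>, separate from the compact convex set of positive semidefinite
  operators of that trace. The separating functional consists of an operator \<open>\<gamma>\<close> satisfying the
  marginal condition and of a witness \<open>W\<close>, whose components in the bases \<open>\<phi>\<^sub>x\<close> and \<open>E\<^sub>y\<close> become,
  after a shift that trace preservation makes harmless, the Choi operators of an instrument family.
  For this family \<open>\<gamma>\<close> bounds the program of \<open>\<Lambda>\<^sub>\<Phi>\<close> from above, and weak duality with the identity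
  superchannel bounds that of \<open>\<Lambda>\<^sub>\<Psi>\<close> from below by a strictly larger number.

  All pairings of operators are bilinear, \<open>\<Sum>\<^sub>i\<^sub>j X\<^sub>i\<^sub>j Y\<^sub>i\<^sub>j\<close>, so that no transposes appear.
\<close>

section \<open>Positive semidefinite operators\<close>

text \<open>The image of the whole positive cone under a linear map need not be closed, so strict
  separation from the cone itself could fail; hence the passage to a slice of fixed trace. The
  marginal condition of the entropy program arises from the way the affine conditions are encoded:
  \<open>marg_proj\<close> of Tr_B1 J equals the identity over d_A0, where \<open>marg_proj\<close>
  is the orthogonal projection onto the operators with that marginal condition. Its self-adjointness
  moves the projection onto the Lagrange multiplier, so \<gamma> satisfies the condition
  automatically, while tracing out B1 turns into tensoring \<gamma> with the identity. Separation
  takes place in a real vector space and controls only real parts, so \<gamma> and W are finally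
  replaced by their Hermitian parts. The two programs are normalised by different dimensions, but
  the upper and the lower bound turn out to carry the same factor 1 / (d_X d_B0), so the strict gap
  of the separation survives in the optimal values.\<close>

definition quad :: "'i set \<Rightarrow> 'i opr \<Rightarrow> ('i \<Rightarrow> complex) \<Rightarrow> complex" where
  "quad S X v = (\<Sum>i\<in>S. \<Sum>j\<in>S. cnj (v i) * X i j * v j)"

lemma psd_quad: "X \<in> psd S \<longleftrightarrow> X \<in> opers S \<and> (\<forall>v. quad S X v \<in> \<real>\<^sub>\<ge>\<^sub>0)"
  by (simp add: psd_def quad_def)

lemma psdI:
  assumes "\<And>i j. i \<notin> S \<or> j \<notin> S \<Longrightarrow> X i j = 0" "\<And>v. quad S X v \<in> \<real>\<^sub>\<ge>\<^sub>0"
  shows "X \<in> psd S"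
  using assms by (auto simp: psd_quad opers_def)

lemma psd_zero: "X \<in> psd S \<Longrightarrow> i \<notin> S \<or> j \<notin> S \<Longrightarrow> X i j = 0"
  by (auto simp: psd_def opers_def)

lemma quad_two:
  assumes "finite S" "i \<in> S" "j \<in> S" "i \<noteq> j"
  shows "quad S X (\<lambda>k. if k = i then a else if k = j then b else 0) =
    cnj a * X i i * a + cnj a * X i j * b + cnj b * X j i * a + cnj b * X j j * b"
proof -
  have *: "(\<Sum>k\<in>S. f k * (if k = i then a else if k = j then b else 0)) = f i * a + f j * b" for f :: "'a \<Rightarrow> complex" and a b
  proof -
    have "(\<Sum>k\<in>S. f k * (if k = i then a else if k = j then b else 0)) =
      (\<Sum>k\<in>S. (if k = i then f k * a else 0) + (if k = j then f k * b else 0))"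
      by (rule sum.cong) (use assms in auto)
    then show ?thesis
      using assms by (simp add: sum.distrib)
  qed
  have "quad S X (\<lambda>k. if k = i then a else if k = j then b else 0) =
    (\<Sum>k\<in>S. cnj (if k = i then a else if k = j then b else 0) * X k i * a +
      cnj (if k = i then a else if k = j then b else 0) * X k j * b)"
    unfolding quad_def * ..
  also have "\<dots> = (\<Sum>k\<in>S. (X k i * a + X k j * b) * (if k = i then cnj a else if k = j then cnj b else 0))"
    by (rule sum.cong) (auto simp: algebra_simps)
  finally have "quad S X (\<lambda>k. if k = i then a else if k = j then b else 0) =
    (\<Sum>k\<in>S. (X k i * a + X k j * b) * (if k = i then cnj a else if k = j then cnj b else 0))" .
  then show ?thesis
    unfolding * by (simp add: algebra_simps)
qed

lemma quad_one:
  assumes "finite S" "i \<in> S"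
  shows "quad S X (\<lambda>k. if k = i then a else 0) = cnj a * X i i * a"
proof -
  have "quad S X (\<lambda>k. if k = i then a else 0) =
    (\<Sum>k\<in>S. \<Sum>l\<in>S. if l = i then (if k = i then cnj a * X i i * a else 0) else 0)"
    unfolding quad_def by (intro sum.cong) auto
  then show ?thesis
    using assms by simp
qed

lemma psd_diag: 
  assumes "X \<in> psd S" "finite S" shows "X i i \<in> \<real>\<^sub>\<ge>\<^sub>0"
proof (cases "i \<in> S")
  case True
  then show ?thesis
    using quad_one[OF assms(2) True, of X 1] assms(1) by (auto simp: psd_quad) (metis)
qed (use assms psd_zero in \<open>fastforce\<close>)

text \<open>Polarisation: \<open>psd\<close> asks only for nonnegative values of the form, and their
  reality at e_i + e_j and at e_i + \<i> e_j makes the imaginary and the real part of X i j - cnj (X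
  j i) vanish.\<close>

lemma psd_hermitian:
  assumes "X \<in> psd S" "finite S"
  shows "X i j = cnj (X j i)"
proof -
  consider "i \<notin> S \<or> j \<notin> S" | "i = j" | "i \<in> S" "j \<in> S" "i \<noteq> j" by blast
  then show ?thesis
  proof cases
    case 1
    then show ?thesis using psd_zero[OF assms(1)] by auto
  next
    case 2
    then show ?thesis
      using psd_diag[OF assms, of i] by (simp add: complex_nonneg_Reals_iff complex_eq_iff)
  next
    case 3
    have r: "quad S X v \<in> \<real>\<^sub>\<ge>\<^sub>0" for v using assms by (simp add: psd_quad)
    have d: "Im (X i i) = 0" "Im (X j j) = 0"
      using psd_diag[OF assms] by (simp_all add: complex_nonneg_Reals_iff)
    show ?thesis
      using r[of "\<lambda>k. if k = i then 1 else if k = j then 1 else 0"]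
        r[of "\<lambda>k. if k = i then 1 else if k = j then \<i> else 0"] d
      unfolding quad_two[OF assms(2) 3] by (auto simp: complex_nonneg_Reals_iff complex_eq_iff)
  qed
qed

text \<open>With X i i = 0 the form is affine in the coefficient of e_i, so a nonzero X i j would
  let it become negative.\<close>

lemma psd_diag_zero:
  assumes "X \<in> psd S" "finite S" "X i i = 0"
  shows "X i j = 0"
proof (rule ccontr)
  assume nz: "X i j \<noteq> 0"
  then have 3: "i \<in> S" "j \<in> S" "i \<noteq> j" using psd_zero[OF assms(1)] assms(3) by blast+
  \<comment> \<open>The factor \<open>c\<close> makes each of the two cross terms of c e_i + e_j
    equal to -r / 2, so the form takes the value Re (X j j) - r = -1 there.\<close>
  define r where "r = Re (X j j) + 1"
  define c where "c = - of_real (r / (2 * (cmod (X i j))\<^sup>2)) * X i j"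
  have "cnj c * X i j = - of_real (r / (2 * (cmod (X i j))\<^sup>2)) * (X i j * cnj (X i j))"
    by (simp add: c_def mult.commute)
  also have "\<dots> = - of_real (r / 2)"
  proof -
    have "X i j * cnj (X i j) = of_real ((cmod (X i j))\<^sup>2)"
      by (rule complex_norm_square[symmetric, simplified of_real_power[symmetric]])
    moreover have "r / (2 * (cmod (X i j))\<^sup>2) * (cmod (X i j))\<^sup>2 = r / 2"
      using nz by simp
    ultimately show ?thesis
      by (metis mult_minus_left of_real_mult)
  qed
  finally have e: "cnj c * X i j = - of_real (r / 2)" .
  have e': "X j i * c = - of_real (r / 2)"
    using arg_cong[OF e, of cnj] psd_hermitian[OF assms(1,2), of i j] by (simp add: mult.commute)
  have "quad S X (\<lambda>k. if k = i then c else if k = j then 1 else 0) \<in> \<real>\<^sub>\<ge>\<^sub>0"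
    using assms by (simp add: psd_quad)
  then have "0 \<le> Re (X j j) - r"
    unfolding quad_two[OF assms(2) 3] using e e' assms(3) by (simp add: complex_nonneg_Reals_iff)
  then show False by (simp add: r_def)
qed

lemma quad_rank1: "quad S (rank1 u) v = (\<Sum>i\<in>S. cnj (v i) * u i) * cnj (\<Sum>i\<in>S. cnj (v i) * u i)"
  unfolding quad_def rank1_def by (simp add: sum_product mult.assoc mult.commute mult.left_commute)

lemma mult_cnj_nonneg: "z * cnj z \<in> \<real>\<^sub>\<ge>\<^sub>0"
  by (simp add: complex_nonneg_Reals_iff)

lemma quad_add: "quad S (\<lambda>i j. X i j + Y i j) v = quad S X v + quad S Y v"
  by (simp add: quad_def algebra_simps sum.distrib)

lemma quad_diff: "quad S (\<lambda>i j. X i j - Y i j) v = quad S X v - quad S Y v"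
  by (simp add: quad_def algebra_simps sum_subtractf)

lemma quad_scale: "quad S (\<lambda>i j. c * X i j) v = c * quad S X v"
  by (simp add: quad_def algebra_simps sum_distrib_left)

lemma psd_0: "(\<lambda>i j. 0) \<in> psd S"
  by (simp add: psd_quad opers_def quad_def)

lemma psd_add: "X \<in> psd S \<Longrightarrow> Y \<in> psd S \<Longrightarrow> (\<lambda>i j. X i j + Y i j) \<in> psd S"
  by (auto simp: psd_quad opers_def quad_add)

lemma psd_scale: "X \<in> psd S \<Longrightarrow> c \<in> \<real>\<^sub>\<ge>\<^sub>0 \<Longrightarrow> (\<lambda>i j. c * X i j) \<in> psd S"
  by (auto simp: psd_quad opers_def quad_scale)

lemma psd_sum:
  "(\<And>t. t \<in> T \<Longrightarrow> X t \<in> psd S) \<Longrightarrow> (\<lambda>i j. \<Sum>t\<in>T. X t i j) \<in> psd S"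
  by (induction T rule: infinite_finite_induct) (auto simp: psd_0 psd_add)

lemma psd_rank1: "(\<And>i. i \<notin> S \<Longrightarrow> u i = 0) \<Longrightarrow> rank1 u \<in> psd S"
  by (intro psdI) (simp_all only: quad_rank1 mult_cnj_nonneg, auto simp: rank1_def)

text \<open>Cholesky decomposition: each step splits off one vector and leaves a Schur complement.\<close>

lemma psd_decomp:
  assumes "finite S" "X \<in> psd S"
  shows "\<exists>(n::nat) w. X = (\<lambda>i j. \<Sum>t<n. rank1 (w t) i j) \<and> (\<forall>t<n. \<forall>i. i \<notin> S \<longrightarrow> w t i = 0)"
  using assms
proof (induction S arbitrary: X rule: finite_induct)
  case empty
  then show ?case
    by (intro exI[of _ 0]) (auto intro: psd_zero)
next
  case (insert i S)
  let ?S = "insert i S"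
  have fin: "finite ?S" using insert by simp
  note herm = psd_hermitian[OF insert.prems fin]
  show ?case
  proof (cases "X i i = 0")
    case True
    have z: "X i j = 0" "X j i = 0" for j
      using psd_diag_zero[OF insert.prems fin True] herm[of j i] by auto
    have "X \<in> psd S"
    proof (rule psdI)
      show "X k l = 0" if "k \<notin> S \<or> l \<notin> S" for k l
        using that z psd_zero[OF insert.prems, of k l] by blast
      show "quad S X v \<in> \<real>\<^sub>\<ge>\<^sub>0" for v
      proof -
        have "quad S X v = quad ?S X v"
          using insert.hyps by (simp add: quad_def z)
        then show ?thesis using insert.prems by (simp add: psd_quad)
      qed
    qed
    from insert.IH[OF this] show ?thesis by blast
  next
    case False
    define d where "d = Re (X i i)"
    have Xd: "X i i = of_real d" and d0: "d > 0"
      using psd_diag[OF insert.prems fin, of i] False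
      by (auto simp: complex_nonneg_Reals_iff complex_eq_iff d_def)
    \<comment> \<open>\<open>rank1 u\<close> agrees with X in row and column i, so the remainder
      \<open>Y\<close> lives on S.\<close>
    define u where "u = (\<lambda>j. X j i / of_real (sqrt d))"
    have sq: "of_real (sqrt d) * of_real (sqrt d) = (of_real d :: complex)"
      using d0 by (simp flip: of_real_mult)
    have u0: "u j = 0" if "j \<notin> ?S" for j
      using psd_zero[OF insert.prems, of j i] that by (simp add: u_def)
    define Y where "Y = (\<lambda>k l. X k l - rank1 u k l)"
    have Yk: "Y k i = 0" for k
      using d0 Xd sq by (simp add: Y_def rank1_def u_def field_simps)
    have Yi: "Y i k = 0" for k
    proof -
      have "Y i k = cnj (Y k i)"
        using herm[of i k] by (simp add: Y_def rank1_def mult.commute)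
      then show ?thesis using Yk by simp
    qed
    have "Y \<in> psd S"
    proof (rule psdI)
      show "Y k l = 0" if "k \<notin> S \<or> l \<notin> S" for k l
      proof (cases "k = i \<or> l = i")
        case False
        then have "k \<notin> ?S \<or> l \<notin> ?S" using that by auto
        then show ?thesis
          using psd_zero[OF insert.prems, of k l] u0 by (auto simp: Y_def rank1_def)
      qed (use Yi Yk in auto)
      show "quad S Y v \<in> \<real>\<^sub>\<ge>\<^sub>0" for v
      proof -
        \<comment> \<open>The i-th coordinate makes v' orthogonal to u; the form of the Schur
          complement at v is then the form of X at v'.\<close>
        define v' where "v' = v(i := - (\<Sum>j\<in>S. X i j * v j) / of_real d)"
        have v'S: "v' j = v j" if "j \<in> S" for j using that insert.hyps by (auto simp: v'_def)
        have "quad S Y v = quad S Y v'"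
          using v'S by (simp add: quad_def)
        also have "\<dots> = quad ?S Y v'"
          using insert.hyps by (simp add: quad_def Yi Yk)
        also have "\<dots> = quad ?S X v' - quad ?S (rank1 u) v'"
          unfolding Y_def by (rule quad_diff)
        also have "quad ?S (rank1 u) v' = 0"
        proof -
          have "cnj (\<Sum>k\<in>?S. cnj (v' k) * u k) = (\<Sum>k\<in>?S. X i k * v' k) / of_real (sqrt d)"
            using herm[of i] by (simp add: u_def sum_divide_distrib mult.commute)
          also have "(\<Sum>k\<in>?S. X i k * v' k) = X i i * v' i + (\<Sum>k\<in>S. X i k * v k)"
            using insert.hyps v'S by simp
          also have "\<dots> = 0"
            using d0 by (simp add: v'_def Xd)
          finally show ?thesis unfolding quad_rank1 by simp
        qed
        finally show ?thesis using insert.prems by (simp add: psd_quad)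
      qed
    qed
    from insert.IH[OF this] obtain n :: nat and w where
      w: "Y = (\<lambda>i j. \<Sum>t<n. rank1 (w t) i j)" "\<forall>t<n. \<forall>i. i \<notin> S \<longrightarrow> w t i = 0" by blast
    show ?thesis
    proof (intro exI conjI)
      show "X = (\<lambda>k l. \<Sum>t<Suc n. rank1 ((w(n := u)) t) k l)"
      proof (intro ext)
        fix k l
        have "(\<Sum>t<n. rank1 ((w(n := u)) t) k l) = Y k l"
          unfolding w(1) by (rule sum.cong) auto
        then show "X k l = (\<Sum>t<Suc n. rank1 ((w(n := u)) t) k l)"
          by (simp add: Y_def)
      qed
      show "\<forall>t<Suc n. \<forall>k. k \<notin> ?S \<longrightarrow> (w(n := u)) t k = 0"
        using w(2) u0 by (auto simp: less_Suc_eq)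
    qed
  qed
qed

text \<open>Congruence turns each rank-one summand of a vector w into that of A w. The entries of Y
  are prescribed only on T because operators live on sets of labels and vanish outside.\<close>

lemma psd_congruence:
  assumes "finite S" "X \<in> psd S"
  assumes Y: "\<And>j j'. j \<in> T \<Longrightarrow> j' \<in> T \<Longrightarrow> Y j j' = (\<Sum>i\<in>S. \<Sum>i'\<in>S. A j i * X i i' * cnj (A j' i'))"
    and Y0: "\<And>j j'. j \<notin> T \<or> j' \<notin> T \<Longrightarrow> Y j j' = 0"
  shows "Y \<in> psd T"
proof -
  obtain n :: nat and w where w: "X = (\<lambda>i j. \<Sum>t<n. rank1 (w t) i j)"
    using psd_decomp[OF assms(1,2)] by blast
  have "(\<lambda>j j'. \<Sum>t<n. rank1 (\<lambda>j. if j \<in> T then \<Sum>i\<in>S. A j i * w t i else 0) j j') \<in> psd T"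
    by (intro psd_sum psd_rank1) auto
  also have "(\<lambda>j j'. \<Sum>t<n. rank1 (\<lambda>j. if j \<in> T then \<Sum>i\<in>S. A j i * w t i else 0) j j') = Y"
  proof (intro ext)
    fix j j'
    show "(\<Sum>t<n. rank1 (\<lambda>j. if j \<in> T then \<Sum>i\<in>S. A j i * w t i else 0) j j') = Y j j'"
    proof (cases "j \<in> T \<and> j' \<in> T")
      case True
      have "Y j j' = (\<Sum>i\<in>S. \<Sum>i'\<in>S. \<Sum>t<n. (A j i * w t i) * cnj (A j' i' * w t i'))"
        using True unfolding Y[OF conjunct1[OF True] conjunct2[OF True]] w rank1_def
        by (simp add: sum_distrib_left sum_distrib_right mult_ac)
      also have "\<dots> = (\<Sum>i\<in>S. \<Sum>t<n. \<Sum>i'\<in>S. (A j i * w t i) * cnj (A j' i' * w t i'))"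
        by (intro sum.cong refl) (rule sum.swap)
      also have "\<dots> = (\<Sum>t<n. \<Sum>i\<in>S. \<Sum>i'\<in>S. (A j i * w t i) * cnj (A j' i' * w t i'))"
        by (rule sum.swap)
      also have "\<dots> = (\<Sum>t<n. rank1 (\<lambda>j. if j \<in> T then \<Sum>i\<in>S. A j i * w t i else 0) j j')"
        using True by (simp add: rank1_def sum_product)
      finally show ?thesis by simp
    qed (use Y0 in \<open>auto simp: rank1_def\<close>)
  qed
  finally show ?thesis .
qed

text \<open>Congruence with the 0-1 matrix of f; f may repeat or drop labels.\<close>

lemma psd_relabel_on:
  assumes "X \<in> psd S" "finite S" "\<And>j. j \<in> T \<Longrightarrow> f j \<in> S"
    and "\<And>j j'. j \<in> T \<Longrightarrow> j' \<in> T \<Longrightarrow> Y j j' = X (f j) (f j')"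
    and "\<And>j j'. j \<notin> T \<or> j' \<notin> T \<Longrightarrow> Y j j' = 0"
  shows "Y \<in> psd T"
proof (rule psd_congruence[OF assms(2,1), where A = "\<lambda>j i. if i = f j then 1 else 0"])
  fix j j' assume j: "j \<in> T" "j' \<in> T"
  have "(\<Sum>i\<in>S. \<Sum>i'\<in>S. (if i = f j then 1 else 0) * X i i' * cnj (if i' = f j' then 1 else 0)) =
    (\<Sum>i\<in>S. \<Sum>i'\<in>S. if i' = f j' then if i = f j then X i i' else 0 else 0)"
    by (intro sum.cong) auto
  then show "Y j j' = (\<Sum>i\<in>S. \<Sum>i'\<in>S. (if i = f j then 1 else 0) * X i i' * cnj (if i' = f j' then 1 else 0))"
    using assms(2,3,4) j by simp
qed (use assms in auto)

lemma psd_relabel: "X \<in> psd UNIV \<Longrightarrow> relabel f X \<in> psd UNIV" for X :: "'i::finite opr"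
  by (rule psd_relabel_on[where f = f]) (auto simp: relabel_def)

text \<open>Positivity of the link product. For a rank-one summand of C, its vector read as a matrix
  between Q and R turns the contraction into a congruence of X. Complete positivity, tensor products
  and the action of superchannels all rest on this contraction.\<close>

lemma psd_link:
  assumes "X \<in> psd (P \<times> Q)" "C \<in> psd (Q \<times> R)" "finite P" "finite Q" "finite R"
  shows "(\<lambda>(p, r) (p', r'). \<Sum>q\<in>Q. \<Sum>q'\<in>Q. X (p, q) (p', q') * C (q, r) (q', r')) \<in> psd (P \<times> R)"
proof -
  obtain n :: nat and w where w: "C = (\<lambda>i j. \<Sum>t<n. rank1 (w t) i j)"
    and w0: "\<And>t i. t < n \<Longrightarrow> i \<notin> Q \<times> R \<Longrightarrow> w t i = 0"
    using psd_decomp[OF _ assms(2)] assms by blast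
  define Y where "Y = (\<lambda>t (p, r) (p', r'). \<Sum>q\<in>Q. \<Sum>q'\<in>Q. X (p, q) (p', q') * rank1 (w t) (q, r) (q', r'))"
  have "Y t \<in> psd (P \<times> R)" if t: "t < n" for t
  proof (rule psd_congruence[OF _ assms(1), where A = "\<lambda>(p, r) (p', q). if p' = p then w t (q, r) else 0"])
    show "finite (P \<times> Q)" using assms by simp
    fix j j' assume "j \<in> P \<times> R" "j' \<in> P \<times> R"
    moreover obtain p r p' r' where j: "j = (p, r)" "j' = (p', r')" by (metis surj_pair)
    ultimately have pr: "p \<in> P" "p' \<in> P" by auto
    have d: "(\<Sum>p2\<in>P. if p2 = p then f p2 else 0) = f p"
       "(\<Sum>p2\<in>P. if p2 = p' then f p2 else 0) = f p'" for f :: "'a \<Rightarrow> complex"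
      using pr assms(3) by simp_all
    show "Y t j j' = (\<Sum>i\<in>P \<times> Q. \<Sum>i'\<in>P \<times> Q. (case j of (p, r) \<Rightarrow> \<lambda>(p', q). if p' = p then w t (q, r) else 0) i * X i i' *
                cnj ((case j' of (p, r) \<Rightarrow> \<lambda>(p', q). if p' = p then w t (q, r) else 0) i'))"
    proof -
      have "(\<Sum>i\<in>P \<times> Q. \<Sum>i'\<in>P \<times> Q. (case j of (p, r) \<Rightarrow> \<lambda>(p', q). if p' = p then w t (q, r) else 0) i * X i i' *
                cnj ((case j' of (p, r) \<Rightarrow> \<lambda>(p', q). if p' = p then w t (q, r) else 0) i')) =
        (\<Sum>p2\<in>P. \<Sum>q\<in>Q. \<Sum>p3\<in>P. \<Sum>q'\<in>Q. if p3 = p' then if p2 = p then w t (q, r) * X (p2, q) (p3, q') * cnj (w t (q', r')) else 0 else 0)"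
        unfolding j sum.cartesian_product' split_conv by (intro sum.cong refl) auto
      also have "\<dots> = (\<Sum>q\<in>Q. \<Sum>p2\<in>P. \<Sum>q'\<in>Q. \<Sum>p3\<in>P. if p3 = p' then if p2 = p then w t (q, r) * X (p2, q) (p3, q') * cnj (w t (q', r')) else 0 else 0)"
        by (subst sum.swap, intro sum.cong refl, rule sum.swap)
      also have "\<dots> = (\<Sum>q\<in>Q. \<Sum>q'\<in>Q. \<Sum>p2\<in>P. if p2 = p then w t (q, r) * X (p2, q) (p', q') * cnj (w t (q', r')) else 0)"
        unfolding d by (intro sum.cong refl, subst sum.swap) (simp add: pr assms(3))
      also have "\<dots> = Y t j j'"
        unfolding d by (simp add: Y_def j rank1_def mult.commute mult.left_commute mult.assoc)
      finally show ?thesis by simp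
    qed
  next
    fix j j' assume "j \<notin> P \<times> R \<or> j' \<notin> P \<times> R"
    moreover obtain p r p' r' where j: "j = (p, r)" "j' = (p', r')" by (metis surj_pair)
    ultimately show "Y t j j' = 0"
      using psd_zero[OF assms(1), of "(p, _)" "(p', _)"] w0[OF t, of "(_, r)"] w0[OF t, of "(_, r')"]
      by (auto simp: Y_def j rank1_def)
  qed
  then have "(\<lambda>j j'. \<Sum>t<n. Y t j j') \<in> psd (P \<times> R)"
    by (intro psd_sum) auto
  also have "(\<lambda>j j'. \<Sum>t<n. Y t j j') = (\<lambda>(p, r) (p', r'). \<Sum>q\<in>Q. \<Sum>q'\<in>Q. X (p, q) (p', q') * C (q, r) (q', r'))"
  proof (intro ext, clarify)
    fix p r p' r'
    have "(\<Sum>t<n. Y t (p, r) (p', r')) = (\<Sum>q\<in>Q. \<Sum>t<n. \<Sum>q'\<in>Q. X (p, q) (p', q') * rank1 (w t) (q, r) (q', r'))"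
      unfolding Y_def split_conv by (rule sum.swap)
    also have "\<dots> = (\<Sum>q\<in>Q. \<Sum>q'\<in>Q. X (p, q) (p', q') * C (q, r) (q', r'))"
      unfolding w sum_distrib_left by (intro sum.cong refl, rule sum.swap)
    finally show "(\<Sum>t<n. Y t (p, r) (p', r')) = (\<Sum>q\<in>Q. \<Sum>q'\<in>Q. X (p, q) (p', q') * C (q, r) (q', r'))" .
  qed
  finally show ?thesis .
qed

section \<open>Choi operators\<close>

lemma linear_maps_opers: "N \<in> linear_maps S T \<Longrightarrow> X \<in> opers S \<Longrightarrow> N X \<in> opers T"
  by (simp add: linear_maps_def)

lemma opers_zero: "X \<in> opers S \<Longrightarrow> i \<notin> S \<or> j \<notin> S \<Longrightarrow> X i j = 0"
  by (auto simp: opers_def)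

lemma psd_nonzero: "X \<in> psd S \<Longrightarrow> X i j \<noteq> 0 \<Longrightarrow> i \<in> S \<and> j \<in> S"
  by (auto dest: psd_zero)

lemma linear_maps_lin:
  "N \<in> linear_maps S T \<Longrightarrow> X \<in> opers S \<Longrightarrow> Y \<in> opers S \<Longrightarrow>
    N (\<lambda>i j. c * X i j + Y i j) = (\<lambda>i j. c * N X i j + N Y i j)"
  by (simp add: linear_maps_def)

lemma opers_0: "(\<lambda>i j. 0) \<in> opers S"
  by (simp add: opers_def)

lemma matrix_unit_opers: "i \<in> S \<Longrightarrow> j \<in> S \<Longrightarrow> matrix_unit i j \<in> opers S"
  by (auto simp: opers_def matrix_unit_def)

lemma linear_maps_0:
  assumes "N \<in> linear_maps S T"
  shows "N (\<lambda>i j. 0) = (\<lambda>i j. 0)"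
  using linear_maps_lin[OF assms opers_0 opers_0, of "-1"] by simp

lemma linear_maps_sum:
  assumes "N \<in> linear_maps S T" "finite I" "\<And>t. t \<in> I \<Longrightarrow> X t \<in> opers S"
  shows "N (\<lambda>i j. \<Sum>t\<in>I. c t * X t i j) = (\<lambda>i j. \<Sum>t\<in>I. c t * N (X t) i j)"
  using assms(2,3)
proof (induction I rule: finite_induct)
  case empty
  then show ?case using linear_maps_0[OF assms(1)] by simp
next
  case (insert t I)
  have "(\<lambda>i j. \<Sum>t\<in>I. c t * X t i j) \<in> opers S"
    using insert.prems by (auto simp: opers_def)
  then show ?case
    using insert linear_maps_lin[OF assms(1), of "X t" "\<lambda>i j. \<Sum>t\<in>I. c t * X t i j" "c t"] by simp
qed

text \<open>Unnormalised. A linear map is controlled only on \<open>opers S\<close>, so entries with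
  an input label outside \<open>S\<close> are set to 0; the Choi operator is then supported on the
  labels of input and output.\<close>

definition choi :: "'i set \<Rightarrow> ('i opr \<Rightarrow> 'k opr) \<Rightarrow> ('i \<times> 'k) opr" where
  "choi S N = (\<lambda>(i, k) (j, l). if i \<in> S \<and> j \<in> S then N (matrix_unit i j) k l else 0)"

lemma opers_expand:
  assumes "finite S" "X \<in> opers S"
  shows "X = (\<lambda>p q. \<Sum>t\<in>S \<times> S. X (fst t) (snd t) * matrix_unit (fst t) (snd t) p q)"
proof (intro ext)
  fix p q
  have "(\<Sum>t\<in>S \<times> S. X (fst t) (snd t) * matrix_unit (fst t) (snd t) p q) =
    (\<Sum>t\<in>S \<times> S. if t = (p, q) then X p q else 0)"
    by (rule sum.cong) (auto simp: matrix_unit_def)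
  also have "\<dots> = X p q"
    using assms by (auto simp: opers_def)
  finally show "X p q = (\<Sum>t\<in>S \<times> S. X (fst t) (snd t) * matrix_unit (fst t) (snd t) p q)" by simp
qed

lemma linear_maps_choi:
  assumes "N \<in> linear_maps S T" "finite S" "X \<in> opers S"
  shows "N X k l = (\<Sum>i\<in>S. \<Sum>j\<in>S. X i j * choi S N (i, k) (j, l))"
proof -
  have "N X k l = (\<Sum>t\<in>S \<times> S. X (fst t) (snd t) * N (matrix_unit (fst t) (snd t)) k l)"
    using arg_cong[OF opers_expand[OF assms(2,3)], of "\<lambda>Y. N Y k l"] assms(2)
    by (subst (asm) linear_maps_sum[OF assms(1)]) (auto intro: matrix_unit_opers)
  then show ?thesis
    by (simp add: sum.cartesian_product' choi_def)
qed

lemma choi_opers: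
  assumes "N \<in> linear_maps S T"
  shows "choi S N \<in> opers (S \<times> T)"
  using linear_maps_opers[OF assms matrix_unit_opers] by (auto simp: opers_def choi_def)

lemma linear_maps_eqI:
  assumes "N \<in> linear_maps S T" "M \<in> linear_maps S T" "finite S" "X \<in> opers S" "choi S N = choi S M"
  shows "N X = M X"
  by (intro ext) (simp add: linear_maps_choi[OF assms(1,3,4)] linear_maps_choi[OF assms(2,3,4)] assms(5))

definition of_choi :: "('i::finite \<times> 'k) opr \<Rightarrow> 'i opr \<Rightarrow> 'k opr" where
  "of_choi C = (\<lambda>X k l. \<Sum>i\<in>UNIV. \<Sum>j\<in>UNIV. X i j * C (i, k) (j, l))"

lemma of_choi_linear: "of_choi C \<in> linear_maps UNIV UNIV"
  by (auto simp: linear_maps_def of_choi_def algebra_simps sum.distrib sum_distrib_left)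

lemma sum_matrix_unit:
  assumes "finite S" "finite T" "i \<in> S" "j \<in> T"
  shows "(\<Sum>p\<in>S. \<Sum>q\<in>T. matrix_unit i j p q * f p q) = f i j"
    "(\<Sum>p\<in>S. \<Sum>q\<in>T. f p q * matrix_unit i j p q) = f i j"
proof -
  have "(\<Sum>p\<in>S. \<Sum>q\<in>T. matrix_unit i j p q * f p q) =
      (\<Sum>p\<in>S. \<Sum>q\<in>T. if q = j then if p = i then f i j else 0 else 0)"
    by (intro sum.cong refl) (auto simp: matrix_unit_def)
  then show "(\<Sum>p\<in>S. \<Sum>q\<in>T. matrix_unit i j p q * f p q) = f i j"
    using assms by simp
  then show "(\<Sum>p\<in>S. \<Sum>q\<in>T. f p q * matrix_unit i j p q) = f i j"
    by (simp add: mult.commute)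
qed

lemma choi_of_choi: "choi UNIV (of_choi C) = C"
  by (intro ext) (auto simp: choi_def of_choi_def sum_matrix_unit)

text \<open>Choi's theorem. One direction tests N on the maximally entangled vector; in the other,
  id \<otimes> N is the link product with the Choi operator.\<close>

lemma cp_maps_choi:
  assumes "finite S" "finite T"
  shows "N \<in> cp_maps S T \<longleftrightarrow> N \<in> linear_maps S T \<and> choi S N \<in> psd (S \<times> T)"
proof (intro iffI conjI)
  assume "N \<in> cp_maps S T"
  then have lin: "N \<in> linear_maps S T"
    and cp: "\<And>n X. X \<in> psd ({..<n::nat} \<times> S) \<Longrightarrow> ((\<lambda>Y. Y) \<otimes>\<^sub>m N) X \<in> psd ({..<n} \<times> T)"
    by (auto simp: cp_maps_def)
  show "N \<in> linear_maps S T" by fact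
  obtain h where h: "bij_betw h {..<card S} S"
    using ex_bij_betw_nat_finite[OF assms(1)] by (auto simp: atLeast0LessThan)
  \<comment> \<open>Auxiliary systems carry the labels \<open>{..<n}\<close>, so the auxiliary half
    of the maximally entangled pair is a copy of S along the bijection h.\<close>
  define u where "u = (\<lambda>(p, i). if p < card S \<and> i = h p then 1 else 0 :: complex)"
  have "rank1 u \<in> psd ({..<card S} \<times> S)"
    using bij_betw_apply[OF h] by (intro psd_rank1) (auto simp: u_def split: if_splits)
  note X = cp[OF this]
  define g where "g = inv_into {..<card S} h"
  have g: "g i < card S" "h (g i) = i" if "i \<in> S" for i
    using bij_betw_inv_into_right[OF h that] bij_betw_apply[OF bij_betw_inv_into[OF h] that]
    by (auto simp: g_def)
  show "choi S N \<in> psd (S \<times> T)"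
  proof (rule psd_relabel_on[OF X, where f = "\<lambda>(i, k). (g i, k)"])
    fix j j' assume "j \<in> S \<times> T" "j' \<in> S \<times> T"
    then obtain i k i' k' where j: "j = (i, k)" "j' = (i', k')" and i: "i \<in> S" "i' \<in> S" by auto
    have "(\<lambda>k k'. rank1 u (g i, k) (g i', k')) = matrix_unit i i'"
      using g i by (auto simp: rank1_def u_def matrix_unit_def fun_eq_iff)
    then show "choi S N j j' = ((\<lambda>Y. Y) \<otimes>\<^sub>m N) (rank1 u) (case j of (i, k) \<Rightarrow> (g i, k)) (case j' of (i, k) \<Rightarrow> (g i, k))"
      using i by (simp add: j choi_def map_tensor_def)
  qed (use assms g opers_zero[OF choi_opers[OF lin]] in auto)
next
  assume "N \<in> linear_maps S T \<and> choi S N \<in> psd (S \<times> T)"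
  then have lin: "N \<in> linear_maps S T" and C: "choi S N \<in> psd (S \<times> T)" by auto
  show "N \<in> cp_maps S T"
    unfolding cp_maps_def
  proof (intro CollectI conjI allI ballI lin)
    fix n :: nat and X assume X: "X \<in> psd ({..<n} \<times> S)"
    have "(\<lambda>k k'. X (p, k) (p', k')) \<in> opers S" for p p'
      using psd_zero[OF X] by (auto simp: opers_def)
    then have "((\<lambda>Y. Y) \<otimes>\<^sub>m N) X =
        (\<lambda>(p, r) (p', r'). \<Sum>q\<in>S. \<Sum>q'\<in>S. X (p, q) (p', q') * choi S N (q, r) (q', r'))"
      by (auto simp: map_tensor_def fun_eq_iff linear_maps_choi[OF lin assms(1)])
    then show "((\<lambda>Y. Y) \<otimes>\<^sub>m N) X \<in> psd ({..<n} \<times> T)"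
      using psd_link[OF X C] assms by simp
  qed
qed

text \<open>Stated for an arbitrary factor c because the slices of a feasible \<gamma> are Choi
  operators of maps that multiply the trace by a constant.\<close>

lemma trace_choi:
  fixes N :: "'i::finite opr \<Rightarrow> 'k::finite opr"
  assumes "N \<in> linear_maps UNIV UNIV"
  shows "(\<forall>X. tr (N X) = c * tr X) \<longleftrightarrow> (\<forall>i j. (\<Sum>k\<in>UNIV. choi UNIV N (i, k) (j, k)) = c * id_op i j)"
proof (intro iffI allI)
  fix i j :: 'i assume "\<forall>X. tr (N X) = c * tr X"
  moreover have "tr (matrix_unit i j) = id_op i j"
    by (auto simp: tr_def matrix_unit_def id_op_def intro: sum.neutral)
  moreover have "(\<Sum>k\<in>UNIV. choi UNIV N (i, k) (j, k)) = tr (N (matrix_unit i j))"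
    by (simp add: choi_def tr_def)
  ultimately show "(\<Sum>k\<in>UNIV. choi UNIV N (i, k) (j, k)) = c * id_op i j" by simp
next
  fix X assume *: "\<forall>i j. (\<Sum>k\<in>UNIV. choi UNIV N (i, k) (j, k)) = c * id_op i j"
  have "tr (N X) = (\<Sum>k\<in>UNIV. \<Sum>i\<in>UNIV. \<Sum>j\<in>UNIV. X i j * choi UNIV N (i, k) (j, k))"
    by (simp add: tr_def linear_maps_choi[OF assms])
  also have "\<dots> = (\<Sum>i\<in>UNIV. \<Sum>k\<in>UNIV. \<Sum>j\<in>UNIV. X i j * choi UNIV N (i, k) (j, k))"
    by (rule sum.swap)
  also have "\<dots> = (\<Sum>i\<in>UNIV. \<Sum>j\<in>UNIV. X i j * (\<Sum>k\<in>UNIV. choi UNIV N (i, k) (j, k)))"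
    unfolding sum_distrib_left by (intro sum.cong refl, rule sum.swap)
  also have "\<dots> = c * tr X"
    unfolding *[rule_format] tr_def sum_distrib_left by (simp add: id_op_def if_distrib mult.commute cong: if_cong)
  finally show "tr (N X) = c * tr X" .
qed

lemma trace_preserving_choi:
  assumes "N \<in> linear_maps UNIV UNIV"
  shows "trace_preserving N \<longleftrightarrow> (\<forall>i j. (\<Sum>k\<in>UNIV. choi UNIV N (i, k) (j, k)) = id_op i j)"
  using trace_choi[OF assms, of 1] by (simp add: trace_preserving_def)

section \<open>Choi operators of superchannels\<close>

text \<open>The linear map whose Choi operator is the matrix unit at (a, a'); these maps form a
  basis of the linear maps.\<close>

definition unit_map :: "'i \<times> 'k \<Rightarrow> 'i \<times> 'k \<Rightarrow> 'i opr \<Rightarrow> 'k opr" where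
  "unit_map a a' = (\<lambda>X k l. X (fst a) (fst a') * matrix_unit (snd a) (snd a') k l)"

lemma unit_map_linear: "unit_map a a' \<in> linear_maps UNIV UNIV"
  by (auto simp: linear_maps_def unit_map_def algebra_simps)

definition super_choi ::
    "(('a0 opr \<Rightarrow> 'a1 opr) \<Rightarrow> ('b0 opr \<Rightarrow> 'b1 opr)) \<Rightarrow> (('a0 \<times> 'a1) \<times> ('b0 \<times> 'b1)) opr" where
  "super_choi \<Theta> = (\<lambda>(a, b) (a', b'). choi UNIV (\<Theta> (unit_map a a')) b b')"

lemma linear_super_linear: "linear_super \<Theta> \<Longrightarrow> N \<in> linear_maps UNIV UNIV \<Longrightarrow> \<Theta> N \<in> linear_maps UNIV UNIV"
  by (simp add: linear_super_def)

lemma linear_super_lin: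
  "linear_super \<Theta> \<Longrightarrow> N \<in> linear_maps UNIV UNIV \<Longrightarrow> M \<in> linear_maps UNIV UNIV \<Longrightarrow>
    \<Theta> (\<lambda>X i j. c * N X i j + M X i j) = (\<lambda>X i j. c * \<Theta> N X i j + \<Theta> M X i j)"
  by (simp add: linear_super_def)

lemma zero_linear: "(\<lambda>X i j. 0) \<in> linear_maps S T"
  by (simp add: linear_maps_def opers_def)

lemma linear_super_0: "linear_super \<Theta> \<Longrightarrow> \<Theta> (\<lambda>X i j. 0) = (\<lambda>X i j. 0)"
  using linear_super_lin[OF _ zero_linear zero_linear, of \<Theta> "-1"] by simp

lemma linear_super_sum:
  assumes "linear_super \<Theta>" "finite I" "\<And>t. t \<in> I \<Longrightarrow> N t \<in> linear_maps UNIV UNIV"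
  shows "\<Theta> (\<lambda>X i j. \<Sum>t\<in>I. c t * N t X i j) = (\<lambda>X i j. \<Sum>t\<in>I. c t * \<Theta> (N t) X i j)"
  using assms(2,3)
proof (induction I rule: finite_induct)
  case empty
  then show ?case using linear_super_0[OF assms(1)] by simp
next
  case (insert t I)
  have "(\<lambda>X i j. \<Sum>t\<in>I. c t * N t X i j) \<in> linear_maps UNIV UNIV"
    using insert.prems by (auto simp: linear_maps_def sum.distrib sum_distrib_left algebra_simps)
  then show ?case
    using insert linear_super_lin[OF assms(1), of "N t" "\<lambda>X i j. \<Sum>t\<in>I. c t * N t X i j" "c t"] by simp
qed

text \<open>N is expanded in the maps \<open>unit_map\<close>, with the entries of its Choi operator
  as coefficients.\<close>

lemma super_choi_apply:
  fixes \<Theta> :: "('a0::finite opr \<Rightarrow> 'a1::finite opr) \<Rightarrow> ('b0 opr \<Rightarrow> 'b1 opr)"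
  assumes "linear_super \<Theta>" "N \<in> linear_maps UNIV UNIV"
  shows "choi UNIV (\<Theta> N) b b' = (\<Sum>a\<in>UNIV. \<Sum>a'\<in>UNIV. super_choi \<Theta> (a, b) (a', b') * choi UNIV N a a')"
proof -
  have "N = (\<lambda>X i j. \<Sum>t\<in>UNIV. choi UNIV N (fst t) (snd t) * unit_map (fst t) (snd t) X i j)"
  proof (intro ext)
    fix X k l
    have "(\<Sum>t\<in>UNIV. choi UNIV N (fst t) (snd t) * unit_map (fst t) (snd t) X k l) =
      (\<Sum>i\<in>UNIV. \<Sum>p\<in>UNIV. \<Sum>j\<in>UNIV. \<Sum>q\<in>UNIV. choi UNIV N (i, p) (j, q) * (X i j * matrix_unit p q k l))"
      unfolding UNIV_Times_UNIV[symmetric] sum.cartesian_product' by (simp add: unit_map_def)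
    also have "\<dots> = (\<Sum>i\<in>UNIV. \<Sum>j\<in>UNIV. \<Sum>p\<in>UNIV. \<Sum>q\<in>UNIV. matrix_unit k l p q * (X i j * choi UNIV N (i, p) (j, q)))"
      by (intro sum.cong refl, subst sum.swap) (auto simp: matrix_unit_def intro!: sum.cong)
    also have "\<dots> = N X k l"
      using linear_maps_choi[OF assms(2), of X k l] by (simp add: sum_matrix_unit)
    finally show "N X k l = (\<Sum>t\<in>UNIV. choi UNIV N (fst t) (snd t) * unit_map (fst t) (snd t) X k l)" by simp
  qed
  then have "\<Theta> N = \<Theta> (\<lambda>X i j. \<Sum>t\<in>UNIV. choi UNIV N (fst t) (snd t) * unit_map (fst t) (snd t) X i j)"
    by simp
  also have "\<dots> = (\<lambda>X i j. \<Sum>t\<in>UNIV. choi UNIV N (fst t) (snd t) * \<Theta> (unit_map (fst t) (snd t)) X i j)"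
    by (rule linear_super_sum[OF assms(1)]) (auto intro: unit_map_linear)
  finally have *: "\<Theta> N = (\<lambda>X i j. \<Sum>t\<in>UNIV. choi UNIV N (fst t) (snd t) * \<Theta> (unit_map (fst t) (snd t)) X i j)" .
  show ?thesis
    unfolding * by (simp add: choi_def super_choi_def case_prod_unfold sum.cartesian_product mult.commute)
qed

lemma tensor_unit_lin:
  fixes N :: "('c0 \<times> 'a0) opr \<Rightarrow> ('c1 \<times> 'a1) opr"
  assumes "N \<in> linear_maps (C0 \<times> UNIV) (C1 \<times> UNIV)" "i \<in> C0" "i' \<in> C0"
  shows "(\<lambda>\<rho> a a'. N (matrix_unit i i' \<otimes>\<^sub>o \<rho>) (k, a) (k', a')) \<in> linear_maps UNIV UNIV"
proof -
  have op: "matrix_unit i i' \<otimes>\<^sub>o \<rho> \<in> opers (C0 \<times> UNIV)" for \<rho> :: "'a0 opr"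
    using assms by (auto simp: opers_def op_tensor_def matrix_unit_def)
  have "matrix_unit i i' \<otimes>\<^sub>o (\<lambda>r s. c * X r s + Y r s) =
     (\<lambda>p q. c * (matrix_unit i i' \<otimes>\<^sub>o X) p q + (matrix_unit i i' \<otimes>\<^sub>o Y) p q)" for c and X Y :: "'a0 opr"
    by (auto simp: op_tensor_def fun_eq_iff algebra_simps)
  then show ?thesis
    using linear_maps_lin[OF assms(1) op op] by (simp add: linear_maps_def)
qed

lemma matrix_unit_tensor: "matrix_unit i i' \<otimes>\<^sub>o matrix_unit r s = matrix_unit (i, r) (i', s)"
  by (auto simp: op_tensor_def matrix_unit_def fun_eq_iff)

lemma id_super_linear:
  fixes \<Theta> :: "('a0 opr \<Rightarrow> 'a1 opr) \<Rightarrow> ('b0 opr \<Rightarrow> 'b1 opr)"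
    and N :: "('c0 \<times> 'a0) opr \<Rightarrow> ('c1 \<times> 'a1) opr"
  assumes "linear_super \<Theta>" "N \<in> linear_maps (C0 \<times> UNIV) (C1 \<times> UNIV)"
  shows "id_super C0 \<Theta> N \<in> linear_maps (C0 \<times> UNIV) (C1 \<times> UNIV)"
  unfolding linear_maps_def
proof (intro CollectI conjI ballI allI)
  fix X :: "('c0 \<times> 'b0) opr" assume "X \<in> opers (C0 \<times> UNIV)"
  show "id_super C0 \<Theta> N X \<in> opers (C1 \<times> UNIV)"
  proof -
    have "id_super C0 \<Theta> N X (k, b) (k', b') = 0" if k: "k \<notin> C1 \<or> k' \<notin> C1" for k b k' b'
    proof -
      have "(\<lambda>\<rho> a a'. N (matrix_unit i i' \<otimes>\<^sub>o \<rho>) (k, a) (k', a')) = (\<lambda>\<rho> a a'. 0)"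
        if i: "i \<in> C0" "i' \<in> C0" for i i'
      proof (intro ext)
        fix \<rho> :: "'a0 opr" and a a'
        have op: "matrix_unit i i' \<otimes>\<^sub>o \<rho> \<in> opers (C0 \<times> UNIV)" 
          using i by (auto simp: opers_def op_tensor_def matrix_unit_def)
        then show "N (matrix_unit i i' \<otimes>\<^sub>o \<rho>) (k, a) (k', a') = 0"
          using linear_maps_opers[OF assms(2) op] k by (auto simp: opers_def)
      qed
      then show ?thesis
        by (simp add: id_super_def linear_super_0[OF assms(1)])
    qed
    then show ?thesis by (auto simp: opers_def)
  qed
next
  fix X Y :: "('c0 \<times> 'b0) opr" and c assume "X \<in> opers (C0 \<times> UNIV)" "Y \<in> opers (C0 \<times> UNIV)"
  have "\<Theta> (\<lambda>\<rho> a a'. N (matrix_unit i i' \<otimes>\<^sub>o \<rho>) (k, a) (k', a')) (\<lambda>r s. c * X (i, r) (i', s) + Y (i, r) (i', s)) =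
    (\<lambda>b b'. c * \<Theta> (\<lambda>\<rho> a a'. N (matrix_unit i i' \<otimes>\<^sub>o \<rho>) (k, a) (k', a')) (\<lambda>r s. X (i, r) (i', s)) b b' +
      \<Theta> (\<lambda>\<rho> a a'. N (matrix_unit i i' \<otimes>\<^sub>o \<rho>) (k, a) (k', a')) (\<lambda>r s. Y (i, r) (i', s)) b b')"
    if "i \<in> C0" "i' \<in> C0" for i i' k k'
    by (rule linear_maps_lin[OF linear_super_linear[OF assms(1) tensor_unit_lin[OF assms(2) that]]]) simp_all
  then show "id_super C0 \<Theta> N (\<lambda>i j. c * X i j + Y i j) = (\<lambda>i j. c * id_super C0 \<Theta> N X i j + id_super C0 \<Theta> N Y i j)"
    by (auto simp: id_super_def fun_eq_iff sum_distrib_left sum.distrib)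
qed

text \<open>The labels of C are spectators: on the matrix unit only the coefficient map at (i, i')
  survives, and J contracts its Choi operator.\<close>

lemma choi_id_super:
  fixes \<Theta> :: "('a0::finite opr \<Rightarrow> 'a1::finite opr) \<Rightarrow> ('b0::finite opr \<Rightarrow> 'b1::finite opr)"
  assumes "linear_super \<Theta>" "N \<in> linear_maps (C0 \<times> UNIV) (C1 \<times> UNIV)" "finite C0" "i \<in> C0" "i' \<in> C0"
  shows "choi (C0 \<times> UNIV) (id_super C0 \<Theta> N) ((i, b0), (k, b1)) ((i', b0'), (k', b1')) =
    (\<Sum>a\<in>UNIV. \<Sum>a'\<in>UNIV. super_choi \<Theta> (a, (b0, b1)) (a', (b0', b1')) *
       choi (C0 \<times> UNIV) N ((i, fst a), (k, snd a)) ((i', fst a'), (k', snd a')))"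
proof -
  let ?N = "\<lambda>j j' \<rho> a a'. N (matrix_unit j j' \<otimes>\<^sub>o \<rho>) (k, a) (k', a')"
  have lin: "\<Theta> (?N j j') \<in> linear_maps UNIV UNIV" if "j \<in> C0" "j' \<in> C0" for j j'
    by (rule linear_super_linear[OF assms(1) tensor_unit_lin[OF assms(2) that]])
  have z: "\<Theta> (?N j j') (\<lambda>r s. 0) = (\<lambda>b b'. 0)" if "j \<in> C0" "j' \<in> C0" for j j'
    by (rule linear_maps_0[OF lin[OF that]])
  have m: "(\<lambda>r s. matrix_unit (i, b0) (i', b0') (j, r) (j', s)) =
    (if j = i \<and> j' = i' then matrix_unit b0 b0' else (\<lambda>r s. 0))" for j j'
    by (auto simp: matrix_unit_def fun_eq_iff)
  have "choi (C0 \<times> UNIV) (id_super C0 \<Theta> N) ((i, b0), (k, b1)) ((i', b0'), (k', b1')) =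
    (\<Sum>j\<in>C0. \<Sum>j'\<in>C0. \<Theta> (?N j j') (if j = i \<and> j' = i' then matrix_unit b0 b0' else (\<lambda>r s. 0)) b1 b1')"
    using assms(4,5) by (simp add: choi_def id_super_def m)
  also have "\<dots> = (\<Sum>j\<in>C0. \<Sum>j'\<in>C0. if j' = i' then if j = i then \<Theta> (?N i i') (matrix_unit b0 b0') b1 b1' else 0 else 0)"
    by (intro sum.cong refl) (auto simp: z)
  also have "\<dots> = choi UNIV (\<Theta> (?N i i')) (b0, b1) (b0', b1')"
    using assms(3-5) by (simp add: choi_def)
  also have "\<dots> = (\<Sum>a\<in>UNIV. \<Sum>a'\<in>UNIV. super_choi \<Theta> (a, (b0, b1)) (a', (b0', b1')) * choi UNIV (?N i i') a a')"
    by (rule super_choi_apply[OF assms(1) tensor_unit_lin[OF assms(2,4,5)]])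
  finally show ?thesis
    using assms(4,5) by (simp add: choi_def case_prod_unfold matrix_unit_tensor)
qed

text \<open>Once the labels of C0 and C1 are collected in one factor, the Choi operator of the image
  is the link product of that of N with J.\<close>

lemma id_super_cp:
  fixes \<Theta> :: "('a0::finite opr \<Rightarrow> 'a1::finite opr) \<Rightarrow> ('b0::finite opr \<Rightarrow> 'b1::finite opr)"
  assumes "linear_super \<Theta>" "super_choi \<Theta> \<in> psd UNIV" "finite C0" "finite C1"
    and "N \<in> cp_maps (C0 \<times> UNIV) (C1 \<times> UNIV)"
  shows "id_super C0 \<Theta> N \<in> cp_maps (C0 \<times> UNIV) (C1 \<times> UNIV)"
proof -
  have N: "N \<in> linear_maps (C0 \<times> UNIV) (C1 \<times> UNIV)"
    and C: "choi (C0 \<times> UNIV) N \<in> psd ((C0 \<times> UNIV) \<times> (C1 \<times> UNIV))"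
    using assms by (simp_all add: cp_maps_choi)
  define X where "X = (\<lambda>((i, k), a) ((i', k'), a'). choi (C0 \<times> UNIV) N ((i, fst a), (k, snd a)) ((i', fst a'), (k', snd a')))"
  have X: "X \<in> psd ((C0 \<times> C1) \<times> UNIV)"
    by (rule psd_relabel_on[OF C, where f = "\<lambda>((i, k), a). ((i, fst a), (k, snd a))"])
      (use assms psd_nonzero[OF C] in \<open>auto simp: X_def\<close>)
  have "super_choi \<Theta> \<in> psd (UNIV \<times> UNIV)"
    using assms by simp
  note L = psd_link[OF X this]
  define Y where "Y = (\<lambda>(p, r) (p', r'). \<Sum>q\<in>UNIV. \<Sum>q'\<in>UNIV. X (p, q) (p', q') * super_choi \<Theta> (q, r) (q', r'))"
  have L: "Y \<in> psd ((C0 \<times> C1) \<times> UNIV)"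
    using L assms unfolding Y_def by simp
  have "choi (C0 \<times> UNIV) (id_super C0 \<Theta> N) \<in> psd ((C0 \<times> UNIV) \<times> (C1 \<times> UNIV))"
  proof (rule psd_relabel_on[OF L, where f = "\<lambda>((i, b0), (k, b1)). ((i, k), (b0, b1))"])
    fix j j' assume "j \<in> (C0 \<times> (UNIV :: 'b0 set)) \<times> C1 \<times> (UNIV :: 'b1 set)" "j' \<in> (C0 \<times> (UNIV :: 'b0 set)) \<times> C1 \<times> (UNIV :: 'b1 set)"
    then obtain i b0 k b1 i' b0' k' b1' where j: "j = ((i, b0), (k, b1))" "j' = ((i', b0'), (k', b1'))"
      and i: "i \<in> C0" "i' \<in> C0" by auto
    show "choi (C0 \<times> UNIV) (id_super C0 \<Theta> N) j j' =
      Y (case j of (x, xa) \<Rightarrow> (case x of (i, b0) \<Rightarrow> \<lambda>(k, b1). ((i, k), b0, b1)) xa)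
        (case j' of (x, xa) \<Rightarrow> (case x of (i, b0) \<Rightarrow> \<lambda>(k, b1). ((i, k), b0, b1)) xa)"
      unfolding j split_conv choi_id_super[OF assms(1) N assms(3) i] by (simp add: X_def Y_def mult.commute)
  qed (use assms opers_zero[OF choi_opers[OF id_super_linear[OF assms(1) N]]] in auto)
  then show ?thesis
    using assms id_super_linear[OF assms(1) N] by (simp add: cp_maps_choi)
qed

text \<open>Apply the superchannel to one half of the map whose Choi operator is maximally entangled.\<close>

lemma superchannel_psd:
  fixes \<Theta> :: "('a0::finite opr \<Rightarrow> 'a1::finite opr) \<Rightarrow> ('b0::finite opr \<Rightarrow> 'b1::finite opr)"
  assumes "superchannel \<Theta>"
  shows "super_choi \<Theta> \<in> psd UNIV"
proof -
  let ?m = "CARD('a0)" and ?n = "CARD('a1)"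
  have lin: "linear_super \<Theta>" using assms by (simp add: superchannel_def)
  obtain h :: "'a0 \<Rightarrow> nat" where h: "bij_betw h UNIV {..<?m}"
    using ex_bij_betw_finite_nat[OF finite_class.finite_UNIV] by (auto simp: atLeast0LessThan)
  obtain g :: "'a1 \<Rightarrow> nat" where g: "bij_betw g UNIV {..<?n}"
    using ex_bij_betw_finite_nat[OF finite_class.finite_UNIV] by (auto simp: atLeast0LessThan)
  have hi: "h a = h a' \<longleftrightarrow> a = a'" "h a < ?m" for a a'
    using h bij_betw_apply[OF h] by (auto simp: bij_betw_def inj_def)
  have gi: "g a = g a' \<longleftrightarrow> a = a'" "g a < ?n" for a a'
    using g bij_betw_apply[OF g] by (auto simp: bij_betw_def inj_def)
  \<comment> \<open>A maximally entangled vector between A0 A1 and its copy in C, where the copy is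
    made along the numberings h and g of the labels.\<close>
  define u where "u = (\<lambda>((i, a0), (k, a1)). if i = h a0 \<and> k = g a1 then 1 else 0 :: complex)"
  let ?C0 = "{..<?m}" and ?C1 = "{..<?n}"
  define N where "N = (\<lambda>X k l. \<Sum>i\<in>?C0 \<times> UNIV. \<Sum>j\<in>?C0 \<times> UNIV. X i j * rank1 u (i, k) (j, l))"
  have N: "N \<in> linear_maps (?C0 \<times> UNIV) (?C1 \<times> UNIV)"
    unfolding linear_maps_def
  proof (intro CollectI conjI ballI allI)
    fix X show "N X \<in> opers (?C1 \<times> UNIV)"
      using gi by (auto simp: opers_def N_def rank1_def u_def intro!: sum.neutral)
  qed (simp add: N_def algebra_simps sum.distrib sum_distrib_left)
  have C: "choi (?C0 \<times> UNIV) N = rank1 u"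
  proof (intro ext)
    fix p q
    show "choi (?C0 \<times> UNIV) N p q = rank1 u p q"
    proof (cases p, cases q)
      fix i k j l assume p: "p = (i, k)" "q = (j, l)"
      show ?thesis
      proof (cases "i \<in> ?C0 \<times> UNIV \<and> j \<in> ?C0 \<times> UNIV")
        case True
        then show ?thesis by (simp add: p choi_def N_def sum_matrix_unit)
      next
        case False
        then show ?thesis using hi by (cases i; cases j; cases k; cases l) (auto simp: p choi_def rank1_def u_def)
      qed
    qed
  qed
  have "N \<in> cp_maps (?C0 \<times> UNIV) (?C1 \<times> UNIV)"
    using N unfolding cp_maps_choi[OF finite_cartesian_product[OF finite_lessThan finite_class.finite_UNIV] finite_cartesian_product[OF finite_lessThan finite_class.finite_UNIV]] C
    using hi gi by (auto intro!: psd_rank1 simp: u_def split: if_splits)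
  then have "id_super ?C0 \<Theta> N \<in> cp_maps (?C0 \<times> UNIV) (?C1 \<times> UNIV)"
    using assms by (simp add: superchannel_def)
  then have P: "choi (?C0 \<times> UNIV) (id_super ?C0 \<Theta> N) \<in> psd ((?C0 \<times> UNIV) \<times> (?C1 \<times> UNIV))"
    by (simp add: cp_maps_choi)
  show ?thesis
  proof (rule psd_relabel_on[OF P, where f = "\<lambda>((a0, a1), (b0, b1)). ((h a0, b0), (g a1, b1))"])
    fix j j' :: "('a0 \<times> 'a1) \<times> ('b0 \<times> 'b1)"
    obtain a0 a1 b0 b1 a0' a1' b0' b1' where j: "j = ((a0, a1), (b0, b1))" "j' = ((a0', a1'), (b0', b1'))"
      by (metis surj_pair)
    have hC: "h a \<in> ?C0" for a using hi by simp
    \<comment> \<open>At the C labels coming from (a0, a1) and (a0', a1') the Choi operator of N is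
      a matrix unit on A, so the contraction picks out a single entry of J.\<close>
    have "choi (?C0 \<times> UNIV) (id_super ?C0 \<Theta> N) ((h a0, b0), (g a1, b1)) ((h a0', b0'), (g a1', b1')) =
      (\<Sum>a\<in>UNIV. \<Sum>a'\<in>UNIV. super_choi \<Theta> (a, (b0, b1)) (a', (b0', b1')) * matrix_unit (a0, a1) (a0', a1') a a')"
      unfolding choi_id_super[OF lin N finite_lessThan hC hC] C
      by (intro sum.cong refl arg_cong2[where f = "(*)"])
        (auto simp: rank1_def u_def matrix_unit_def hi gi prod_eq_iff)
    then show "super_choi \<Theta> j j' = choi (?C0 \<times> UNIV) (id_super ?C0 \<Theta> N)
       (case j of (x, xa) \<Rightarrow> (case x of (a0, a1) \<Rightarrow> \<lambda>(b0, b1). ((h a0, b0), g a1, b1)) xa)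
       (case j' of (x, xa) \<Rightarrow> (case x of (a0, a1) \<Rightarrow> \<lambda>(b0, b1). ((h a0, b0), g a1, b1)) xa)"
      by (simp add: j sum_matrix_unit)
  qed (use hi gi in auto)
qed

text \<open>Superchannels are only required to respect trace preservation, an affine condition;
  adding a multiple of one fixed trace-preserving map reduces scaling by c to it.\<close>

lemma superchannel_trace_scaling:
  fixes \<Theta> :: "('a0::finite opr \<Rightarrow> 'a1::finite opr) \<Rightarrow> ('b0::finite opr \<Rightarrow> 'b1::finite opr)"
  assumes "superchannel \<Theta>" "N \<in> linear_maps UNIV UNIV" "\<And>X. tr (N X) = c * tr X"
  shows "tr (\<Theta> N X) = c * tr X"
proof -
  define e :: 'a1 where "e = undefined"
  \<comment> \<open>Discard and prepare, a trace-preserving map between any two systems; (1 - c) D +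
    N is then trace preserving for every complex c, including 0.\<close>
  define D where "D = (\<lambda>(X :: 'a0 opr) i j. tr X * matrix_unit e e i j)"
  have D: "D \<in> linear_maps UNIV UNIV"
    by (auto simp: linear_maps_def D_def tr_def algebra_simps sum.distrib sum_distrib_left)
  have "tr (matrix_unit e e) = 1"
    by (simp add: tr_def matrix_unit_def)
  then have Dt: "tr (D X) = tr X" for X
    by (simp add: D_def tr_def flip: sum_distrib_left)
  have lin: "linear_super \<Theta>" and tp: "\<And>N. N \<in> linear_maps UNIV UNIV \<Longrightarrow> trace_preserving N \<Longrightarrow> trace_preserving (\<Theta> N)"
    using assms by (auto simp: superchannel_def)
  define M where "M = (\<lambda>X i j. (1 - c) * D X i j + N X i j)"
  have M: "M \<in> linear_maps UNIV UNIV"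
    using linear_maps_lin[OF D] linear_maps_lin[OF assms(2)] by (auto simp: linear_maps_def M_def algebra_simps)
  have trM: "tr (M X) = (1 - c) * tr (D X) + tr (N X)" for X
    by (simp add: M_def tr_def sum.distrib sum_distrib_left)
  have "trace_preserving M"
    using assms(3) Dt trM by (simp add: trace_preserving_def algebra_simps)
  then have "tr (\<Theta> M X) = tr X" "tr (\<Theta> D X) = tr X"
    using tp[OF M] tp[OF D] Dt by (auto simp: trace_preserving_def)
  moreover have "tr (\<Theta> M X) = (1 - c) * tr (\<Theta> D X) + tr (\<Theta> N X)"
    unfolding M_def linear_super_lin[OF lin D assms(2)] by (simp add: tr_def sum.distrib sum_distrib_left)
  ultimately show ?thesis by (simp add: algebra_simps)
qed

definition super_of :: "(('a0::finite \<times> 'a1::finite) \<times> ('b0::finite \<times> 'b1)) opr \<Rightarrow> ('a0 opr \<Rightarrow> 'a1 opr) \<Rightarrow> ('b0 opr \<Rightarrow> 'b1 opr)" where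
  "super_of J N = of_choi (\<lambda>b b'. \<Sum>a\<in>UNIV. \<Sum>a'\<in>UNIV. J (a, b) (a', b') * choi UNIV N a a')"

lemma linear_super_of: "linear_super (super_of J)"
proof -
  have "of_choi (\<lambda>i j. c * X i j + Y i j) = (\<lambda>Z i j. c * of_choi X Z i j + of_choi Y Z i j)" for c and X Y :: "('c \<times> 'd) opr"
    by (simp add: of_choi_def algebra_simps sum.distrib sum_distrib_left)
  moreover have "choi UNIV (\<lambda>X i j. c * N X i j + M X i j) = (\<lambda>i j. c * choi UNIV N i j + choi UNIV M i j)" for c and N M :: "'a opr \<Rightarrow> 'b opr"
    by (auto simp: choi_def fun_eq_iff)
  moreover have "(\<lambda>b b'. \<Sum>a\<in>UNIV. \<Sum>a'\<in>UNIV. J (a, b) (a', b') * (c * X a a' + Y a a')) =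
    (\<lambda>b b'. c * (\<Sum>a\<in>UNIV. \<Sum>a'\<in>UNIV. J (a, b) (a', b') * X a a') +
      (\<Sum>a\<in>UNIV. \<Sum>a'\<in>UNIV. J (a, b) (a', b') * Y a a'))" for c and X Y :: "('a \<times> 'b) opr"
    by (simp add: algebra_simps sum.distrib sum_distrib_left)
  ultimately show ?thesis
    by (simp add: linear_super_def super_of_def of_choi_linear)
qed

lemma super_choi_super_of: "super_choi (super_of J) = J"
proof -
  have *: "choi UNIV (unit_map a a') = matrix_unit a a'" for a a' :: "'a \<times> 'b"
    by (cases a; cases a') (auto simp: choi_def unit_map_def matrix_unit_def fun_eq_iff)
  show ?thesis
    unfolding super_choi_def super_of_def choi_of_choi * by (auto simp: sum_matrix_unit fun_eq_iff)
qed

text \<open>The hypotheses read Tr_B1 J = I^A1 \<otimes> L and Tr_A0 L = I^B0. For a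
  trace-preserving N the identity on A1 traces its Choi operator to I^A0, and pairing L with I^A0 is
  the trace over A0.\<close>

lemma superchannel_super_of:
  fixes J :: "(('a0::finite \<times> 'a1::finite) \<times> ('b0::finite \<times> 'b1::finite)) opr"
  assumes "J \<in> psd UNIV"
    and L: "\<And>a0 a1 b0 a0' a1' b0'. (\<Sum>b1\<in>UNIV. J ((a0, a1), (b0, b1)) ((a0', a1'), (b0', b1))) = id_op a1 a1' * L a0 b0 a0' b0'"
    and L': "\<And>b0 b0'. (\<Sum>a0\<in>UNIV. L a0 b0 a0 b0') = id_op b0 b0'"
  shows "superchannel (super_of J)"
  unfolding superchannel_def
proof (intro conjI allI ballI impI linear_super_of)
  fix m n :: nat and N :: "(nat \<times> 'a0) opr \<Rightarrow> (nat \<times> 'a1) opr"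
  assume "N \<in> cp_maps ({..<m} \<times> UNIV) ({..<n} \<times> UNIV)"
  then show "id_super {..<m} (super_of J) N \<in> cp_maps ({..<m} \<times> UNIV) ({..<n} \<times> UNIV)"
    using assms(1) by (intro id_super_cp) (simp_all add: linear_super_of super_choi_super_of)
next
  fix N :: "'a0 opr \<Rightarrow> 'a1 opr" assume N: "N \<in> linear_maps UNIV UNIV" "trace_preserving N"
  then have t: "(\<Sum>k\<in>UNIV. choi UNIV N (i, k) (j, k)) = id_op i j" for i j
    by (simp add: trace_preserving_choi)
  have "(\<Sum>k\<in>UNIV. choi UNIV (super_of J N) (i, k) (j, k)) = id_op i j" for i j
  proof -
    have "(\<Sum>k\<in>UNIV. choi UNIV (super_of J N) (i, k) (j, k)) =
      (\<Sum>a\<in>UNIV. \<Sum>k\<in>UNIV. \<Sum>a'\<in>UNIV. J (a, (i, k)) (a', (j, k)) * choi UNIV N a a')"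
      unfolding super_of_def choi_of_choi by (rule sum.swap)
    also have "\<dots> = (\<Sum>a\<in>UNIV. \<Sum>a'\<in>UNIV. (\<Sum>k\<in>UNIV. J (a, (i, k)) (a', (j, k))) * choi UNIV N a a')"
      unfolding sum_distrib_right by (intro sum.cong refl, rule sum.swap)
    also have "\<dots> = (\<Sum>a0\<in>UNIV. \<Sum>a1\<in>UNIV. \<Sum>a0'\<in>UNIV. L a0 i a0' j * choi UNIV N (a0, a1) (a0', a1))"
      unfolding UNIV_Times_UNIV[symmetric] sum.cartesian_product' L id_op_def
      by (simp add: if_distrib if_distribR cong: if_cong)
    also have "\<dots> = (\<Sum>a0\<in>UNIV. \<Sum>a0'\<in>UNIV. L a0 i a0' j * (\<Sum>a1\<in>UNIV. choi UNIV N (a0, a1) (a0', a1)))"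
      unfolding sum_distrib_left by (intro sum.cong refl, rule sum.swap)
    also have "\<dots> = (\<Sum>a0\<in>UNIV. L a0 i a0 j)"
      unfolding t by (simp add: id_op_def if_distrib if_distribR cong: if_cong)
    finally show ?thesis using L' by simp
  qed
  then show "trace_preserving (super_of J N)"
    unfolding trace_preserving_choi[OF linear_super_linear[OF linear_super_of N(1)]] by blast
qed

section \<open>Contractions, tensor products and bounds for positive operators\<close>

lemma psd_contract:
  fixes X :: "'q::finite opr" and C :: "('q \<times> 'r::finite) opr"
  assumes "X \<in> psd UNIV" "C \<in> psd UNIV"
  shows "(\<lambda>r r'. \<Sum>q\<in>UNIV. \<Sum>q'\<in>UNIV. X q q' * C (q, r) (q', r')) \<in> psd UNIV"
proof -
  have "relabel (snd :: unit \<times> 'q \<Rightarrow> 'q) X \<in> psd (UNIV \<times> UNIV)" "C \<in> psd (UNIV \<times> UNIV)"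
    using psd_relabel[OF assms(1)] assms(2) by auto
  from psd_link[OF this] have "(\<lambda>(p :: unit, r) (p' :: unit, r'). \<Sum>q\<in>UNIV. \<Sum>q'\<in>UNIV. X q q' * C (q, r) (q', r')) \<in> psd UNIV"
    by (simp add: relabel_def)
  from psd_relabel[OF this, of "\<lambda>r. ((), r)"] show ?thesis
    by (simp add: relabel_def)
qed

lemma psd_tensor:
  fixes X :: "'p::finite opr" and Y :: "'r::finite opr"
  assumes "X \<in> psd UNIV" "Y \<in> psd UNIV"
  shows "X \<otimes>\<^sub>o Y \<in> psd UNIV"
proof -
  have "relabel (fst :: 'p \<times> unit \<Rightarrow> 'p) X \<in> psd (UNIV \<times> UNIV)" "relabel (snd :: unit \<times> 'r \<Rightarrow> 'r) Y \<in> psd (UNIV \<times> UNIV)"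
    using psd_relabel[OF assms(1)] psd_relabel[OF assms(2)] by auto
  from psd_link[OF this] show ?thesis
    by (simp add: relabel_def op_tensor_def UNIV_unit)
qed

lemma psd_transpose:
  fixes X :: "'p::finite opr"
  assumes "X \<in> psd UNIV"
  shows "(\<lambda>i j. X j i) \<in> psd UNIV"
proof (rule psdI)
  fix v
  have "quad UNIV (\<lambda>i j. X j i) v = quad UNIV X (\<lambda>i. cnj (v i))"
    unfolding quad_def by (subst sum.swap) (simp add: mult_ac)
  then show "quad UNIV (\<lambda>i j. X j i) v \<in> \<real>\<^sub>\<ge>\<^sub>0"
    using assms by (simp add: psd_quad)
qed simp

text \<open>In a decomposition into rank-one operators every product of two components is at most a
  squared norm, and the squared norms add up to the trace. This makes slices of the cone bounded and
  positive operators of trace 0 vanish.\<close>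

lemma psd_entry_le_trace:
  fixes X :: "'i::finite opr"
  assumes "X \<in> psd UNIV"
  shows "cmod (X i j) \<le> Re (tr X)"
proof -
  obtain n :: nat and w where w: "X = (\<lambda>i j. \<Sum>t<n. rank1 (w t) i j)"
    using psd_decomp[OF finite assms] by blast
  have "cmod (X i j) \<le> (\<Sum>t<n. cmod (w t i) * cmod (w t j))"
    unfolding w rank1_def by (rule order_trans[OF norm_sum]) (simp add: norm_mult)
  also have "\<dots> \<le> (\<Sum>t<n. \<Sum>k\<in>UNIV. (cmod (w t k))\<^sup>2)"
  proof (rule sum_mono)
    fix t
    have "cmod (w t k) \<le> sqrt (\<Sum>k\<in>UNIV. (cmod (w t k))\<^sup>2)" for k
      by (rule real_le_rsqrt, rule member_le_sum[of k UNIV "\<lambda>k. (cmod (w t k))\<^sup>2"]) auto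
    then have "cmod (w t i) * cmod (w t j) \<le> sqrt (\<Sum>k\<in>UNIV. (cmod (w t k))\<^sup>2) * sqrt (\<Sum>k\<in>UNIV. (cmod (w t k))\<^sup>2)"
      by (intro mult_mono) (auto intro: sum_nonneg)
    then show "cmod (w t i) * cmod (w t j) \<le> (\<Sum>k\<in>UNIV. (cmod (w t k))\<^sup>2)"
      by (simp add: sum_nonneg)
  qed
  also have "\<dots> = Re (tr X)"
    unfolding tr_def w rank1_def by (subst sum.swap) (simp add: complex_mult_cnj cmod_power2)
  finally show ?thesis .
qed

lemma hermitian_cnj: "hermitian X \<Longrightarrow> cnj (X i j) = X j i"
  unfolding hermitian_def by metis

lemma hermitianI: "(\<And>i j. cnj (X i j) = X j i) \<Longrightarrow> hermitian X"
  by (simp add: hermitian_def)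

lemma hermitian_quad_real:
  fixes H :: "'i::finite opr"
  assumes "hermitian H"
  shows "Im (quad UNIV H v) = 0"
proof -
  have "cnj (quad UNIV H v) = (\<Sum>i\<in>UNIV. \<Sum>j\<in>UNIV. cnj (v j) * H j i * v i)"
    using assms by (simp add: quad_def hermitian_cnj mult_ac)
  also have "\<dots> = quad UNIV H v"
    unfolding quad_def by (rule sum.swap)
  finally show ?thesis by (simp add: complex_eq_iff)
qed

lemma psd_imp_hermitian: "X \<in> psd UNIV \<Longrightarrow> hermitian X" for X :: "'i::finite opr"
  unfolding hermitian_def using psd_hermitian[OF _ finite] by blast

text \<open>A crude bound suffices: |v_i| |v_j| is at most the squared norm of v, so the sum of the
  absolute values of all entries controls the form. It supplies feasible points of the program and
  positive members of the instrument family.\<close>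

lemma hermitian_shift_psd:
  fixes H :: "'i::finite opr"
  assumes "hermitian H" "(\<Sum>i\<in>UNIV. \<Sum>j\<in>UNIV. cmod (H i j)) \<le> c"
  shows "(\<lambda>i j. of_real c * id_op i j + H i j) \<in> psd UNIV"
proof (rule psdI)
  fix v :: "'i \<Rightarrow> complex"
  define s where "s = (\<Sum>k\<in>UNIV. (cmod (v k))\<^sup>2)"
  have s0: "s \<ge> 0" by (simp add: s_def sum_nonneg)
  have le: "cmod (v k) \<le> sqrt s" for k
    unfolding s_def by (rule real_le_rsqrt, rule member_le_sum[of k UNIV "\<lambda>k. (cmod (v k))\<^sup>2"]) auto
  have "cmod (quad UNIV H v) \<le> (\<Sum>i\<in>UNIV. \<Sum>j\<in>UNIV. cmod (H i j) * s)"
    unfolding quad_def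
  proof (intro order_trans[OF norm_sum] sum_mono)
    fix i j
    have "cmod (v i) * cmod (v j) \<le> sqrt s * sqrt s"
      using le s0 by (intro mult_mono) auto
    then have "cmod (H i j) * (cmod (v i) * cmod (v j)) \<le> cmod (H i j) * s"
      using s0 by (intro mult_left_mono) auto
    then show "cmod (cnj (v i) * H i j * v j) \<le> cmod (H i j) * s"
      by (simp add: norm_mult mult_ac)
  qed
  also have "\<dots> \<le> c * s"
    using assms(2) s0 by (simp add: mult_right_mono flip: sum_distrib_right)
  finally have "cmod (quad UNIV H v) \<le> c * s" .
  then have "- Re (quad UNIV H v) \<le> c * s"
    using abs_Re_le_cmod[of "quad UNIV H v"] by linarith
  moreover have "quad UNIV id_op v = of_real s"
    by (simp add: quad_def id_op_def s_def if_distrib if_distribR mult.commute cong: if_cong)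
      (simp only: complex_norm_square flip: of_real_power)
  ultimately show "quad UNIV (\<lambda>i j. of_real c * id_op i j + H i j) v \<in> \<real>\<^sub>\<ge>\<^sub>0"
    using hermitian_quad_real[OF assms(1), of v] by (simp add: quad_add quad_scale complex_nonneg_Reals_iff)
qed simp

section \<open>The semidefinite program of the min-entropy\<close>

text \<open>The operator \<gamma> \<otimes> I^B1, with B1 grouped with B0 as in
  \<open>choi_state\<close>.\<close>

definition ampl :: "('a \<times> 'b0) opr \<Rightarrow> ('a \<times> ('b0 \<times> 'b1)) opr" where
  "ampl \<gamma> = (\<lambda>(a, (b0, b1)) (a', (b0', b1')). \<gamma> (a, b0) (a', b0') * id_op b1 b1')"

lemma choi_state_eq:
  "choi_state \<Omega> ((a0, a1), (b0, b1)) ((a0', a1'), (b0', b1')) =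
    \<Omega> (matrix_unit (a0, b0) (a0', b0')) (a1, b1) (a1', b1') / (of_nat CARD('a0) * of_nat CARD('b0))"
  for \<Omega> :: "('a0::finite \<times> 'b0::finite) opr \<Rightarrow> ('a1 \<times> 'b1) opr"
proof -
  have ph: "phi_plus (a, b) (a', b') = (if a = b \<and> a' = b' then 1 else 0)" for a b a' b' :: "'c::finite"
  proof -
    have "phi_plus (a, b) (a', b') = (\<Sum>i\<in>UNIV. \<Sum>j\<in>UNIV. if j = a' then if i = a then if a = b \<and> a' = b' then 1 else 0 else 0 else 0)"
      unfolding phi_plus_def by (intro sum.cong refl) (auto simp: op_tensor_def matrix_unit_def)
    then show ?thesis by simp
  qed
  have "(\<lambda>k k'. relabel (\<lambda>((a, b), (a', b')). ((a, a'), (b, b'))) (phi_plus \<otimes>\<^sub>o phi_plus) ((a0, b0), k) ((a0', b0'), k')) =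
    matrix_unit (a0, b0) (a0', b0')"
    by (auto simp: relabel_def op_tensor_def ph matrix_unit_def fun_eq_iff)
  then show ?thesis
    by (simp add: choi_state_def relabel_def[of "\<lambda>((a0, a1), (b0, b1)). ((a0, b0), (a1, b1))"] map_tensor_def)
qed

lemma choi_state_paired:
  fixes F :: "nat \<Rightarrow> nat \<Rightarrow> 'a0::finite opr \<Rightarrow> 'a1 opr" and \<Lambda> :: "nat \<Rightarrow> nat \<Rightarrow> 'b0::finite opr \<Rightarrow> 'b1 opr"
  assumes "\<And>x y. x \<in> {1..dX} \<Longrightarrow> y \<in> {1..dY} \<Longrightarrow> F x y \<in> linear_maps UNIV UNIV"
    and "\<And>x y. x \<in> {1..dX} \<Longrightarrow> y \<in> {1..dY} \<Longrightarrow> \<Lambda> x y \<in> linear_maps UNIV UNIV"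
  shows "choi_state (paired_map dX dY F \<Lambda>) (a, b) (a', b') =
    (\<Sum>x=1..dX. \<Sum>y=1..dY. choi UNIV (F x y) a a' * choi UNIV (\<Lambda> x y) b b') / (of_nat dX * of_nat CARD('a0) * of_nat CARD('b0))"
proof -
  obtain a0 a1 b0 b1 a0' a1' b0' b1' where j: "a = (a0, a1)" "b = (b0, b1)" "a' = (a0', a1')" "b' = (b0', b1')"
    by (metis surj_pair)
  have "(F x y \<otimes>\<^sub>m \<Lambda> x y) (matrix_unit (a0, b0) (a0', b0')) (a1, b1) (a1', b1') = choi UNIV (F x y) a a' * choi UNIV (\<Lambda> x y) b b'"
    if "x \<in> {1..dX}" "y \<in> {1..dY}" for x y
    unfolding matrix_unit_tensor[symmetric] map_tensor_op_tensor[OF assms[OF that]]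
    by (simp add: op_tensor_def choi_def j)
  then show ?thesis
    by (simp add: j choi_state_eq paired_map_def mult_ac)
qed

lemma hmin_feasible_iff:
  fixes \<Omega> :: "('a0::finite \<times> 'b0::finite) opr \<Rightarrow> ('a1::finite \<times> 'b1::finite) opr"
  shows "\<gamma> \<in> hmin_feasible \<Omega> \<longleftrightarrow> hermitian \<gamma> \<and> (\<lambda>p q. ampl \<gamma> p q - choi_state \<Omega> p q) \<in> psd UNIV \<and>
    (\<forall>a0 b0 a0' b0'. (\<Sum>a1\<in>UNIV. \<gamma> ((a0, a1), b0) ((a0', a1), b0')) =
      id_op a0 a0' / of_nat CARD('a0) * (\<Sum>a\<in>UNIV. \<gamma> (a, b0) (a, b0')))"
proof -
  have *: "relabel (\<lambda>(a, (b0, b1)). ((a, b0), b1)) (\<gamma> \<otimes>\<^sub>o id_op) = ampl \<gamma>"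
    by (auto simp: relabel_def op_tensor_def ampl_def fun_eq_iff)
  show ?thesis
    unfolding hmin_feasible_def mem_Collect_eq *
    by (simp add: ptrace_fst_def relabel_def op_tensor_def max_mixed_def fun_eq_iff)
qed

text \<open>\<gamma> \<otimes> I^B1 dominates a positive operator, and restricting it to one label
  of B1 returns \<gamma>. The constraints themselves ask only for a Hermitian \<gamma>.\<close>

lemma hmin_feasible_psd:
  fixes \<Omega> :: "('a0::finite \<times> 'b0::finite) opr \<Rightarrow> ('a1::finite \<times> 'b1::finite) opr"
  assumes "choi_state \<Omega> \<in> psd UNIV" "\<gamma> \<in> hmin_feasible \<Omega>"
  shows "\<gamma> \<in> psd UNIV"
proof -
  have "ampl \<gamma> \<in> psd (UNIV :: (('a0 \<times> 'a1) \<times> 'b0 \<times> 'b1) set)"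
    using psd_add[OF assms(1), of "\<lambda>p q. ampl \<gamma> p q - choi_state \<Omega> p q"] assms(2) by (simp add: hmin_feasible_iff)
  from psd_relabel[OF this, of "\<lambda>(a, b0). (a, (b0, undefined))"] show ?thesis
    by (simp add: relabel_def ampl_def id_op_def case_prod_unfold)
qed

text \<open>A large multiple of the identity works: its marginals are multiples of the identity, so
  the marginal condition is met.\<close>

lemma hmin_feasible_nonempty:
  fixes \<Omega> :: "('a0::finite \<times> 'b0::finite) opr \<Rightarrow> ('a1::finite \<times> 'b1::finite) opr"
  assumes "hermitian (choi_state \<Omega>)"
  shows "\<exists>\<gamma>. \<gamma> \<in> hmin_feasible \<Omega>"
proof -
  let ?H = "\<lambda>p q. - choi_state \<Omega> p q"
  define c where "c = (\<Sum>i\<in>UNIV. \<Sum>j\<in>UNIV. cmod (?H i j))"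
  have "hermitian ?H" using assms by (intro hermitianI) (simp add: hermitian_cnj)
  from hermitian_shift_psd[OF this, of c] have "(\<lambda>i j. of_real c * id_op i j + ?H i j) \<in> psd UNIV"
    by (simp add: c_def)
  moreover have "ampl (\<lambda>i j. of_real c * id_op i j) = ((\<lambda>i j. of_real c * id_op i j) :: (('a0 \<times> 'a1) \<times> ('b0 \<times> 'b1)) opr)"
    by (auto simp: ampl_def id_op_def fun_eq_iff)
  moreover have "hermitian (\<lambda>i j. of_real c * id_op i j)"
    by (simp add: hermitian_def id_op_def)
  moreover have "(\<Sum>a1\<in>(UNIV :: 'a1 set). of_real c * id_op ((a0, a1), b0) ((a0', a1), b0')) =
      id_op a0 a0' / of_nat CARD('a0) * (\<Sum>a\<in>(UNIV :: ('a0 \<times> 'a1) set). of_real c * id_op (a, b0) (a, b0'))"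
    for a0 a0' :: 'a0 and b0 b0' :: 'b0
    by (auto simp: id_op_def)
  ultimately show ?thesis
    by (intro exI[of _ "\<lambda>i j. of_real c * id_op i j"]) (simp add: hmin_feasible_iff)
qed

lemma continuous_on_tr [continuous_intros]: "continuous_on S (\<lambda>M :: complex^'i^'i. tr (\<lambda>i j. M $ i $ j))"
  unfolding tr_def by (intro continuous_intros)

text \<open>Closed as an intersection over all test vectors, bounded because the trace bounds every
  entry. The type \<open>complex^'i^'i\<close> stands in for operators because it carries the
  Euclidean topology.\<close>

lemma compact_psd:
  "compact {M :: complex^'i^'i. (\<lambda>i j. M $ i $ j) \<in> psd UNIV \<and> Re (tr (\<lambda>i j. M $ i $ j)) \<le> c}" (is "compact ?K")
proof -
  have "closed {M :: complex^'i^'i. quad UNIV (\<lambda>i j. M $ i $ j) v \<in> \<real>\<^sub>\<ge>\<^sub>0}" for v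
    unfolding quad_def
    by (rule closed_vimage[OF closed_nonneg_Reals_complex, unfolded vimage_def]) (intro continuous_intros)
  then have "closed {M :: complex^'i^'i. \<forall>v. quad UNIV (\<lambda>i j. M $ i $ j) v \<in> \<real>\<^sub>\<ge>\<^sub>0}"
    by (rule closed_Collect_all)
  moreover have "closed {M :: complex^'i^'i. Re (tr (\<lambda>i j. M $ i $ j)) \<le> c}"
    by (intro closed_Collect_le continuous_intros)
  ultimately have "closed ?K"
    by (simp add: psd_quad closed_Collect_conj)
  moreover have "bounded ?K"
    unfolding bounded_iff
  proof (intro exI ballI)
    fix M assume M: "M \<in> ?K"
    have "norm M \<le> (\<Sum>i\<in>UNIV. \<Sum>j\<in>UNIV. cmod (M $ i $ j))"
      unfolding norm_vec_def by (intro order_trans[OF L2_set_le_sum] sum_mono) (auto simp: L2_set_le_sum)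
    also have "\<dots> \<le> (\<Sum>i\<in>(UNIV::'i set). \<Sum>j\<in>(UNIV::'i set). c)"
    proof (intro sum_mono)
      fix i j
      show "cmod (M $ i $ j) \<le> c"
        using M psd_entry_le_trace[of "\<lambda>i j. M $ i $ j" i j] by auto
    qed
    finally show "norm M \<le> (\<Sum>i\<in>(UNIV::'i set). \<Sum>j\<in>(UNIV::'i set). c)" .
  qed
  ultimately show ?thesis by (simp add: compact_eq_bounded_closed)
qed

text \<open>Feasible operators are positive, so those with trace at most that of one fixed feasible
  operator form a compact set.\<close>

lemma hmin_attained:
  fixes \<Omega> :: "('a0::finite \<times> 'b0::finite) opr \<Rightarrow> ('a1::finite \<times> 'b1::finite) opr"
  assumes \<omega>: "choi_state \<Omega> \<in> psd UNIV"
  shows "\<exists>\<gamma>\<in>hmin_feasible \<Omega>. \<forall>\<gamma>'\<in>hmin_feasible \<Omega>. Re (tr \<gamma>) \<le> Re (tr \<gamma>')"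
proof -
  obtain \<gamma>0 where \<gamma>0: "\<gamma>0 \<in> hmin_feasible \<Omega>"
    using hmin_feasible_nonempty[OF psd_imp_hermitian[OF \<omega>]] by blast
  define c where "c = Re (tr \<gamma>0)"
  define op :: "complex^(('a0 \<times> 'a1) \<times> 'b0)^(('a0 \<times> 'a1) \<times> 'b0) \<Rightarrow> (('a0 \<times> 'a1) \<times> 'b0) opr"
    where "op = (\<lambda>M i j. M $ i $ j)"
  define K where "K = {M. op M \<in> psd UNIV \<and> Re (tr (op M)) \<le> c} \<inter> {M. op M \<in> hmin_feasible \<Omega>}"
  have op_surj: "\<exists>M. op M = \<gamma>" for \<gamma>
    by (rule exI[of _ "\<chi> i j. \<gamma> i j"]) (simp add: op_def fun_eq_iff)
  have K: "op M \<in> hmin_feasible \<Omega> \<and> Re (tr (op M)) \<le> c \<longleftrightarrow> M \<in> K" for M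
    using hmin_feasible_psd[OF \<omega>] by (auto simp: K_def)
  have "closed {M. hermitian (op M)}"
    unfolding hermitian_def op_def by (intro closed_Collect_all closed_Collect_eq continuous_intros)
  moreover have "closed {M. (\<lambda>p q. ampl (op M) p q - choi_state \<Omega> p q) \<in> psd UNIV}"
  proof -
    have amp: "ampl (op M) p q = M $ (fst p, fst (snd p)) $ (fst q, fst (snd q)) * id_op (snd (snd p)) (snd (snd q))" for M p q
      by (simp add: ampl_def op_def case_prod_unfold)
    have "closed {M. quad UNIV (\<lambda>p q. ampl (op M) p q - choi_state \<Omega> p q) v \<in> \<real>\<^sub>\<ge>\<^sub>0}" for v
      unfolding quad_def amp
      by (rule closed_vimage[OF closed_nonneg_Reals_complex, unfolded vimage_def]) (intro continuous_intros)
    then show ?thesis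
      by (simp add: psd_quad closed_Collect_all)
  qed
  moreover have "closed {M. \<forall>a0 b0 a0' b0'. (\<Sum>a1\<in>UNIV. op M ((a0, a1), b0) ((a0', a1), b0')) =
      id_op a0 a0' / of_nat CARD('a0) * (\<Sum>a\<in>UNIV. op M (a, b0) (a, b0'))}"
    unfolding op_def by (intro closed_Collect_all closed_Collect_eq continuous_intros)
  ultimately have "closed {M. op M \<in> hmin_feasible \<Omega>}"
    unfolding hmin_feasible_iff by (intro closed_Collect_conj)
  then have "compact K"
    unfolding K_def op_def by (intro compact_Int_closed compact_psd)
  moreover have "K \<noteq> {}"
    using op_surj[of \<gamma>0] K \<gamma>0 c_def by force
  moreover have "continuous_on K (\<lambda>M. Re (tr (op M)))"
    unfolding op_def by (intro continuous_intros)
  ultimately obtain M where M: "M \<in> K" "\<And>M'. M' \<in> K \<Longrightarrow> Re (tr (op M)) \<le> Re (tr (op M'))"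
    using continuous_attains_inf[of K "\<lambda>M. Re (tr (op M))"] by blast
  show ?thesis
  proof (intro bexI ballI)
    show "op M \<in> hmin_feasible \<Omega>" using M K by blast
    fix \<gamma> assume \<gamma>: "\<gamma> \<in> hmin_feasible \<Omega>"
    obtain M' where M': "op M' = \<gamma>" using op_surj by blast
    show "Re (tr (op M)) \<le> Re (tr \<gamma>)"
    proof (cases "Re (tr \<gamma>) \<le> c")
      case True
      then have "M' \<in> K" using K[of M'] \<gamma> M' by metis
      then show ?thesis using M(2) M' by metis
    next
      case False
      then show ?thesis using K[of M] M(1) by linarith
    qed
  qed
qed

definition hmin_val :: "(('a0::finite \<times> 'b0::finite) opr \<Rightarrow> ('a1::finite \<times> 'b1::finite) opr) \<Rightarrow> real" where
  "hmin_val \<Omega> = (LEAST t. \<exists>\<gamma> \<in> hmin_feasible \<Omega>. t = Re (tr \<gamma>))"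

text \<open>\<open>LEAST\<close> has its intended value because the minimum is attained; over the
  reals an infimum alone would not give it.\<close>

lemma hmin_val:
  assumes "choi_state \<Omega> \<in> psd UNIV"
  shows "\<exists>\<gamma>\<in>hmin_feasible \<Omega>. hmin_val \<Omega> = Re (tr \<gamma>)"
    and "\<gamma> \<in> hmin_feasible \<Omega> \<Longrightarrow> hmin_val \<Omega> \<le> Re (tr \<gamma>)"
    and "0 \<le> hmin_val \<Omega>"
proof -
  obtain \<gamma>0 where \<gamma>0: "\<gamma>0 \<in> hmin_feasible \<Omega>" "\<And>\<gamma>'. \<gamma>' \<in> hmin_feasible \<Omega> \<Longrightarrow> Re (tr \<gamma>0) \<le> Re (tr \<gamma>')"
    using hmin_attained[OF assms] by blast
  have v: "hmin_val \<Omega> = Re (tr \<gamma>0)"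
    unfolding hmin_val_def by (rule Least_equality) (use \<gamma>0 in auto)
  show "\<exists>\<gamma>\<in>hmin_feasible \<Omega>. hmin_val \<Omega> = Re (tr \<gamma>)" using v \<gamma>0 by blast
  show "\<gamma> \<in> hmin_feasible \<Omega> \<Longrightarrow> hmin_val \<Omega> \<le> Re (tr \<gamma>)" using v \<gamma>0 by simp
  have "0 \<le> cmod (\<gamma>0 undefined undefined)" by simp
  also have "\<dots> \<le> Re (tr \<gamma>0)"
    by (rule psd_entry_le_trace[OF hmin_feasible_psd[OF assms \<gamma>0(1)]])
  finally show "0 \<le> hmin_val \<Omega>" using v by simp
qed

text \<open>The negative logarithm is decreasing, and the optimum 0, sent to \<infinity>, fits in
  because optima are nonnegative.\<close>

lemma Hmin_ext_le_iff:
  assumes "choi_state \<Omega> \<in> psd UNIV" "choi_state \<Omega>' \<in> psd UNIV"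
  shows "Hmin_ext \<Omega> \<le> Hmin_ext \<Omega>' \<longleftrightarrow> hmin_val \<Omega>' \<le> hmin_val \<Omega>"
  using hmin_val(3)[OF assms(1)] hmin_val(3)[OF assms(2)]
  by (auto simp: Hmin_ext_def hmin_val_def[symmetric] Let_def)

section \<open>Conditional maps\<close>

text \<open>Separates the reference R from the party A, so that conditioning contracts the first
  factor and a superchannel the second.\<close>

definition regroup :: "(('r0 \<times> 'a0) \<times> ('r1 \<times> 'a1)) opr \<Rightarrow> (('r0 \<times> 'r1) \<times> ('a0 \<times> 'a1)) opr" where
  "regroup = relabel (\<lambda>((r0, r1), (a0, a1)). ((r0, a0), (r1, a1)))"

lemma regroup_eq: "regroup C (r, a) (r', a') = C ((fst r, fst a), (snd r, snd a)) ((fst r', fst a'), (snd r', snd a'))"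
  by (simp add: regroup_def relabel_def case_prod_unfold)

lemma cond_map_apply:
  "cond_map \<Phi> P E \<rho> k l = (\<Sum>r\<in>UNIV. \<Sum>s\<in>UNIV. E s r * \<Phi> (P \<otimes>\<^sub>o \<rho>) (r, k) (s, l))"
  for \<Phi> :: "('r0 \<times> 'a0) opr \<Rightarrow> ('r1::finite \<times> 'a1::finite) opr"
proof -
  have "cond_map \<Phi> P E \<rho> k l = (\<Sum>s\<in>UNIV. \<Sum>r\<in>UNIV. \<Sum>c\<in>UNIV. if c = k then E s r * \<Phi> (P \<otimes>\<^sub>o \<rho>) (r, c) (s, l) else 0)"
    unfolding cond_map_def ptrace_fst_def op_mult_def UNIV_Times_UNIV[symmetric] sum.cartesian_product'
    by (intro sum.cong refl) (auto simp: op_tensor_def id_op_def)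
  also have "\<dots> = (\<Sum>s\<in>UNIV. \<Sum>r\<in>UNIV. E s r * \<Phi> (P \<otimes>\<^sub>o \<rho>) (r, k) (s, l))"
    by simp
  also have "\<dots> = (\<Sum>r\<in>UNIV. \<Sum>s\<in>UNIV. E s r * \<Phi> (P \<otimes>\<^sub>o \<rho>) (r, k) (s, l))"
    by (rule sum.swap)
  finally show ?thesis .
qed

lemma cond_map_linear:
  fixes \<Phi> :: "('r0 \<times> 'a0) opr \<Rightarrow> ('r1::finite \<times> 'a1::finite) opr"
  assumes "\<Phi> \<in> linear_maps UNIV UNIV"
  shows "cond_map \<Phi> P E \<in> linear_maps UNIV UNIV"
proof -
  have "P \<otimes>\<^sub>o (\<lambda>r s. c * X r s + Y r s) = (\<lambda>p q. c * (P \<otimes>\<^sub>o X) p q + (P \<otimes>\<^sub>o Y) p q)" for c and X Y :: "'a0 opr"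
    by (auto simp: op_tensor_def fun_eq_iff algebra_simps)
  then have *: "\<Phi> (P \<otimes>\<^sub>o (\<lambda>r s. c * X r s + Y r s)) = (\<lambda>p q. c * \<Phi> (P \<otimes>\<^sub>o X) p q + \<Phi> (P \<otimes>\<^sub>o Y) p q)" for c and X Y :: "'a0 opr"
    using linear_maps_lin[OF assms] by simp
  show ?thesis
    by (simp add: linear_maps_def fun_eq_iff cond_map_apply *)
      (simp add: algebra_simps sum.distrib sum_distrib_left)
qed

text \<open>Preparing P and measuring E contract the R part with P \<otimes> E^T; the transpose
  comes from the trace pairing Tr (E X).\<close>

lemma choi_cond_map:
  fixes \<Phi> :: "('r0::finite \<times> 'a0::finite) opr \<Rightarrow> ('r1::finite \<times> 'a1::finite) opr"
  assumes "\<Phi> \<in> linear_maps UNIV UNIV"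
  shows "choi UNIV (cond_map \<Phi> P E) a a' =
    (\<Sum>r\<in>UNIV. \<Sum>r'\<in>UNIV. (P \<otimes>\<^sub>o (\<lambda>i j. E j i)) r r' * regroup (choi UNIV \<Phi>) (r, a) (r', a'))"
proof -
  obtain a0 a1 a0' a1' where j: "a = (a0, a1)" "a' = (a0', a1')"
    by (metis surj_pair)
  have \<Phi>: "\<Phi> (P \<otimes>\<^sub>o matrix_unit a0 a0') (k, a1) (l, a1') =
    (\<Sum>i\<in>UNIV. \<Sum>i'\<in>UNIV. P i i' * choi UNIV \<Phi> ((i, a0), (k, a1)) ((i', a0'), (l, a1')))" for k l
  proof -
    have "\<Phi> (P \<otimes>\<^sub>o matrix_unit a0 a0') (k, a1) (l, a1') =
      (\<Sum>i\<in>UNIV. \<Sum>s\<in>UNIV. \<Sum>i'\<in>UNIV. \<Sum>s'\<in>UNIV. (P i i' * matrix_unit a0 a0' s s') * choi UNIV \<Phi> ((i, s), (k, a1)) ((i', s'), (l, a1')))"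
      unfolding linear_maps_choi[OF assms finite, of "P \<otimes>\<^sub>o matrix_unit a0 a0'", simplified] UNIV_Times_UNIV[symmetric] sum.cartesian_product'
      by (simp add: op_tensor_def)
    also have "\<dots> = (\<Sum>i\<in>UNIV. \<Sum>i'\<in>UNIV. \<Sum>s\<in>UNIV. \<Sum>s'\<in>UNIV. matrix_unit a0 a0' s s' * (P i i' * choi UNIV \<Phi> ((i, s), (k, a1)) ((i', s'), (l, a1'))))"
      by (intro sum.cong refl, subst sum.swap) (simp add: mult_ac)
    finally show ?thesis by (simp add: sum_matrix_unit)
  qed
  have "choi UNIV (cond_map \<Phi> P E) a a' = (\<Sum>k\<in>UNIV. \<Sum>l\<in>UNIV. \<Sum>i\<in>UNIV. \<Sum>i'\<in>UNIV. E l k * (P i i' * choi UNIV \<Phi> ((i, a0), (k, a1)) ((i', a0'), (l, a1'))))"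
    by (simp add: j choi_def[of _ "cond_map \<Phi> P E"] cond_map_apply \<Phi> sum_distrib_left)
  also have "\<dots> = (\<Sum>k\<in>UNIV. \<Sum>i\<in>UNIV. \<Sum>l\<in>UNIV. \<Sum>i'\<in>UNIV. E l k * (P i i' * choi UNIV \<Phi> ((i, a0), (k, a1)) ((i', a0'), (l, a1'))))"
    by (intro sum.cong refl, rule sum.swap)
  also have "\<dots> = (\<Sum>i\<in>UNIV. \<Sum>k\<in>UNIV. \<Sum>l\<in>UNIV. \<Sum>i'\<in>UNIV. E l k * (P i i' * choi UNIV \<Phi> ((i, a0), (k, a1)) ((i', a0'), (l, a1'))))"
    by (rule sum.swap)
  also have "\<dots> = (\<Sum>i\<in>UNIV. \<Sum>k\<in>UNIV. \<Sum>i'\<in>UNIV. \<Sum>l\<in>UNIV. E l k * (P i i' * choi UNIV \<Phi> ((i, a0), (k, a1)) ((i', a0'), (l, a1'))))"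
    by (intro sum.cong refl, rule sum.swap)
  finally show ?thesis
    unfolding UNIV_Times_UNIV[symmetric] sum.cartesian_product'
    by (simp add: op_tensor_def regroup_eq j mult_ac)
qed

lemma cond_map_cp:
  fixes \<Phi> :: "('r0::finite \<times> 'a0::finite) opr \<Rightarrow> ('r1::finite \<times> 'a1::finite) opr"
  assumes "\<Phi> \<in> cp_maps UNIV UNIV" "P \<in> psd UNIV" "E \<in> psd UNIV"
  shows "choi UNIV (cond_map \<Phi> P E) \<in> psd UNIV"
proof -
  have "\<Phi> \<in> linear_maps UNIV UNIV" "choi UNIV \<Phi> \<in> psd UNIV"
    using assms(1) by (simp_all add: cp_maps_choi)
  then have "regroup (choi UNIV \<Phi>) \<in> psd UNIV"
    unfolding regroup_def by (intro psd_relabel)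
  from psd_contract[OF psd_tensor[OF assms(2) psd_transpose[OF assms(3)]] this]
  show ?thesis
    unfolding choi_cond_map[OF \<open>\<Phi> \<in> linear_maps UNIV UNIV\<close>, symmetric] .
qed

text \<open>Conditioning contracts R and the superchannel contracts A, so the two contractions
  commute.\<close>

lemma choi_cond_map_id_super:
  fixes \<Theta> :: "('a0::finite opr \<Rightarrow> 'a1::finite opr) \<Rightarrow> ('b0::finite opr \<Rightarrow> 'b1::finite opr)"
    and \<Phi> :: "('r0::finite \<times> 'a0) opr \<Rightarrow> ('r1::finite \<times> 'a1) opr"
  assumes "linear_super \<Theta>" "\<Phi> \<in> linear_maps UNIV UNIV"
  shows "choi UNIV (cond_map (id_super UNIV \<Theta> \<Phi>) P E) b b' =
    (\<Sum>a\<in>UNIV. \<Sum>a'\<in>UNIV. super_choi \<Theta> (a, b) (a', b') * choi UNIV (cond_map \<Phi> P E) a a')"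
proof -
  have lin: "id_super UNIV \<Theta> \<Phi> \<in> linear_maps UNIV UNIV"
    using id_super_linear[OF assms(1), of \<Phi> UNIV UNIV] assms(2) by simp
  have ch: "regroup (choi UNIV (id_super UNIV \<Theta> \<Phi>)) (r, b) (r', b') =
    (\<Sum>a\<in>UNIV. \<Sum>a'\<in>UNIV. super_choi \<Theta> (a, b) (a', b') * regroup (choi UNIV \<Phi>) (r, a) (r', a'))" for r r'
    using choi_id_super[OF assms(1), of \<Phi> UNIV UNIV] assms(2) by (simp add: regroup_eq)
  let ?D = "P \<otimes>\<^sub>o (\<lambda>i j. E j i)" and ?J = "super_choi \<Theta>" and ?C = "regroup (choi UNIV \<Phi>)"
  have "choi UNIV (cond_map (id_super UNIV \<Theta> \<Phi>) P E) b b' =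
    (\<Sum>r\<in>UNIV. \<Sum>r'\<in>UNIV. \<Sum>a\<in>UNIV. \<Sum>a'\<in>UNIV. ?D r r' * (?J (a, b) (a', b') * ?C (r, a) (r', a')))"
    by (simp add: choi_cond_map[OF lin] ch sum_distrib_left)
  also have "\<dots> = (\<Sum>r\<in>UNIV. \<Sum>a\<in>UNIV. \<Sum>r'\<in>UNIV. \<Sum>a'\<in>UNIV. ?D r r' * (?J (a, b) (a', b') * ?C (r, a) (r', a')))"
    by (intro sum.cong refl, rule sum.swap)
  also have "\<dots> = (\<Sum>a\<in>UNIV. \<Sum>r\<in>UNIV. \<Sum>r'\<in>UNIV. \<Sum>a'\<in>UNIV. ?D r r' * (?J (a, b) (a', b') * ?C (r, a) (r', a')))"
    by (rule sum.swap)
  also have "\<dots> = (\<Sum>a\<in>UNIV. \<Sum>r\<in>UNIV. \<Sum>a'\<in>UNIV. \<Sum>r'\<in>UNIV. ?D r r' * (?J (a, b) (a', b') * ?C (r, a) (r', a')))"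
    by (intro sum.cong refl, rule sum.swap)
  also have "\<dots> = (\<Sum>a\<in>UNIV. \<Sum>a'\<in>UNIV. \<Sum>r\<in>UNIV. \<Sum>r'\<in>UNIV. ?D r r' * (?J (a, b) (a', b') * ?C (r, a) (r', a')))"
    by (intro sum.cong refl, rule sum.swap)
  finally show ?thesis
    by (simp add: choi_cond_map[OF assms(2)] sum_distrib_left mult_ac)
qed

section \<open>Monotonicity under superchannels\<close>

lemma tr_prod: "tr X = (\<Sum>c\<in>UNIV. \<Sum>b\<in>UNIV. X (b, c) (b, c))" for X :: "('b::finite \<times> 'c::finite) opr"
  unfolding tr_def UNIV_Times_UNIV[symmetric] sum.cartesian_product' by (rule sum.swap)

text \<open>Contraction with a positive J preserves the operator inequality. The marginal condition
  survives because it says that each slice of \<gamma> at fixed labels of the second party is the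
  Choi operator of a trace-scaling map, and superchannels keep the scaling factor.\<close>

lemma superchannel_feasible:
  fixes \<Theta> :: "('a0::finite opr \<Rightarrow> 'a1::finite opr) \<Rightarrow> ('b0::finite opr \<Rightarrow> 'b1::finite opr)"
    and \<Omega> :: "('a0 \<times> 'c0::finite) opr \<Rightarrow> ('a1 \<times> 'c1::finite) opr"
    and \<Omega>' :: "('b0 \<times> 'c0) opr \<Rightarrow> ('b1 \<times> 'c1) opr"
  assumes \<Theta>: "superchannel \<Theta>" and \<gamma>: "\<gamma> \<in> hmin_feasible \<Omega>"
    and \<Omega>': "\<And>b c b' c'. choi_state \<Omega>' (b, c) (b', c') = of_nat CARD('a0) / of_nat CARD('b0) *
      (\<Sum>a\<in>UNIV. \<Sum>a'\<in>UNIV. super_choi \<Theta> (a, b) (a', b') * choi_state \<Omega> (a, c) (a', c'))"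
  shows "\<exists>\<gamma>'\<in>hmin_feasible \<Omega>'. tr \<gamma>' = tr \<gamma>"
proof -
  \<comment> \<open>Compensates the different normalisations of the two Choi states, 1 / d_A0
    against 1 / d_B0.\<close>
  define k :: complex where "k = of_nat CARD('a0) / of_nat CARD('b0)"
  let ?J = "super_choi \<Theta>"
  have J: "?J \<in> psd UNIV" by (rule superchannel_psd[OF \<Theta>])
  have lin: "linear_super \<Theta>" using \<Theta> by (simp add: superchannel_def)
  have herm: "hermitian \<gamma>" and pos: "(\<lambda>p q. ampl \<gamma> p q - choi_state \<Omega> p q) \<in> psd UNIV"
    and marg: "\<And>a0 c a0' c'. (\<Sum>a1\<in>UNIV. \<gamma> ((a0, a1), c) ((a0', a1), c')) =
      id_op a0 a0' / of_nat CARD('a0) * (\<Sum>a\<in>UNIV. \<gamma> (a, c) (a, c'))"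
    using \<gamma> by (simp_all add: hmin_feasible_iff)
  define \<gamma>' where "\<gamma>' = (\<lambda>(b, c) (b', c'). k * (\<Sum>a\<in>UNIV. \<Sum>a'\<in>UNIV. ?J (a, b) (a', b') * \<gamma> (a, c) (a', c')))"
  have kr: "k \<in> \<real>\<^sub>\<ge>\<^sub>0" "cnj k = k" by (simp_all add: k_def)
  have "hermitian \<gamma>'"
    unfolding hermitian_def
  proof (intro allI)
    fix i j :: "('b0 \<times> 'b1) \<times> 'c0"
    obtain b c b' c' where ij: "i = (b, c)" "j = (b', c')" by (metis surj_pair)
    have h: "cnj (?J p q) = ?J q p" "cnj (\<gamma> r s) = \<gamma> s r" for p q r s
      using psd_imp_hermitian[OF J] herm by (simp_all add: hermitian_cnj)
    show "\<gamma>' i j = cnj (\<gamma>' j i)"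
      unfolding \<gamma>'_def ij split_conv complex_cnj_mult cnj_sum h kr by (subst sum.swap) simp
  qed
  moreover have "(\<lambda>p q. ampl \<gamma>' p q - choi_state \<Omega>' p q) \<in> psd UNIV"
  proof -
    have "relabel prod.swap ?J \<in> psd (UNIV \<times> UNIV)" "(\<lambda>p q. ampl \<gamma> p q - choi_state \<Omega> p q) \<in> psd (UNIV \<times> UNIV)"
      using psd_relabel[OF J] pos by auto
    note psd_scale[OF psd_link[OF this finite finite finite] kr(1)]
    moreover have "ampl \<gamma>' (b, c) (b', c') - choi_state \<Omega>' (b, c) (b', c') =
      k * (\<Sum>a\<in>UNIV. \<Sum>a'\<in>UNIV. ?J (a, b) (a', b') * (ampl \<gamma> (a, c) (a', c') - choi_state \<Omega> (a, c) (a', c')))" for b c b' c'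
      unfolding \<Omega>' by (cases c; cases c')
        (simp add: ampl_def \<gamma>'_def k_def algebra_simps sum_distrib_left sum_subtractf)
    then have "(\<lambda>p q. ampl \<gamma>' p q - choi_state \<Omega>' p q) = (\<lambda>p q. k * (case p of (b, c) \<Rightarrow> \<lambda>(b', c').
      \<Sum>a\<in>UNIV. \<Sum>a'\<in>UNIV. relabel prod.swap ?J (b, a) (b', a') * (ampl \<gamma> (a, c) (a', c') - choi_state \<Omega> (a, c) (a', c'))) q)"
      by (auto simp: fun_eq_iff relabel_def)
    ultimately show ?thesis by simp
  qed
  moreover have m: "(\<Sum>b1\<in>UNIV. \<gamma>' ((b0, b1), c) ((b0', b1), c')) = id_op b0 b0' / of_nat CARD('b0) * (\<Sum>a\<in>UNIV. \<gamma> (a, c) (a, c'))"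
    for b0 b0' c c'
  proof -
    \<comment> \<open>For c and c' distinct this slice need not be positive or even Hermitian, so
      trace scaling has to be available for arbitrary linear maps.\<close>
    define N where "N = of_choi (\<lambda>a a'. \<gamma> (a, c) (a', c'))"
    have N: "N \<in> linear_maps UNIV UNIV" by (simp add: N_def of_choi_linear)
    define s where "s = (\<Sum>a\<in>UNIV. \<gamma> (a, c) (a, c')) / of_nat CARD('a0)"
    have "\<forall>X. tr (N X) = s * tr X"
      unfolding trace_choi[OF N] unfolding N_def choi_of_choi marg by (simp add: s_def)
    then have "\<forall>X. tr (\<Theta> N X) = s * tr X"
      using superchannel_trace_scaling[OF \<Theta> N] by blast
    then have "(\<Sum>b1\<in>UNIV. choi UNIV (\<Theta> N) (b0, b1) (b0', b1)) = s * id_op b0 b0'"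
      using trace_choi[OF linear_super_linear[OF lin N]] by blast
    then have "(\<Sum>b1\<in>UNIV. \<gamma>' ((b0, b1), c) ((b0', b1), c')) = k * (s * id_op b0 b0')"
      unfolding super_choi_apply[OF lin N] unfolding N_def choi_of_choi \<gamma>'_def by (simp flip: sum_distrib_left)
    then show ?thesis by (simp add: k_def s_def)
  qed
  moreover have g: "(\<Sum>b\<in>UNIV. \<gamma>' (b, c) (b, c')) = (\<Sum>a\<in>UNIV. \<gamma> (a, c) (a, c'))" for c c'
    by (simp add: UNIV_Times_UNIV[symmetric] sum.cartesian_product' m id_op_def del: UNIV_Times_UNIV)
  ultimately have "\<gamma>' \<in> hmin_feasible \<Omega>'"
    by (simp add: hmin_feasible_iff)
  moreover have "tr \<gamma>' = tr \<gamma>"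
    by (simp add: tr_prod g)
  ultimately show ?thesis by blast
qed

section \<open>Duality\<close>

text \<open>A theorem of the alternative for a cone. A solution of L X = b must have the trace
  \<open>inner y0 b\<close>, so only that slice of the cone has to be kept away from b; its compact
  convex image can be separated strictly, and homogeneity extends the inequality to the
  cone.\<close>

lemma psd_separation:
  fixes L :: "'i::finite opr \<Rightarrow> 'e::euclidean_space"
  assumes lin: "\<And>X Y c. L (\<lambda>i j. of_real c * X i j + Y i j) = c *\<^sub>R L X + L Y"
    and y0: "\<And>X. inner y0 (L X) = Re (tr X)" and c: "inner y0 b > 0"
    and none: "\<not> (\<exists>X\<in>psd UNIV. L X = b)"
  shows "\<exists>y. (\<forall>X\<in>psd UNIV. 0 \<le> inner y (L X)) \<and> inner y b < 0"
proof -
  define c where "c = inner y0 b"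
  define op :: "complex^'i^'i \<Rightarrow> 'i opr" where "op = (\<lambda>M i j. M $ i $ j)"
  define K where "K = {M. op M \<in> psd UNIV \<and> Re (tr (op M)) \<le> c} \<inter> {M. c \<le> Re (tr (op M))}"
  have L0: "L (\<lambda>i j. 0) = 0"
    using lin[of "-1" "\<lambda>i j. 0" "\<lambda>i j. 0"] by simp
  have op_lin: "op (x *\<^sub>R M + N) = (\<lambda>i j. of_real x * op M i j + op N i j)" for x M N
    by (simp add: op_def fun_eq_iff complex_eq_iff)
  have "linear (\<lambda>M. L (op M))"
  proof (rule linearI)
    show "L (op (M + N)) = L (op M) + L (op N)" for M N
      using op_lin[of 1 M N] lin[of 1] by simp
    have "op 0 = (\<lambda>i j. 0)" by (simp add: op_def fun_eq_iff)
    then show "L (op (x *\<^sub>R M)) = x *\<^sub>R L (op M)" for x M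
      using op_lin[of x M 0] lin[of x "op M" "\<lambda>i j. 0"] L0 by simp
  qed
  note linear = this
  have "compact K"
    unfolding K_def op_def by (intro compact_Int_closed compact_psd closed_Collect_le continuous_intros)
  then have "compact ((\<lambda>M. L (op M)) ` K)"
    using linear by (intro compact_continuous_image linear_continuous_on) (simp add: linear_conv_bounded_linear)
  moreover have "convex K"
  proof (rule convexI)
    fix M N and u v :: real assume K: "M \<in> K" "N \<in> K" and uv: "0 \<le> u" "0 \<le> v" "u + v = 1"
    have e: "op (u *\<^sub>R M + v *\<^sub>R N) = (\<lambda>i j. of_real u * op M i j + of_real v * op N i j)"
      by (simp add: op_def fun_eq_iff complex_eq_iff)
    have "op (u *\<^sub>R M + v *\<^sub>R N) \<in> psd UNIV"
      unfolding e using K uv by (intro psd_add psd_scale) (auto simp: K_def)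
    moreover have "tr (op (u *\<^sub>R M + v *\<^sub>R N)) = of_real u * tr (op M) + of_real v * tr (op N)"
      unfolding e by (simp add: tr_def sum.distrib sum_distrib_left)
    moreover have "Re (tr (op M)) = c" "Re (tr (op N)) = c"
      using K by (auto simp: K_def)
    moreover have "u * c + v * c = c"
      using uv by (simp flip: distrib_right)
    ultimately show "u *\<^sub>R M + v *\<^sub>R N \<in> K"
      by (simp add: K_def)
  qed
  moreover have "b \<notin> (\<lambda>M. L (op M)) ` K"
    using none by (auto simp: K_def)
  ultimately obtain a \<beta> where a: "inner a b < \<beta>" "\<And>M. M \<in> K \<Longrightarrow> inner a (L (op M)) > \<beta>"
    using separating_hyperplane_closed_point[of "(\<lambda>M. L (op M)) ` K" b] linear
    by (auto simp: convex_linear_image compact_imp_closed)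
  show ?thesis
  proof (intro exI conjI ballI)
    have c0: "c > 0" using c by (simp add: c_def)
    \<comment> \<open>On the slice the pairing with \<open>y0\<close> is the constant c, so
      subtracting this multiple of \<open>y0\<close> moves the separating level from \<beta> to
      0.\<close>
    show "inner (a - (\<beta> / c) *\<^sub>R y0) b < 0"
      using a(1) c by (simp add: inner_diff_left c_def)
    fix X :: "'i opr" assume X: "X \<in> psd UNIV"
    define t where "t = Re (tr X)"
    have t0: "t \<ge> 0"
      using order_trans[OF norm_ge_zero psd_entry_le_trace[OF X, of undefined undefined]] by (simp add: t_def)
    show "0 \<le> inner (a - (\<beta> / c) *\<^sub>R y0) (L X)"
    proof (cases "t = 0")
      case True
      then have "X = (\<lambda>i j. 0)"
        using psd_entry_le_trace[OF X] by (simp add: t_def fun_eq_iff)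
      then show ?thesis using L0 by simp
    next
      case False
      with t0 have tp: "t > 0" by simp
      define M :: "complex^'i^'i" where "M = (\<chi> i j. of_real (c / t) * X i j)"
      have e: "op M = (\<lambda>i j. of_real (c / t) * X i j)"
        by (simp add: M_def op_def fun_eq_iff)
      have "tr (op M) = of_real (c / t) * tr X"
        unfolding e by (simp add: tr_def sum_distrib_left)
      then have "Re (tr (op M)) = c"
        using tp by (simp add: t_def)
      moreover have "op M \<in> psd UNIV"
        unfolding e using X tp c0 by (intro psd_scale) auto
      ultimately have "inner a (L (op M)) > \<beta>"
        by (intro a(2)) (simp add: K_def)
      moreover have "L (op M) = (c / t) *\<^sub>R L X"
        unfolding e using lin[of "c / t" X "\<lambda>i j. 0"] L0 by simp
      ultimately have "c / t * inner a (L X) > \<beta>" by simp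
      then have "inner a (L X) > \<beta> / c * t"
        using tp c0 by (simp add: field_simps)
      then show ?thesis
        by (simp add: inner_diff_left y0 t_def)
    qed
  qed
qed

section \<open>Marginals, their projection, and the affine conditions on superchannels\<close>

definition marg1 :: "(('a0 \<times> 'a1::finite) \<times> 'b0) opr \<Rightarrow> 'a0 \<Rightarrow> 'b0 \<Rightarrow> 'a0 \<Rightarrow> 'b0 \<Rightarrow> complex" where
  "marg1 X a0 b0 a0' b0' = (\<Sum>a1\<in>UNIV. X ((a0, a1), b0) ((a0', a1), b0'))"

definition marg0 :: "(('a0::finite \<times> 'a1::finite) \<times> 'b0) opr \<Rightarrow> 'b0 opr" where
  "marg0 X b0 b0' = (\<Sum>a\<in>UNIV. X (a, b0) (a, b0'))"

lemma marg0_marg1: "marg0 X b0 b0' = (\<Sum>a0\<in>UNIV. marg1 X a0 b0 a0 b0')"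
  unfolding marg0_def marg1_def UNIV_Times_UNIV[symmetric] sum.cartesian_product' ..

text \<open>The orthogonal projection onto the operators \<open>\<gamma>\<close> with \<open>\<gamma>\<^sup>A\<^sup>0\<^sup>B\<^sup>0 = u\<^sup>A\<^sup>0 \<otimes> \<gamma>\<^sup>B\<^sup>0\<close>.\<close>

definition marg_proj :: "(('a0::finite \<times> 'a1::finite) \<times> 'b0) opr \<Rightarrow> (('a0 \<times> 'a1) \<times> 'b0) opr" where
  "marg_proj X = (\<lambda>((a0, a1), b0) ((a0', a1'), b0'). X ((a0, a1), b0) ((a0', a1'), b0') +
     id_op a1 a1' * (id_op a0 a0' * (marg0 X b0 b0' / of_nat (CARD('a0) * CARD('a1))) -
       marg1 X a0 b0 a0' b0' / of_nat CARD('a1)))"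

lemma sum_id_op:
  "(\<Sum>j\<in>UNIV. id_op i j * f j) = f i" "(\<Sum>j\<in>UNIV. f j * id_op i j) = f i"
  "(\<Sum>j\<in>UNIV. id_op j i * f j) = f i" "(\<Sum>j\<in>UNIV. f j * id_op j i) = f i" for i :: "'i::finite"
  by (simp_all add: id_op_def if_distrib if_distribR cong: if_cong)

lemma id_op_same: "id_op i i = 1"
  by (simp add: id_op_def)

lemma marg1_proj:
  fixes X :: "(('a0::finite \<times> 'a1::finite) \<times> 'b0) opr"
  shows "marg1 (marg_proj X) a0 b0 a0' b0' = id_op a0 a0' / of_nat CARD('a0) * marg0 X b0 b0'"
  unfolding marg1_def[of "marg_proj X"] unfolding marg_proj_def
  by (simp add: sum.distrib id_op_same right_diff_distrib) (simp add: marg1_def)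

lemma marg0_proj:
  fixes X :: "(('a0::finite \<times> 'a1::finite) \<times> 'b0) opr"
  shows "marg0 (marg_proj X) = marg0 X"
  by (simp add: fun_eq_iff marg0_marg1[of "marg_proj X"] marg1_proj id_op_same)

lemma tr_marg0: "tr X = (\<Sum>b0\<in>UNIV. marg0 X b0 b0)" for X :: "(('a0::finite \<times> 'a1::finite) \<times> 'b0::finite) opr"
  by (simp add: tr_prod marg0_def)

text \<open>An operator I^A1 \<otimes> f sees only the partial trace over A1; the correction term in
  \<open>marg_proj\<close> has this form.\<close>

lemma sum_marg1:
  fixes X :: "(('a0::finite \<times> 'a1::finite) \<times> 'b0::finite) opr"
  shows "(\<Sum>p\<in>UNIV. \<Sum>q\<in>UNIV. X p q * (case p of ((a0, a1), b0) \<Rightarrow> \<lambda>((a0', a1'), b0'). id_op a1 a1' * f a0 b0 a0' b0') q) =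
    (\<Sum>a0\<in>UNIV. \<Sum>b0\<in>UNIV. \<Sum>a0'\<in>UNIV. \<Sum>b0'\<in>UNIV. marg1 X a0 b0 a0' b0' * f a0 b0 a0' b0')"
proof -
  have "(\<Sum>p\<in>UNIV. \<Sum>q\<in>UNIV. X p q * (case p of ((a0, a1), b0) \<Rightarrow> \<lambda>((a0', a1'), b0'). id_op a1 a1' * f a0 b0 a0' b0') q) =
    (\<Sum>a0\<in>UNIV. \<Sum>a1\<in>UNIV. \<Sum>b0\<in>UNIV. \<Sum>a0'\<in>UNIV. \<Sum>a1'\<in>UNIV. \<Sum>b0'\<in>UNIV.
      id_op a1 a1' * (X ((a0, a1), b0) ((a0', a1'), b0') * f a0 b0 a0' b0'))"
    unfolding UNIV_Times_UNIV[symmetric] sum.cartesian_product' by (simp add: mult_ac)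
  also have "\<dots> = (\<Sum>a0\<in>UNIV. \<Sum>a1\<in>UNIV. \<Sum>b0\<in>UNIV. \<Sum>a0'\<in>UNIV. \<Sum>b0'\<in>UNIV.
      X ((a0, a1), b0) ((a0', a1), b0') * f a0 b0 a0' b0')"
    by (intro sum.cong refl, subst sum.swap) (simp add: sum_id_op)
  also have "\<dots> = (\<Sum>a0\<in>UNIV. \<Sum>b0\<in>UNIV. \<Sum>a1\<in>UNIV. \<Sum>a0'\<in>UNIV. \<Sum>b0'\<in>UNIV.
      X ((a0, a1), b0) ((a0', a1), b0') * f a0 b0 a0' b0')"
    by (intro sum.cong refl, rule sum.swap)
  also have "\<dots> = (\<Sum>a0\<in>UNIV. \<Sum>b0\<in>UNIV. \<Sum>a0'\<in>UNIV. \<Sum>a1\<in>UNIV. \<Sum>b0'\<in>UNIV.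
      X ((a0, a1), b0) ((a0', a1), b0') * f a0 b0 a0' b0')"
    by (intro sum.cong refl, rule sum.swap)
  also have "\<dots> = (\<Sum>a0\<in>UNIV. \<Sum>b0\<in>UNIV. \<Sum>a0'\<in>UNIV. \<Sum>b0'\<in>UNIV. \<Sum>a1\<in>UNIV.
      X ((a0, a1), b0) ((a0', a1), b0') * f a0 b0 a0' b0')"
    by (intro sum.cong refl, rule sum.swap)
  finally show ?thesis by (simp add: marg1_def sum_distrib_right)
qed

text \<open>The right-hand side is visibly symmetric in X and Y, and self-adjointness of the
  projection follows at once.\<close>

lemma marg_proj_pairing:
  fixes X Y :: "(('a0::finite \<times> 'a1::finite) \<times> 'b0::finite) opr"
  shows "(\<Sum>p\<in>UNIV. \<Sum>q\<in>UNIV. X p q * marg_proj Y p q) =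
    (\<Sum>p\<in>UNIV. \<Sum>q\<in>UNIV. X p q * Y p q) +
    (\<Sum>b0\<in>UNIV. \<Sum>b0'\<in>UNIV. marg0 X b0 b0' * marg0 Y b0 b0') / of_nat (CARD('a0) * CARD('a1)) -
    (\<Sum>a0\<in>UNIV. \<Sum>b0\<in>UNIV. \<Sum>a0'\<in>UNIV. \<Sum>b0'\<in>UNIV. marg1 X a0 b0 a0' b0' * marg1 Y a0 b0 a0' b0') / of_nat CARD('a1)"
proof -
  let ?f = "\<lambda>a0 b0 a0' b0'. id_op a0 a0' * (marg0 Y b0 b0' / of_nat (CARD('a0) * CARD('a1))) - marg1 Y a0 b0 a0' b0' / of_nat CARD('a1)"
  have "(\<Sum>p\<in>UNIV. \<Sum>q\<in>UNIV. X p q * marg_proj Y p q) = (\<Sum>p\<in>UNIV. \<Sum>q\<in>UNIV. X p q * Y p q +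
     X p q * (case p of ((a0, a1), b0) \<Rightarrow> \<lambda>((a0', a1'), b0'). id_op a1 a1' * ?f a0 b0 a0' b0') q)"
    by (intro sum.cong refl) (simp add: marg_proj_def case_prod_unfold distrib_left)
  also have "\<dots> = (\<Sum>p\<in>UNIV. \<Sum>q\<in>UNIV. X p q * Y p q) +
    (\<Sum>a0\<in>UNIV. \<Sum>b0\<in>UNIV. \<Sum>a0'\<in>UNIV. \<Sum>b0'\<in>UNIV. marg1 X a0 b0 a0' b0' * ?f a0 b0 a0' b0')"
    unfolding sum.distrib sum_marg1 ..
  also have "(\<Sum>a0\<in>UNIV. \<Sum>b0\<in>UNIV. \<Sum>a0'\<in>UNIV. \<Sum>b0'\<in>UNIV. marg1 X a0 b0 a0' b0' * ?f a0 b0 a0' b0') =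
    (\<Sum>a0\<in>UNIV. \<Sum>b0\<in>UNIV. \<Sum>a0'\<in>UNIV. \<Sum>b0'\<in>UNIV.
      id_op a0 a0' * (marg1 X a0 b0 a0' b0' * (marg0 Y b0 b0' / of_nat (CARD('a0) * CARD('a1))))) -
    (\<Sum>a0\<in>UNIV. \<Sum>b0\<in>UNIV. \<Sum>a0'\<in>UNIV. \<Sum>b0'\<in>UNIV. marg1 X a0 b0 a0' b0' * marg1 Y a0 b0 a0' b0') / of_nat CARD('a1)"
    by (simp add: right_diff_distrib sum_subtractf sum_divide_distrib mult_ac)
  also have "(\<Sum>a0\<in>UNIV. \<Sum>b0\<in>UNIV. \<Sum>a0'\<in>UNIV. \<Sum>b0'\<in>UNIV.
      id_op a0 a0' * (marg1 X a0 b0 a0' b0' * (marg0 Y b0 b0' / of_nat (CARD('a0) * CARD('a1))))) =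
    (\<Sum>a0\<in>UNIV. \<Sum>b0\<in>UNIV. \<Sum>b0'\<in>UNIV. marg1 X a0 b0 a0 b0' * (marg0 Y b0 b0' / of_nat (CARD('a0) * CARD('a1))))"
    by (intro sum.cong refl, subst sum.swap) (simp add: sum_id_op del: times_divide_eq_right times_divide_eq_left)
  also have "\<dots> = (\<Sum>b0\<in>UNIV. \<Sum>a0\<in>UNIV. \<Sum>b0'\<in>UNIV. marg1 X a0 b0 a0 b0' * (marg0 Y b0 b0' / of_nat (CARD('a0) * CARD('a1))))"
    by (rule sum.swap)
  also have "\<dots> = (\<Sum>b0\<in>UNIV. \<Sum>b0'\<in>UNIV. \<Sum>a0\<in>UNIV. marg1 X a0 b0 a0 b0' * (marg0 Y b0 b0' / of_nat (CARD('a0) * CARD('a1))))"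
    by (intro sum.cong refl, rule sum.swap)
  also have "\<dots> = (\<Sum>b0\<in>UNIV. \<Sum>b0'\<in>UNIV. marg0 X b0 b0' * marg0 Y b0 b0') / of_nat (CARD('a0) * CARD('a1))"
    by (simp add: marg0_marg1[of X] sum_distrib_right sum_divide_distrib)
  finally show ?thesis by simp
qed

lemma marg_proj_adjoint:
  fixes X Y :: "(('a0::finite \<times> 'a1::finite) \<times> 'b0::finite) opr"
  shows "(\<Sum>p\<in>UNIV. \<Sum>q\<in>UNIV. X p q * marg_proj Y p q) = (\<Sum>p\<in>UNIV. \<Sum>q\<in>UNIV. marg_proj X p q * Y p q)"
  using marg_proj_pairing[of X Y] marg_proj_pairing[of Y X] by (simp add: mult.commute)

definition trace_out :: "('a \<times> ('b0 \<times> 'b1::finite)) opr \<Rightarrow> ('a \<times> 'b0) opr" where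
  "trace_out J = (\<lambda>(a, b0) (a', b0'). \<Sum>b1\<in>UNIV. J (a, (b0, b1)) (a', (b0', b1)))"

text \<open>Makes the multiplier of a condition on Tr_B1 J appear as \<gamma> \<otimes> I^B1, the
  shape it has in the entropy program: the two operations are adjoint.\<close>

lemma trace_out_pairing:
  fixes J :: "('a::finite \<times> ('b0::finite \<times> 'b1::finite)) opr"
  shows "(\<Sum>p\<in>UNIV. \<Sum>q\<in>UNIV. X p q * trace_out J p q) = (\<Sum>p\<in>UNIV. \<Sum>q\<in>UNIV. ampl X p q * J p q)"
proof -
  have "(\<Sum>p\<in>UNIV. \<Sum>q\<in>UNIV. ampl X p q * J p q) = (\<Sum>a\<in>UNIV. \<Sum>b0\<in>UNIV. \<Sum>b1\<in>UNIV. \<Sum>a'\<in>UNIV. \<Sum>b0'\<in>UNIV. \<Sum>b1'\<in>UNIV.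
    id_op b1 b1' * (X (a, b0) (a', b0') * J (a, (b0, b1)) (a', (b0', b1'))))"
    unfolding UNIV_Times_UNIV[symmetric] sum.cartesian_product' by (simp add: ampl_def mult_ac)
  also have "\<dots> = (\<Sum>a\<in>UNIV. \<Sum>b0\<in>UNIV. \<Sum>b1\<in>UNIV. \<Sum>a'\<in>UNIV. \<Sum>b0'\<in>UNIV. X (a, b0) (a', b0') * J (a, (b0, b1)) (a', (b0', b1)))"
    by (simp add: sum_id_op)
  also have "\<dots> = (\<Sum>a\<in>UNIV. \<Sum>b0\<in>UNIV. \<Sum>a'\<in>UNIV. \<Sum>b1\<in>UNIV. \<Sum>b0'\<in>UNIV. X (a, b0) (a', b0') * J (a, (b0, b1)) (a', (b0', b1)))"
    by (intro sum.cong refl, rule sum.swap)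
  also have "\<dots> = (\<Sum>a\<in>UNIV. \<Sum>b0\<in>UNIV. \<Sum>a'\<in>UNIV. \<Sum>b0'\<in>UNIV. \<Sum>b1\<in>UNIV. X (a, b0) (a', b0') * J (a, (b0, b1)) (a', (b0', b1)))"
    by (intro sum.cong refl, rule sum.swap)
  also have "\<dots> = (\<Sum>p\<in>UNIV. \<Sum>q\<in>UNIV. X p q * trace_out J p q)"
    unfolding UNIV_Times_UNIV[symmetric] sum.cartesian_product' by (simp add: trace_out_def sum_distrib_left)
  finally show ?thesis by simp
qed

lemma tr_trace_out: "tr (trace_out J) = tr J" for J :: "('a::finite \<times> ('b0::finite \<times> 'b1::finite)) opr"
  unfolding tr_def UNIV_Times_UNIV[symmetric] sum.cartesian_product' by (simp add: trace_out_def)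

text \<open>The orthogonal complement of the range of \<open>marg_proj\<close> consists of the
  operators I^A1 \<otimes> M with Tr_A0 M = 0. So the equation says that Tr_B1 J is the identity
  over d_A0 plus such an operator, which combines both conditions on a superchannel.\<close>

lemma superchannel_of_marg_proj:
  fixes J :: "(('a0::finite \<times> 'a1::finite) \<times> ('b0::finite \<times> 'b1::finite)) opr"
  assumes "J \<in> psd UNIV" and eq: "marg_proj (trace_out J) = (\<lambda>p q. id_op p q / of_nat CARD('a0))"
  shows "superchannel (super_of J)"
proof (rule superchannel_super_of[OF assms(1)])
  have "marg0 (marg_proj (trace_out J)) b0 b0' = of_nat CARD('a1) * id_op b0 b0'" for b0 b0'
    unfolding eq by (simp add: marg0_def id_op_def)
  then have m0: "marg0 (trace_out J) b0 b0' = of_nat CARD('a1) * id_op b0 b0'" for b0 b0'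
    by (simp add: marg0_proj)
  show "(\<Sum>b1\<in>UNIV. J ((a0, a1), (b0, b1)) ((a0', a1'), (b0', b1))) =
      id_op a1 a1' * (marg1 (trace_out J) a0 b0 a0' b0' / of_nat CARD('a1))" for a0 a1 b0 a0' a1' b0'
  proof -
    have "id_op ((a0, a1), b0) ((a0', a1'), b0') = id_op a1 a1' * (id_op a0 a0' * id_op b0 b0')"
      by (simp add: id_op_def)
    then have "trace_out J ((a0, a1), b0) ((a0', a1'), b0') +
        id_op a1 a1' * (id_op a0 a0' * (id_op b0 b0' / of_nat CARD('a0)) - marg1 (trace_out J) a0 b0 a0' b0' / of_nat CARD('a1)) =
        id_op a1 a1' * (id_op a0 a0' * (id_op b0 b0' / of_nat CARD('a0)))"
      using fun_cong[OF fun_cong[OF eq, of "((a0, a1), b0)"], of "((a0', a1'), b0')"]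
      by (simp add: marg_proj_def m0)
    then have "trace_out J ((a0, a1), b0) ((a0', a1'), b0') = id_op a1 a1' * (marg1 (trace_out J) a0 b0 a0' b0' / of_nat CARD('a1))"
      by (simp only: right_diff_distrib) (simp add: algebra_simps)
    then show ?thesis by (simp add: trace_out_def[of J])
  qed
  show "(\<Sum>a0\<in>UNIV. marg1 (trace_out J) a0 b0 a0 b0' / of_nat CARD('a1)) = id_op b0 b0'" for b0 b0'
    using m0[of b0 b0'] by (simp add: marg0_marg1 flip: sum_divide_distrib)
qed

text \<open>The affine conditions and the equations relating C to D are stacked into one real-linear
  map, to which \<open>psd_separation\<close> applies. \<gamma> comes from the multiplier of the
  first component, W from that of the second.\<close>

lemma superchannel_alternative:
  fixes C :: "'k::finite \<Rightarrow> ('a0::finite \<times> 'a1::finite) opr" and D :: "'k \<Rightarrow> ('b0::finite \<times> 'b1::finite) opr"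
  assumes "\<not> (\<exists>\<Theta>. superchannel \<Theta> \<and>
    (\<forall>k b b'. (\<Sum>a\<in>UNIV. \<Sum>a'\<in>UNIV. super_choi \<Theta> (a, b) (a', b') * C k a a') = D k b b'))"
  shows "\<exists>\<gamma> W. (\<forall>a0 b0 a0' b0'. marg1 \<gamma> a0 b0 a0' b0' = id_op a0 a0' / of_nat CARD('a0) * marg0 \<gamma> b0 b0') \<and>
    (\<forall>J\<in>psd UNIV. (\<Sum>k\<in>UNIV. \<Sum>b\<in>UNIV. \<Sum>b'\<in>UNIV. Re (W k b b' * (\<Sum>a\<in>UNIV. \<Sum>a'\<in>UNIV. J (a, b) (a', b') * C k a a')))
      \<le> Re (\<Sum>p\<in>UNIV. \<Sum>q\<in>UNIV. ampl \<gamma> p q * J p q)) \<and>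
    Re (tr \<gamma>) / of_nat CARD('a0) < (\<Sum>k\<in>UNIV. \<Sum>b\<in>UNIV. \<Sum>b'\<in>UNIV. Re (W k b b' * D k b b'))"
proof -
  let ?act = "\<lambda>J k b b'. \<Sum>a\<in>UNIV. \<Sum>a'\<in>UNIV. J (a, b) (a', b') * C k a a'"
  define L :: "(('a0 \<times> 'a1) \<times> ('b0 \<times> 'b1)) opr \<Rightarrow>
      (complex^(('a0 \<times> 'a1) \<times> 'b0)^(('a0 \<times> 'a1) \<times> 'b0)) \<times> (complex^('b0 \<times> 'b1)^('b0 \<times> 'b1)^'k)"
    where "L = (\<lambda>J. (\<chi> p q. marg_proj (trace_out J) p q, \<chi> k b b'. ?act J k b b'))"
  define z :: "(complex^(('a0 \<times> 'a1) \<times> 'b0)^(('a0 \<times> 'a1) \<times> 'b0)) \<times> (complex^('b0 \<times> 'b1)^('b0 \<times> 'b1)^'k)"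
    where "z = (\<chi> p q. id_op p q / of_nat CARD('a0), \<chi> k b b'. D k b b')"
  \<comment> \<open>Pairing with the identity in the first component recovers the trace of J, since
    both \<open>trace_out\<close> and \<open>marg_proj\<close> keep the trace.\<close>
  define y0 :: "(complex^(('a0 \<times> 'a1) \<times> 'b0)^(('a0 \<times> 'a1) \<times> 'b0)) \<times> (complex^('b0 \<times> 'b1)^('b0 \<times> 'b1)^'k)"
    where "y0 = (\<chi> p q. id_op p q, 0)"
  have inner_c: "inner x y = Re (cnj x * y)" for x y :: complex
    by (simp add: inner_complex_def)
  have inner_y0: "inner y0 (\<chi> p q. X p q, V) = Re (tr X)" for X V
  proof -
    have "inner y0 (\<chi> p q. X p q, V) = Re (\<Sum>p\<in>UNIV. \<Sum>q\<in>UNIV. id_op p q * X p q)"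
      unfolding y0_def by (simp add: inner_vec_def inner_c) (auto simp: id_op_def intro!: sum.cong)
    then show ?thesis by (simp add: sum_id_op tr_def)
  qed
  have mp: "marg_proj (\<lambda>p q. of_real c * X p q + Y p q) p q = of_real c * marg_proj X p q + marg_proj Y p q"
    for c :: real and X Y :: "(('a0 \<times> 'a1) \<times> 'b0) opr" and p q
  proof -
    have "marg0 (\<lambda>p q. of_real c * X p q + Y p q) = (\<lambda>b b'. of_real c * marg0 X b b' + marg0 Y b b')"
      "marg1 (\<lambda>p q. of_real c * X p q + Y p q) = (\<lambda>a b a' b'. of_real c * marg1 X a b a' b' + marg1 Y a b a' b')"
      by (simp_all add: marg0_def marg1_def fun_eq_iff sum.distrib sum_distrib_left)
    then show ?thesis
      by (simp add: marg_proj_def case_prod_unfold) (simp add: algebra_simps add_divide_distrib)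
  qed
  have to: "trace_out (\<lambda>p q. of_real c * X p q + Y p q) = (\<lambda>p q. of_real c * trace_out X p q + trace_out Y p q)"
    for c :: real and X Y :: "(('a0 \<times> 'a1) \<times> ('b0 \<times> 'b1)) opr"
    by (simp add: trace_out_def fun_eq_iff sum.distrib sum_distrib_left)
  have "\<exists>y. (\<forall>J\<in>psd UNIV. 0 \<le> inner y (L J)) \<and> inner y z < 0"
  proof (rule psd_separation)
    show "L (\<lambda>i j. of_real c * X i j + Y i j) = c *\<^sub>R L X + L Y" for X Y c
    proof -
      have "?act (\<lambda>i j. of_real c * X i j + Y i j) k b b' = of_real c * ?act X k b b' + ?act Y k b b'" for k b b'
        by (simp add: algebra_simps sum.distrib sum_distrib_left)
      then show ?thesis
        by (simp add: L_def to mp vec_eq_iff) (simp add: scaleR_conv_of_real)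
    qed
    have trp: "tr (marg_proj X) = tr X" for X :: "(('a0 \<times> 'a1) \<times> 'b0) opr"
      by (simp add: tr_marg0 marg0_proj)
    show "inner y0 (L J) = Re (tr J)" for J
      unfolding L_def inner_y0 trp tr_trace_out ..
    show "inner y0 z > 0"
      unfolding z_def inner_y0 by (simp add: tr_def id_op_def)
    show "\<not> (\<exists>J\<in>psd UNIV. L J = z)"
    proof
      assume "\<exists>J\<in>psd UNIV. L J = z"
      then obtain J where J: "J \<in> psd UNIV" "L J = z" by blast
      then have "superchannel (super_of J)"
        by (intro superchannel_of_marg_proj) (auto simp: L_def z_def vec_eq_iff fun_eq_iff)
      moreover have "?act J k b b' = D k b b'" for k b b'
        using J(2) by (cases b; cases b') (simp add: L_def z_def vec_eq_iff)
      ultimately show False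
        using assms super_choi_super_of[of J] by auto
    qed
  qed
  then obtain K V where y: "\<And>J. J \<in> psd UNIV \<Longrightarrow> 0 \<le> inner (K, V) (L J)" "inner (K, V) z < 0"
    by (metis surj_pair)
  \<comment> \<open>Conjugation turns the inner product of complex vectors into the bilinear
    pairing; the sign of \<open>W\<close> puts its term on the other side of the inequality.\<close>
  define X where "X = (\<lambda>p q. cnj (K $ p $ q))"
  define W where "W = (\<lambda>k b b'. - cnj (V $ k $ b $ b'))"
  have expand: "inner (K, V) (\<chi> p q. Y p q, \<chi> k b b'. Z k b b') =
    Re (\<Sum>p\<in>UNIV. \<Sum>q\<in>UNIV. X p q * Y p q) - (\<Sum>k\<in>UNIV. \<Sum>b\<in>UNIV. \<Sum>b'\<in>UNIV. Re (W k b b' * Z k b b'))" for Y Z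
    by (simp add: inner_vec_def inner_c X_def W_def) (simp add: add.commute flip: sum_negf)
  show ?thesis
  proof (intro exI conjI ballI allI)
    \<comment> \<open>The certificate is \<open>marg_proj X\<close>: the projection is moved from
      \<open>trace_out J\<close> onto X, which leaves all pairings unchanged.\<close>
    show "marg1 (marg_proj X) a0 b0 a0' b0' = id_op a0 a0' / of_nat CARD('a0) * marg0 (marg_proj X) b0 b0'" for a0 b0 a0' b0'
      by (simp add: marg1_proj marg0_proj)
    show "(\<Sum>k\<in>UNIV. \<Sum>b\<in>UNIV. \<Sum>b'\<in>UNIV. Re (W k b b' * ?act J k b b'))
      \<le> Re (\<Sum>p\<in>UNIV. \<Sum>q\<in>UNIV. ampl (marg_proj X) p q * J p q)" if "J \<in> psd UNIV" for J
      using y(1)[OF that] unfolding L_def expand marg_proj_adjoint trace_out_pairing by simp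
    have "(\<Sum>p\<in>UNIV. \<Sum>q\<in>UNIV. X p q * (id_op p q / of_nat CARD('a0))) = tr X / of_nat CARD('a0)"
      by (simp add: sum_id_op tr_def flip: sum_divide_distrib)
    moreover have "tr (marg_proj X) = tr X"
      by (simp add: tr_marg0 marg0_proj)
    ultimately show "Re (tr (marg_proj X)) / of_nat CARD('a0) < (\<Sum>k\<in>UNIV. \<Sum>b\<in>UNIV. \<Sum>b'\<in>UNIV. Re (W k b b' * D k b b'))"
      using y(2) unfolding z_def expand by simp
  qed
qed

section \<open>From a dual certificate to a violating instrument family\<close>

definition herm :: "'i opr \<Rightarrow> 'i opr" where
  "herm X = (\<lambda>i j. (X i j + cnj (X j i)) / 2)"

lemma hermitian_herm: "hermitian (herm X)"
  by (intro hermitianI) (simp add: herm_def add.commute)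

text \<open>The form of the Hermitian part is the real part of the form, and real parts are all that
  the separating functional controls.\<close>

lemma herm_psd:
  fixes X :: "'i::finite opr"
  assumes "\<And>v. 0 \<le> Re (quad UNIV X v)"
  shows "herm X \<in> psd UNIV"
proof (rule psdI)
  fix v
  have c: "cnj (quad UNIV X v) = quad UNIV (\<lambda>i j. cnj (X j i)) v"
    unfolding quad_def by (subst sum.swap) (simp add: mult_ac)
  have "quad UNIV (herm X) v = (1 / 2) * (quad UNIV X v + cnj (quad UNIV X v))"
    unfolding c quad_add[symmetric] quad_scale[symmetric] herm_def by simp
  also have "\<dots> = of_real (Re (quad UNIV X v))"
    by (simp add: complex_eq_iff)
  finally show "quad UNIV (herm X) v \<in> \<real>\<^sub>\<ge>\<^sub>0"
    using assms by simp
qed simp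

lemma herm_pairing:
  fixes X D :: "'i::finite opr"
  assumes "hermitian D"
  shows "Re (\<Sum>i\<in>UNIV. \<Sum>j\<in>UNIV. herm X i j * D i j) = Re (\<Sum>i\<in>UNIV. \<Sum>j\<in>UNIV. X i j * D i j)"
proof -
  let ?s = "\<Sum>i\<in>UNIV. \<Sum>j\<in>UNIV. X i j * D i j"
  have "cnj ?s = (\<Sum>i\<in>UNIV. \<Sum>j\<in>UNIV. cnj (X j i) * D i j)"
    by (subst sum.swap) (simp add: hermitian_cnj[OF assms])
  then have "(\<Sum>i\<in>UNIV. \<Sum>j\<in>UNIV. herm X i j * D i j) = (?s + cnj ?s) / 2"
    by (simp add: herm_def add_divide_distrib distrib_right sum.distrib sum_divide_distrib)
  moreover have "Re ((z + cnj z) / 2) = Re z" for z :: complex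
    by simp
  ultimately show ?thesis by (simp only:)
qed

lemma choi_state_paired_psd:
  fixes F :: "nat \<Rightarrow> nat \<Rightarrow> 'a0::finite opr \<Rightarrow> 'a1::finite opr" and \<Lambda> :: "nat \<Rightarrow> nat \<Rightarrow> 'b0::finite opr \<Rightarrow> 'b1::finite opr"
  assumes "\<And>x y. x \<in> {1..dX} \<Longrightarrow> y \<in> {1..dY} \<Longrightarrow> F x y \<in> cp_maps UNIV UNIV"
    and "\<And>x y. x \<in> {1..dX} \<Longrightarrow> y \<in> {1..dY} \<Longrightarrow> \<Lambda> x y \<in> cp_maps UNIV UNIV"
  shows "choi_state (paired_map dX dY F \<Lambda>) \<in> psd UNIV"
proof -
  let ?n = "of_nat dX * of_nat CARD('a0) * of_nat CARD('b0) :: complex"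
  have "(\<lambda>p q. (1 / ?n) * (\<Sum>x=1..dX. \<Sum>y=1..dY. (choi UNIV (F x y) \<otimes>\<^sub>o choi UNIV (\<Lambda> x y)) p q)) \<in> psd UNIV"
    using assms by (intro psd_scale psd_sum psd_tensor) (simp_all add: cp_maps_choi)
  also have "(\<lambda>p q. (1 / ?n) * (\<Sum>x=1..dX. \<Sum>y=1..dY. (choi UNIV (F x y) \<otimes>\<^sub>o choi UNIV (\<Lambda> x y)) p q)) =
    choi_state (paired_map dX dY F \<Lambda>)"
    using choi_state_paired[of dX dY F \<Lambda>] assms by (auto simp: fun_eq_iff op_tensor_def cp_maps_choi)
  finally show ?thesis .
qed

text \<open>The vector is the unnormalised maximally entangled one on two copies of B. Its rank-one
  operator is the Choi operator of the identity superchannel, so this evaluation is a pairing with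
  it.\<close>

lemma quad_diagonal:
  "quad UNIV X (\<lambda>(a, b). if a = b then 1 else 0) = (\<Sum>b\<in>UNIV. \<Sum>b'\<in>UNIV. X (b, b) (b', b'))"
  for X :: "('b::finite \<times> 'b) opr"
proof -
  have "quad UNIV X (\<lambda>(a, b). if a = b then 1 else 0) =
    (\<Sum>a\<in>UNIV. \<Sum>b\<in>UNIV. \<Sum>a'\<in>UNIV. \<Sum>b'\<in>UNIV. id_op a b * (id_op a' b' * X (a, b) (a', b')))"
    unfolding quad_def UNIV_Times_UNIV[symmetric] sum.cartesian_product'
    by (intro sum.cong refl) (simp add: id_op_def)
  then show ?thesis by (simp add: sum_id_op flip: sum_distrib_left)
qed

lemma sum_swap4:
  "(\<Sum>a\<in>A. \<Sum>b\<in>B. \<Sum>c\<in>C. \<Sum>d\<in>D. f a b c d) = (\<Sum>c\<in>C. \<Sum>d\<in>D. \<Sum>a\<in>A. \<Sum>b\<in>B. f a b c d)"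
proof -
  have "(\<Sum>a\<in>A. \<Sum>b\<in>B. \<Sum>c\<in>C. \<Sum>d\<in>D. f a b c d) = (\<Sum>p\<in>A \<times> B. \<Sum>q\<in>C \<times> D. f (fst p) (snd p) (fst q) (snd q))"
    by (simp add: sum.cartesian_product')
  also have "\<dots> = (\<Sum>q\<in>C \<times> D. \<Sum>p\<in>A \<times> B. f (fst p) (snd p) (fst q) (snd q))"
    by (rule sum.swap)
  finally show ?thesis by (simp add: sum.cartesian_product')
qed

text \<open>Lets trace preservation neutralise the shift by V \<otimes> I^B1, which pairs only with
  Tr_B1 D.\<close>

lemma sum_snd_id_op:
  fixes D :: "('b0::finite \<times> 'b1::finite) opr"
  shows "(\<Sum>b\<in>UNIV. \<Sum>b'\<in>UNIV. D b b' * (id_op (snd b) (snd b') * V (fst b) (fst b'))) =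
    (\<Sum>b0\<in>UNIV. \<Sum>b0'\<in>UNIV. (\<Sum>b1\<in>UNIV. D (b0, b1) (b0', b1)) * V b0 b0')"
proof -
  have "(\<Sum>b\<in>UNIV. \<Sum>b'\<in>UNIV. D b b' * (id_op (snd b) (snd b') * V (fst b) (fst b'))) =
    (\<Sum>b0\<in>UNIV. \<Sum>b1\<in>UNIV. \<Sum>b0'\<in>UNIV. \<Sum>b1'\<in>UNIV. id_op b1 b1' * (D (b0, b1) (b0', b1') * V b0 b0'))"
    unfolding UNIV_Times_UNIV[symmetric] sum.cartesian_product' by (simp add: mult_ac)
  also have "\<dots> = (\<Sum>b0\<in>UNIV. \<Sum>b0'\<in>UNIV. \<Sum>b1\<in>UNIV. D (b0, b1) (b0', b1) * V b0 b0')"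
    unfolding sum_id_op by (intro sum.cong refl, rule sum.swap)
  finally show ?thesis by (simp add: sum_distrib_right)
qed

text \<open>
  A dual certificate \<open>(\<gamma>, W)\<close> becomes an instrument family. Adding the \<open>y\<close>-independent operator
  \<open>V x \<otimes> I\<close> to \<open>s W x y\<close> changes both sides of the dual inequality by the same amount, because the
  sums of \<open>C x y\<close> and \<open>D x y\<close> over \<open>y\<close> are trace preserving; \<open>V\<close> is fixed by the normalisation of
  the instrument, and small \<open>s\<close> ensures positivity.
\<close>

lemma instrument_violation:
  fixes F :: "nat \<Rightarrow> nat \<Rightarrow> 'a0::finite opr \<Rightarrow> 'a1::finite opr" and G :: "nat \<Rightarrow> nat \<Rightarrow> 'b0::finite opr \<Rightarrow> 'b1::finite opr"
    and W :: "nat \<Rightarrow> nat \<Rightarrow> ('b0 \<times> 'b1) opr" and \<gamma> :: "(('a0 \<times> 'a1) \<times> 'b0) opr"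
  assumes F: "\<And>x y. x \<in> {1..dX} \<Longrightarrow> y \<in> {1..dY} \<Longrightarrow> F x y \<in> cp_maps UNIV UNIV"
    and G: "\<And>x y. x \<in> {1..dX} \<Longrightarrow> y \<in> {1..dY} \<Longrightarrow> G x y \<in> cp_maps UNIV UNIV"
    and Ft: "\<And>x a0 a0'. x \<in> {1..dX} \<Longrightarrow> (\<Sum>y=1..dY. \<Sum>a1\<in>UNIV. choi UNIV (F x y) (a0, a1) (a0', a1)) = id_op a0 a0'"
    and Gt: "\<And>x b0 b0'. x \<in> {1..dX} \<Longrightarrow> (\<Sum>y=1..dY. \<Sum>b1\<in>UNIV. choi UNIV (G x y) (b0, b1) (b0', b1)) = id_op b0 b0'"
    and d: "dX > 0" "dY > 0"
    and \<gamma>: "hermitian \<gamma>" and marg: "\<And>a0 b0 a0' b0'. marg1 \<gamma> a0 b0 a0' b0' = id_op a0 a0' / of_nat CARD('a0) * marg0 \<gamma> b0 b0'"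
    and W: "\<And>x y. hermitian (W x y)"
    and pos: "(\<lambda>(a, b) (a', b'). ampl \<gamma> (a, b) (a', b') - (\<Sum>x=1..dX. \<Sum>y=1..dY. choi UNIV (F x y) a a' * W x y b b')) \<in> psd UNIV"
    and less: "Re (tr \<gamma>) / of_nat CARD('a0) < Re (\<Sum>x=1..dX. \<Sum>y=1..dY. \<Sum>b\<in>UNIV. \<Sum>b'\<in>UNIV. W x y b b' * choi UNIV (G x y) b b')"
  shows "\<exists>\<Lambda> :: nat \<Rightarrow> nat \<Rightarrow> 'b0 opr \<Rightarrow> 'b1 opr. instrument_family dX dY \<Lambda> \<and> \<not> Hmin_ext (paired_map dX dY F \<Lambda>) \<le> Hmin_ext (paired_map dX dY G \<Lambda>)"
proof -
  let ?C = "\<lambda>x y. choi UNIV (F x y)" and ?D = "\<lambda>x y. choi UNIV (G x y)"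
  have Fl: "F x y \<in> linear_maps UNIV UNIV" and Fp: "?C x y \<in> psd UNIV" if "x \<in> {1..dX}" "y \<in> {1..dY}" for x y
    using F[OF that] by (simp_all add: cp_maps_choi)
  have Gl: "G x y \<in> linear_maps UNIV UNIV" and Gp: "?D x y \<in> psd UNIV" if "x \<in> {1..dX}" "y \<in> {1..dY}" for x y
    using G[OF that] by (simp_all add: cp_maps_choi)
  \<comment> \<open>The uniform family, with every Choi operator equal to the identity over n, is
    normalised and serves as the centre of the perturbation.\<close>
  define n where "n = real (dY * CARD('b1))"
  have n0: "n > 0" using d by (simp add: n_def)
  define m where "m = (\<lambda>x b0 b0'. \<Sum>y=1..dY. \<Sum>b1\<in>UNIV. W x y (b0, b1) (b0', b1))"
  have m_cnj: "cnj (m x b0 b0') = m x b0' b0" for x b0 b0'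
    by (simp add: m_def hermitian_cnj[OF W])
  \<comment> \<open>\<open>H\<close> is W corrected so that its sum over y has vanishing partial
    trace over B1; perturbing by it keeps the normalisation.\<close>
  define H where "H = (\<lambda>x y (b0, b1) (b0', b1'). W x y (b0, b1) (b0', b1') - id_op b1 b1' * m x b0 b0' / of_real n)"
  have id_cnj: "cnj (id_op i j) = id_op j i" for i j :: 'i
    by (simp add: id_op_def)
  have H: "hermitian (H x y)" for x y
    by (intro hermitianI) (auto simp: H_def hermitian_cnj[OF W] m_cnj id_cnj)
  define t where "t = (\<Sum>x=1..dX. \<Sum>y=1..dY. \<Sum>b\<in>UNIV. \<Sum>b'\<in>UNIV. cmod (H x y b b'))"
  have t0: "t \<ge> 0" by (simp add: t_def sum_nonneg)
  \<comment> \<open>\<open>t\<close> bounds all relevant \<open>H x y\<close> at once, and s t \<le>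
    1 / n keeps the perturbed operators positive; 1 + t excludes a zero denominator.\<close>
  define s where "s = 1 / (n * (1 + t))"
  have s0: "s > 0" using n0 t0 by (simp add: s_def)
  define Lc where "Lc = (\<lambda>x y b b'. of_real (1 / n) * id_op b b' + of_real s * H x y b b')"
  \<comment> \<open>\<open>V\<close> collects what does not depend on y: the uniform part and the
    correction inside \<open>H\<close>.\<close>
  define V where "V = (\<lambda>x b0 b0'. (id_op b0 b0' - of_real s * m x b0 b0') / of_real n)"
  have Lc_V: "Lc x y b b' = of_real s * W x y b b' + id_op (snd b) (snd b') * V x (fst b) (fst b')" for x y b b'
  proof -
    have "id_op b b' = id_op (snd b) (snd b') * id_op (fst b) (fst b')"
      by (auto simp: id_op_def prod_eq_iff)
    then show ?thesis
      by (simp add: Lc_def H_def V_def case_prod_unfold algebra_simps diff_divide_distrib)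
  qed
  have Lc: "Lc x y \<in> psd UNIV" if "x \<in> {1..dX}" "y \<in> {1..dY}" for x y
  proof -
    have "(\<Sum>b\<in>UNIV. \<Sum>b'\<in>UNIV. cmod (H x y b b')) \<le> (\<Sum>y=1..dY. \<Sum>b\<in>UNIV. \<Sum>b'\<in>UNIV. cmod (H x y b b'))"
      using that by (intro member_le_sum[of y _ "\<lambda>y. \<Sum>b\<in>UNIV. \<Sum>b'\<in>UNIV. cmod (H x y b b')"]) (auto intro!: sum_nonneg)
    also have "\<dots> \<le> t"
      unfolding t_def using that
      by (intro member_le_sum[of x _ "\<lambda>x. \<Sum>y=1..dY. \<Sum>b\<in>UNIV. \<Sum>b'\<in>UNIV. cmod (H x y b b')"]) (auto intro!: sum_nonneg)
    finally have "s * (\<Sum>b\<in>UNIV. \<Sum>b'\<in>UNIV. cmod (H x y b b')) \<le> s * t"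
      using s0 by simp
    also have "\<dots> \<le> 1 / n"
    proof -
      have "1 / n * (t / (1 + t)) \<le> 1 / n * 1"
        using n0 t0 by (intro mult_left_mono) auto
      then show ?thesis by (simp add: s_def)
    qed
    finally have le: "s * (\<Sum>b\<in>UNIV. \<Sum>b'\<in>UNIV. cmod (H x y b b')) \<le> 1 / n" .
    show ?thesis
      unfolding Lc_def
    proof (rule hermitian_shift_psd)
      show "hermitian (\<lambda>i j. of_real s * H x y i j)"
        by (intro hermitianI) (simp add: hermitian_cnj[OF H])
      show "(\<Sum>i\<in>UNIV. \<Sum>j\<in>UNIV. cmod (of_real s * H x y i j)) \<le> 1 / n"
        using le s0 by (simp add: norm_mult sum_distrib_left)
    qed
  qed
  have Lc_t: "(\<Sum>y=1..dY. \<Sum>b1\<in>UNIV. Lc x y (b0, b1) (b0', b1)) = id_op b0 b0'" for x b0 b0'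
  proof -
    have "(\<Sum>y=1..dY. \<Sum>b1\<in>UNIV. Lc x y (b0, b1) (b0', b1)) = of_real s * m x b0 b0' + of_real n * V x b0 b0'"
      by (simp add: Lc_V id_op_same sum.distrib m_def sum_distrib_left n_def)
    then show ?thesis using n0 by (simp add: V_def)
  qed
  define \<Lambda> where "\<Lambda> = (\<lambda>x y. of_choi (Lc x y))"
  have \<Lambda>l: "\<Lambda> x y \<in> linear_maps UNIV UNIV" and \<Lambda>c: "choi UNIV (\<Lambda> x y) = Lc x y" for x y
    by (simp_all add: \<Lambda>_def of_choi_linear choi_of_choi)
  have inst: "instrument_family dX dY \<Lambda>"
    unfolding instrument_family_def channels_def
  proof (intro conjI ballI CollectI)
    fix x assume x: "x \<in> {1..dX}"
    show "\<Lambda> x y \<in> cp_maps UNIV UNIV" if "y \<in> {1..dY}" for y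
      using Lc[OF x that] by (simp add: cp_maps_choi \<Lambda>l \<Lambda>c)
    let ?S = "\<lambda>\<rho> i j. \<Sum>y=1..dY. \<Lambda> x y \<rho> i j"
    have l: "?S \<in> linear_maps UNIV UNIV"
      using linear_maps_lin[OF \<Lambda>l] by (simp add: linear_maps_def sum.distrib sum_distrib_left)
    have c: "choi UNIV ?S = (\<lambda>b b'. \<Sum>y=1..dY. Lc x y b b')"
      unfolding \<Lambda>c[symmetric] by (auto simp: choi_def fun_eq_iff)
    show "?S \<in> cp_maps UNIV UNIV"
      unfolding cp_maps_choi[OF finite finite] c using l psd_sum[of "{1..dY}" "Lc x", OF Lc[OF x]] by simp
    show "trace_preserving ?S"
      unfolding trace_preserving_choi[OF l] c using Lc_t[of x] by (subst sum.swap) blast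
  qed
  let ?\<Omega>F = "paired_map dX dY F \<Lambda>" and ?\<Omega>G = "paired_map dX dY G \<Lambda>"
  define N where "N = real (dX * CARD('a0) * CARD('b0))"
  define N' where "N' = real (dX * CARD('b0) * CARD('b0))"
  have N0: "N > 0" "N' > 0" using d by (simp_all add: N_def N'_def)
  have \<omega>F: "choi_state ?\<Omega>F (a, b) (a', b') = (\<Sum>x=1..dX. \<Sum>y=1..dY. ?C x y a a' * Lc x y b b') / of_real N" for a b a' b'
    using choi_state_paired[of dX dY F \<Lambda>] Fl \<Lambda>l by (simp add: \<Lambda>c N_def)
  have \<omega>G: "choi_state ?\<Omega>G (a, b) (a', b') = (\<Sum>x=1..dX. \<Sum>y=1..dY. ?D x y a a' * Lc x y b b') / of_real N'" for a b a' b'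
    using choi_state_paired[of dX dY G \<Lambda>] Gl \<Lambda>l by (simp add: \<Lambda>c N'_def)
  have \<Lambda>cp: "\<Lambda> x y \<in> cp_maps UNIV UNIV" if "x \<in> {1..dX}" "y \<in> {1..dY}" for x y
    using Lc[OF that] by (simp add: cp_maps_choi \<Lambda>l \<Lambda>c)
  have pF: "choi_state ?\<Omega>F \<in> psd UNIV" and pG: "choi_state ?\<Omega>G \<in> psd UNIV"
    using F G \<Lambda>cp by (auto intro: choi_state_paired_psd)
  define v where "v = Re (\<Sum>x=1..dX. \<Sum>b0\<in>UNIV. V x b0 b0)"
  have upper: "hmin_val ?\<Omega>F \<le> (s * Re (tr \<gamma>) + of_nat CARD('a0) * v) / N"
  proof -
    define Cx where "Cx = (\<lambda>x a a'. \<Sum>y=1..dY. ?C x y a a')"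
    \<comment> \<open>s \<gamma> plus the contribution of the shift. \<open>Cx x\<close> is the Choi
      operator of a trace-preserving map, so the second term satisfies the marginal condition by
      itself; the slack over the Choi state is s / N times the slack of the certificate.\<close>
    define \<gamma>' where "\<gamma>' = (\<lambda>(a, b0) (a', b0'). (of_real s * \<gamma> (a, b0) (a', b0') + (\<Sum>x=1..dX. Cx x a a' * V x b0 b0')) / of_real N)"
    have Cx1: "(\<Sum>a1\<in>UNIV. Cx x (a0, a1) (a0', a1)) = id_op a0 a0'" if "x \<in> {1..dX}" for x a0 a0'
      unfolding Cx_def using Ft[OF that] by (subst sum.swap) simp
    have V_cnj: "cnj (V x b0 b0') = V x b0' b0" for x b0 b0'
      by (simp add: V_def m_cnj id_cnj)
    have C_cnj: "cnj (Cx x a a') = Cx x a' a" if "x \<in> {1..dX}" for x a a'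
      using hermitian_cnj[OF psd_imp_hermitian[OF Fp[OF that]]] by (simp add: Cx_def)
    have "cnj (\<Sum>x=1..dX. Cx x a a' * V x b0 b0') = (\<Sum>x=1..dX. Cx x a' a * V x b0' b0)" for a a' b0 b0'
      unfolding cnj_sum complex_cnj_mult V_cnj by (rule sum.cong) (simp_all add: C_cnj)
    then have "hermitian \<gamma>'"
      by (intro hermitianI) (simp add: \<gamma>'_def hermitian_cnj[OF \<gamma>] case_prod_unfold del: cnj_sum)
    moreover have "(\<lambda>p q. ampl \<gamma>' p q - choi_state ?\<Omega>F p q) \<in> psd UNIV"
    proof -
      have "ampl \<gamma>' (a, b) (a', b') - choi_state ?\<Omega>F (a, b) (a', b') =
        of_real (s / N) * (ampl \<gamma> (a, b) (a', b') - (\<Sum>x=1..dX. \<Sum>y=1..dY. ?C x y a a' * W x y b b'))" for a b a' b'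
      proof -
        have "(\<Sum>x=1..dX. \<Sum>y=1..dY. ?C x y a a' * Lc x y b b') =
          of_real s * (\<Sum>x=1..dX. \<Sum>y=1..dY. ?C x y a a' * W x y b b') +
          id_op (snd b) (snd b') * (\<Sum>x=1..dX. Cx x a a' * V x (fst b) (fst b'))"
          by (simp add: Lc_V Cx_def distrib_left sum.distrib sum_distrib_left sum_distrib_right mult_ac)
        then show ?thesis
          unfolding \<omega>F by (simp add: ampl_def \<gamma>'_def case_prod_unfold algebra_simps add_divide_distrib diff_divide_distrib)
      qed
      then have "(\<lambda>p q. ampl \<gamma>' p q - choi_state ?\<Omega>F p q) = (\<lambda>p q. of_real (s / N) *
        (\<lambda>(a, b) (a', b'). ampl \<gamma> (a, b) (a', b') - (\<Sum>x=1..dX. \<Sum>y=1..dY. ?C x y a a' * W x y b b')) p q)"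
        by (auto simp: fun_eq_iff)
      then show ?thesis
        using psd_scale[OF pos, of "of_real (s / N)"] s0 N0 by simp
    qed
    moreover have m1: "marg1 \<gamma>' a0 b0 a0' b0' = id_op a0 a0' / of_nat CARD('a0) *
        ((of_real s * marg0 \<gamma> b0 b0' + of_nat CARD('a0) * (\<Sum>x=1..dX. V x b0 b0')) / of_real N)" for a0 b0 a0' b0'
    proof -
      have "marg1 \<gamma>' a0 b0 a0' b0' = (of_real s * marg1 \<gamma> a0 b0 a0' b0' +
          (\<Sum>a1\<in>UNIV. \<Sum>x=1..dX. Cx x (a0, a1) (a0', a1) * V x b0 b0')) / of_real N"
        by (simp add: marg1_def \<gamma>'_def sum.distrib sum_distrib_left flip: sum_divide_distrib)
      also have "(\<Sum>a1\<in>UNIV. \<Sum>x=1..dX. Cx x (a0, a1) (a0', a1) * V x b0 b0') = (\<Sum>x=1..dX. id_op a0 a0' * V x b0 b0')"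
        by (subst sum.swap) (simp add: Cx1 flip: sum_distrib_right)
      finally show ?thesis
        unfolding marg by (simp add: field_simps flip: sum_distrib_left)
    qed
    moreover have m0: "marg0 \<gamma>' b0 b0' = (of_real s * marg0 \<gamma> b0 b0' + of_nat CARD('a0) * (\<Sum>x=1..dX. V x b0 b0')) / of_real N" for b0 b0'
      by (simp add: marg0_marg1[of \<gamma>'] m1 id_op_same)
    ultimately have "\<gamma>' \<in> hmin_feasible ?\<Omega>F"
      unfolding hmin_feasible_iff marg1_def[symmetric] marg0_def[symmetric] by simp
    then have "hmin_val ?\<Omega>F \<le> Re (tr \<gamma>')"
      by (rule hmin_val(2)[OF pF])
    also have "tr \<gamma>' = (of_real s * tr \<gamma> + of_nat CARD('a0) * (\<Sum>x=1..dX. \<Sum>b0\<in>UNIV. V x b0 b0)) / of_real N"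
      unfolding tr_marg0[of \<gamma>'] m0 tr_marg0[of \<gamma>]
      by (subst sum.swap) (simp add: sum.distrib sum_distrib_left flip: sum_divide_distrib)
    also have "Re \<dots> = (s * Re (tr \<gamma>) + of_nat CARD('a0) * v) / N"
      by (simp add: v_def)
    finally show ?thesis .
  qed
  define w where "w = Re (\<Sum>x=1..dX. \<Sum>y=1..dY. \<Sum>b\<in>UNIV. \<Sum>b'\<in>UNIV. W x y b b' * ?D x y b b')"
  have lower: "(s * w + v) * CARD('b0) / N' \<le> hmin_val ?\<Omega>G"
  proof -
    define Sw where "Sw = (\<Sum>x=1..dX. \<Sum>y=1..dY. \<Sum>b\<in>UNIV. \<Sum>b'\<in>UNIV. W x y b b' * ?D x y b b')"
    define Sv where "Sv = (\<Sum>x=1..dX. \<Sum>b0\<in>UNIV. V x b0 b0)"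
    have w: "w = Re Sw" and v: "v = Re Sv"
      by (simp_all only: w_def v_def Sw_def Sv_def)
    obtain \<gamma>' where \<gamma>': "\<gamma>' \<in> hmin_feasible ?\<Omega>G" and val: "hmin_val ?\<Omega>G = Re (tr \<gamma>')"
      using hmin_val(1)[OF pG] by blast
    have mg: "(\<Sum>a1\<in>UNIV. \<gamma>' ((a0, a1), b0) ((a0', a1), b0')) = id_op a0 a0' / of_nat CARD('b0) * marg0 \<gamma>' b0 b0'" for a0 b0 a0' b0'
      using \<gamma>' by (simp add: hmin_feasible_iff marg0_def)
    let ?u = "\<lambda>(a, b). if a = b then 1 else 0 :: complex"
    have "0 \<le> Re (quad UNIV (\<lambda>p q. ampl \<gamma>' p q - choi_state ?\<Omega>G p q) ?u)"
      using \<gamma>' by (simp add: hmin_feasible_iff psd_quad complex_nonneg_Reals_iff)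
    \<comment> \<open>Summing over the labels of the two B1 systems leaves the marginal on the two
      B0 systems, where the marginal condition replaces \<gamma>' by its marginal on B0
      alone.\<close>
    moreover have "quad UNIV (ampl \<gamma>') ?u = tr \<gamma>' / of_nat CARD('b0)"
    proof -
      have "quad UNIV (ampl \<gamma>') ?u = (\<Sum>b0\<in>UNIV. \<Sum>b1\<in>UNIV. \<Sum>b0'\<in>UNIV. \<Sum>b1'\<in>UNIV. id_op b1 b1' * \<gamma>' ((b0, b1), b0) ((b0', b1'), b0'))"
        unfolding quad_diagonal unfolding UNIV_Times_UNIV[symmetric] sum.cartesian_product' by (simp add: ampl_def mult.commute)
      also have "\<dots> = (\<Sum>b0\<in>UNIV. \<Sum>b0'\<in>UNIV. \<Sum>b1\<in>UNIV. \<gamma>' ((b0, b1), b0) ((b0', b1), b0'))"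
        unfolding sum_id_op by (intro sum.cong refl, rule sum.swap)
      also have "\<dots> = (\<Sum>b0\<in>UNIV. \<Sum>b0'\<in>UNIV. id_op b0 b0' * (marg0 \<gamma>' b0 b0' / of_nat CARD('b0)))"
        unfolding mg by simp
      also have "\<dots> = tr \<gamma>' / of_nat CARD('b0)"
        unfolding sum_id_op tr_marg0 by (simp add: sum_divide_distrib)
      finally show ?thesis .
    qed
    moreover have "quad UNIV (choi_state ?\<Omega>G) ?u = (\<Sum>x=1..dX. \<Sum>y=1..dY. \<Sum>b\<in>UNIV. \<Sum>b'\<in>UNIV. ?D x y b b' * Lc x y b b') / of_real N'"
      unfolding quad_diagonal \<omega>G sum_divide_distrib[symmetric] by (subst sum_swap4) rule
    moreover have "(\<Sum>x=1..dX. \<Sum>y=1..dY. \<Sum>b\<in>UNIV. \<Sum>b'\<in>UNIV. ?D x y b b' * Lc x y b b') =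
      of_real s * (\<Sum>x=1..dX. \<Sum>y=1..dY. \<Sum>b\<in>UNIV. \<Sum>b'\<in>UNIV. W x y b b' * ?D x y b b') + (\<Sum>x=1..dX. \<Sum>b0\<in>UNIV. V x b0 b0)"
    proof -
      have "(\<Sum>y=1..dY. \<Sum>b\<in>UNIV. \<Sum>b'\<in>UNIV. ?D x y b b' * (id_op (snd b) (snd b') * V x (fst b) (fst b'))) =
        (\<Sum>b0\<in>UNIV. V x b0 b0)" if x: "x \<in> {1..dX}" for x
      proof -
        have "(\<Sum>y=1..dY. \<Sum>b\<in>UNIV. \<Sum>b'\<in>UNIV. ?D x y b b' * (id_op (snd b) (snd b') * V x (fst b) (fst b'))) =
          (\<Sum>b0\<in>UNIV. \<Sum>y=1..dY. \<Sum>b0'\<in>UNIV. (\<Sum>b1\<in>UNIV. ?D x y (b0, b1) (b0', b1)) * V x b0 b0')"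
          unfolding sum_snd_id_op by (rule sum.swap)
        also have "\<dots> = (\<Sum>b0\<in>UNIV. \<Sum>b0'\<in>UNIV. \<Sum>y=1..dY. (\<Sum>b1\<in>UNIV. ?D x y (b0, b1) (b0', b1)) * V x b0 b0')"
          by (intro sum.cong refl, rule sum.swap)
        finally show ?thesis
          unfolding sum_distrib_right[symmetric] Gt[OF x] sum_id_op .
      qed
      then show ?thesis
        by (simp add: Lc_V distrib_left sum.distrib sum_distrib_left mult_ac)
    qed
    ultimately have "0 \<le> Re (tr \<gamma>' / of_nat CARD('b0) - (of_real s * Sw + Sv) / of_real N')"
      unfolding quad_diff Sw_def Sv_def by (simp only:)
    then have "(s * w + v) / N' \<le> Re (tr \<gamma>') / CARD('b0)"
      by (simp add: w v)
    then show ?thesis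
      unfolding val by (simp add: field_simps)
  qed
  have "hmin_val ?\<Omega>F < hmin_val ?\<Omega>G"
  proof -
    \<comment> \<open>After cancellation both bounds carry 1 / (dX d_B0) and the same v, so only Re
      (tr \<gamma>) / d_A0 and w compete.\<close>
    have "(s * Re (tr \<gamma>) + of_nat CARD('a0) * v) / N = (s * (Re (tr \<gamma>) / CARD('a0)) + v) * CARD('b0) / N'"
      using d by (simp add: N_def N'_def field_simps)
    also have "\<dots> < (s * w + v) * CARD('b0) / N'"
      using mult_strict_left_mono[OF less[folded w_def] s0] N0
      by (intro divide_strict_right_mono mult_strict_right_mono) auto
    finally show ?thesis using upper lower by linarith
  qed
  then have "\<not> Hmin_ext ?\<Omega>F \<le> Hmin_ext ?\<Omega>G"
    unfolding Hmin_ext_le_iff[OF pF pG] by simp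
  then show ?thesis using inst by blast
qed

section \<open>Expansion of a channel in its conditional maps\<close>

lemma cond_map_cp_maps:
  fixes \<Phi> :: "('r0::finite \<times> 'a0::finite) opr \<Rightarrow> ('r1::finite \<times> 'a1::finite) opr"
  assumes "\<Phi> \<in> cp_maps UNIV UNIV" "P \<in> psd UNIV" "E \<in> psd UNIV"
  shows "cond_map \<Phi> P E \<in> cp_maps UNIV UNIV"
  using cond_map_cp[OF assms] cond_map_linear[of \<Phi>] assms(1) by (simp add: cp_maps_choi)

text \<open>Summing the effects to the identity leaves the partial trace over R1, and attaching a P
  of trace 1 does not change the trace of the input.\<close>

lemma cond_map_trace:
  fixes \<Phi> :: "('r0::finite \<times> 'a0::finite) opr \<Rightarrow> ('r1::finite \<times> 'a1::finite) opr"
  assumes "\<Phi> \<in> linear_maps UNIV UNIV" "trace_preserving \<Phi>" "tr P = 1" "(\<lambda>i j. \<Sum>y\<in>Y. E y i j) = id_op"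
  shows "(\<Sum>y\<in>Y. \<Sum>a1\<in>UNIV. choi UNIV (cond_map \<Phi> P (E y)) (a0, a1) (a0', a1)) = id_op a0 a0'"
proof -
  let ?N = "\<lambda>\<rho> i j. \<Sum>y\<in>Y. cond_map \<Phi> P (E y) \<rho> i j"
  have N: "?N \<in> linear_maps UNIV UNIV"
    using linear_maps_lin[OF cond_map_linear[OF assms(1)]] by (simp add: linear_maps_def sum.distrib sum_distrib_left)
  have c: "choi UNIV ?N = (\<lambda>i j. \<Sum>y\<in>Y. choi UNIV (cond_map \<Phi> P (E y)) i j)"
    by (auto simp: choi_def fun_eq_iff)
  have E: "(\<Sum>y\<in>Y. E y i j) = id_op i j" for i j
    using assms(4) by (simp add: fun_eq_iff)
  have "?N \<rho> k l = (\<Sum>r\<in>UNIV. \<Phi> (P \<otimes>\<^sub>o \<rho>) (r, k) (r, l))" for \<rho> k l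
  proof -
    have "?N \<rho> k l = (\<Sum>r\<in>UNIV. \<Sum>y\<in>Y. \<Sum>s\<in>UNIV. E y s r * \<Phi> (P \<otimes>\<^sub>o \<rho>) (r, k) (s, l))"
      unfolding cond_map_apply by (rule sum.swap)
    also have "\<dots> = (\<Sum>r\<in>UNIV. \<Sum>s\<in>UNIV. (\<Sum>y\<in>Y. E y s r) * \<Phi> (P \<otimes>\<^sub>o \<rho>) (r, k) (s, l))"
      unfolding sum_distrib_right by (intro sum.cong refl, rule sum.swap)
    finally show ?thesis by (simp add: E sum_id_op)
  qed
  then have "tr (?N \<rho>) = tr (\<Phi> (P \<otimes>\<^sub>o \<rho>))" for \<rho>
    by (simp add: tr_prod) (simp add: tr_def)
  moreover have "tr (P \<otimes>\<^sub>o \<rho>) = tr P * tr \<rho>" for \<rho> :: "'a0 opr"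
    by (simp add: tr_prod op_tensor_def) (simp add: tr_def sum_distrib_left sum_distrib_right)
  ultimately have "\<forall>\<rho>. tr (?N \<rho>) = 1 * tr \<rho>"
    using assms(2,3) by (simp add: trace_preserving_def)
  then have "(\<Sum>a1\<in>UNIV. \<Sum>y\<in>Y. choi UNIV (cond_map \<Phi> P (E y)) (a0, a1) (a0', a1)) = id_op a0 a0'"
    unfolding trace_choi[OF N] c by simp
  then show ?thesis by (subst sum.swap)
qed

lemma choi_cond_map_sum:
  fixes \<Phi> :: "('r0::finite \<times> 'a0::finite) opr \<Rightarrow> ('r1::finite \<times> 'a1::finite) opr"
  assumes "\<Phi> \<in> linear_maps UNIV UNIV"
  shows "choi UNIV (cond_map \<Phi> (\<lambda>i j. \<Sum>x\<in>X. c x * P x i j) (\<lambda>i j. \<Sum>y\<in>Y. e y * E y i j)) a a' =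
    (\<Sum>x\<in>X. \<Sum>y\<in>Y. c x * e y * choi UNIV (cond_map \<Phi> (P x) (E y)) a a')"
proof -
  let ?R = "\<lambda>r r'. regroup (choi UNIV \<Phi>) (r, a) (r', a')"
  let ?T = "\<lambda>x y r r'. (P x \<otimes>\<^sub>o (\<lambda>i j. E y j i)) r r'"
  have "((\<lambda>i j. \<Sum>x\<in>X. c x * P x i j) \<otimes>\<^sub>o (\<lambda>i j. \<Sum>y\<in>Y. e y * E y j i)) r r' = (\<Sum>x\<in>X. \<Sum>y\<in>Y. c x * e y * ?T x y r r')" for r r'
    by (simp add: op_tensor_def case_prod_unfold sum_product mult_ac)
  then have "choi UNIV (cond_map \<Phi> (\<lambda>i j. \<Sum>x\<in>X. c x * P x i j) (\<lambda>i j. \<Sum>y\<in>Y. e y * E y i j)) a a' =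
    (\<Sum>r\<in>UNIV. \<Sum>r'\<in>UNIV. \<Sum>x\<in>X. \<Sum>y\<in>Y. c x * e y * ?T x y r r' * ?R r r')"
    by (simp add: choi_cond_map[OF assms] sum_distrib_right)
  also have "\<dots> = (\<Sum>x\<in>X. \<Sum>y\<in>Y. \<Sum>r\<in>UNIV. \<Sum>r'\<in>UNIV. c x * e y * ?T x y r r' * ?R r r')"
    by (rule sum_swap4)
  finally show ?thesis
    by (simp add: choi_cond_map[OF assms] sum_distrib_left mult.assoc)
qed

text \<open>Matrix units in place of the state and the effect read off single positions on R. The
  second one has its indices reversed because the effect enters transposed.\<close>

lemma regroup_choi_cond_map:
  fixes \<Phi> :: "('r0::finite \<times> 'a0::finite) opr \<Rightarrow> ('r1::finite \<times> 'a1::finite) opr"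
  assumes "\<Phi> \<in> linear_maps UNIV UNIV"
  shows "regroup (choi UNIV \<Phi>) (r, a) (r', a') =
    choi UNIV (cond_map \<Phi> (matrix_unit (fst r) (fst r')) (matrix_unit (snd r') (snd r))) a a'"
proof -
  have "matrix_unit (fst r) (fst r') \<otimes>\<^sub>o (\<lambda>i j. matrix_unit (snd r') (snd r) j i) = matrix_unit r r'"
    by (auto simp: op_tensor_def matrix_unit_def fun_eq_iff prod_eq_iff)
  then show ?thesis
    by (simp add: choi_cond_map[OF assms] sum_matrix_unit)
qed

text \<open>A matrix unit is a complex combination of two Hermitian operators, so a real basis of
  the Hermitian ones spans all operators over the complex numbers.\<close>

lemma matrix_unit_in_span:
  fixes F :: "nat \<Rightarrow> 'i opr"
  assumes "op_basis \<real> {H. hermitian H} n F"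
  shows "\<exists>c. matrix_unit i j = (\<lambda>p q. \<Sum>x=1..n. c x * F x p q)"
proof -
  have span: "\<exists>c. X = (\<lambda>p q. \<Sum>x=1..n. c x * F x p q)" if "hermitian X" for X
    using assms that unfolding op_basis_def by blast
  have cnj_unit: "cnj (matrix_unit k l p q) = matrix_unit l k q p" for k l p q :: 'i
    by (auto simp: matrix_unit_def)
  have "hermitian (\<lambda>p q. matrix_unit i j p q + matrix_unit j i p q)"
    "hermitian (\<lambda>p q. \<i> * matrix_unit i j p q - \<i> * matrix_unit j i p q)"
    by (rule hermitianI, simp add: cnj_unit)+
  then obtain c d where c: "(\<lambda>p q. matrix_unit i j p q + matrix_unit j i p q) = (\<lambda>p q. \<Sum>x=1..n. c x * F x p q)"
    and d: "(\<lambda>p q. \<i> * matrix_unit i j p q - \<i> * matrix_unit j i p q) = (\<lambda>p q. \<Sum>x=1..n. d x * F x p q)"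
    using span by meson
  have "matrix_unit i j p q = (\<Sum>x=1..n. (c x - \<i> * d x) / 2 * F x p q)" for p q
  proof -
    have "(\<Sum>x=1..n. (c x - \<i> * d x) / 2 * F x p q) = ((\<Sum>x=1..n. c x * F x p q) - \<i> * (\<Sum>x=1..n. d x * F x p q)) / 2"
      unfolding sum_distrib_left sum_subtractf[symmetric] sum_divide_distrib
      by (intro sum.cong refl) (simp add: algebra_simps diff_divide_distrib)
    then show ?thesis
      unfolding fun_cong[OF fun_cong[OF c], symmetric] fun_cong[OF fun_cong[OF d], symmetric]
      by (simp add: algebra_simps)
  qed
  then have "matrix_unit i j = (\<lambda>p q. \<Sum>x=1..n. (c x - \<i> * d x) / 2 * F x p q)"
    by (intro ext)
  then show ?thesis by (rule exI[of _ "\<lambda>x. (c x - \<i> * d x) / 2"])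
qed

text \<open>J acts on the first factor only, so it passes through the sum over x and y that pairs
  with \<Lambda>; a minimiser for F then yields a feasible point for G.\<close>

lemma superchannel_imp_Hmin_le:
  fixes \<Theta> :: "('a0::finite opr \<Rightarrow> 'a1::finite opr) \<Rightarrow> ('b0::finite opr \<Rightarrow> 'b1::finite opr)"
    and F :: "nat \<Rightarrow> nat \<Rightarrow> 'a0 opr \<Rightarrow> 'a1 opr" and G :: "nat \<Rightarrow> nat \<Rightarrow> 'b0 opr \<Rightarrow> 'b1 opr"
    and \<Lambda> :: "nat \<Rightarrow> nat \<Rightarrow> 'c0::finite opr \<Rightarrow> 'c1::finite opr"
  assumes \<Theta>: "superchannel \<Theta>"
    and F: "\<And>x y. x \<in> {1..dX} \<Longrightarrow> y \<in> {1..dY} \<Longrightarrow> F x y \<in> cp_maps UNIV UNIV"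
    and G: "\<And>x y. x \<in> {1..dX} \<Longrightarrow> y \<in> {1..dY} \<Longrightarrow> G x y \<in> cp_maps UNIV UNIV"
    and \<Lambda>: "\<And>x y. x \<in> {1..dX} \<Longrightarrow> y \<in> {1..dY} \<Longrightarrow> \<Lambda> x y \<in> cp_maps UNIV UNIV"
    and FG: "\<And>x y b b'. x \<in> {1..dX} \<Longrightarrow> y \<in> {1..dY} \<Longrightarrow> choi UNIV (G x y) b b' =
      (\<Sum>a\<in>UNIV. \<Sum>a'\<in>UNIV. super_choi \<Theta> (a, b) (a', b') * choi UNIV (F x y) a a')"
  shows "Hmin_ext (paired_map dX dY F \<Lambda>) \<le> Hmin_ext (paired_map dX dY G \<Lambda>)"
proof -
  let ?\<Omega>F = "paired_map dX dY F \<Lambda>" and ?\<Omega>G = "paired_map dX dY G \<Lambda>"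
  have pF: "choi_state ?\<Omega>F \<in> psd UNIV" and pG: "choi_state ?\<Omega>G \<in> psd UNIV"
    using F G \<Lambda> by (auto intro: choi_state_paired_psd)
  obtain \<gamma> where \<gamma>: "\<gamma> \<in> hmin_feasible ?\<Omega>F" "hmin_val ?\<Omega>F = Re (tr \<gamma>)"
    using hmin_val(1)[OF pF] by blast
  have "choi_state ?\<Omega>G (b, c) (b', c') = of_nat CARD('a0) / of_nat CARD('b0) *
      (\<Sum>a\<in>UNIV. \<Sum>a'\<in>UNIV. super_choi \<Theta> (a, b) (a', b') * choi_state ?\<Omega>F (a, c) (a', c'))" for b c b' c'
  proof -
    let ?J = "\<lambda>a a'. super_choi \<Theta> (a, b) (a', b')" and ?L = "\<lambda>x y. choi UNIV (\<Lambda> x y) c c'"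
    have "(\<Sum>x=1..dX. \<Sum>y=1..dY. choi UNIV (G x y) b b' * ?L x y) =
      (\<Sum>x=1..dX. \<Sum>y=1..dY. \<Sum>a\<in>UNIV. \<Sum>a'\<in>UNIV. ?J a a' * (choi UNIV (F x y) a a' * ?L x y))"
      by (intro sum.cong refl) (simp add: FG sum_distrib_right mult.assoc)
    also have "\<dots> = (\<Sum>a\<in>UNIV. \<Sum>a'\<in>UNIV. \<Sum>x=1..dX. \<Sum>y=1..dY. ?J a a' * (choi UNIV (F x y) a a' * ?L x y))"
      by (rule sum_swap4)
    also have "\<dots> = (\<Sum>a\<in>UNIV. \<Sum>a'\<in>UNIV. ?J a a' * (\<Sum>x=1..dX. \<Sum>y=1..dY. choi UNIV (F x y) a a' * ?L x y))"
      by (simp add: sum_distrib_left)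
    finally have *: "(\<Sum>x=1..dX. \<Sum>y=1..dY. choi UNIV (G x y) b b' * ?L x y) = \<dots>" .
    have F': "choi_state ?\<Omega>F (a, c) (a', c') =
        (\<Sum>x=1..dX. \<Sum>y=1..dY. choi UNIV (F x y) a a' * ?L x y) / (of_nat dX * of_nat CARD('a0) * of_nat CARD('c0))" for a a'
      using F \<Lambda> by (intro choi_state_paired) (auto simp: cp_maps_def)
    have G': "choi_state ?\<Omega>G (b, c) (b', c') =
        (\<Sum>x=1..dX. \<Sum>y=1..dY. choi UNIV (G x y) b b' * ?L x y) / (of_nat dX * of_nat CARD('b0) * of_nat CARD('c0))"
      using G \<Lambda> by (intro choi_state_paired) (auto simp: cp_maps_def)
    show ?thesis
      unfolding F' G' * times_divide_eq_right sum_divide_distrib[symmetric] by (simp add: field_simps)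
  qed
  from superchannel_feasible[OF \<Theta> \<gamma>(1) this] obtain \<gamma>' where "\<gamma>' \<in> hmin_feasible ?\<Omega>G" "tr \<gamma>' = tr \<gamma>"
    by blast
  then have "hmin_val ?\<Omega>G \<le> hmin_val ?\<Omega>F"
    using hmin_val(2)[OF pG] \<gamma>(2) by metis
  then show ?thesis
    by (simp add: Hmin_ext_le_iff[OF pF pG])
qed

text \<open>Rank-one choices of J turn the inequality into a statement on the real part of a
  quadratic form. Taking Hermitian parts passes through the sum to W because each C x y is
  Hermitian.\<close>

lemma psd_alternative_hermitian:
  fixes \<gamma> :: "('a::finite \<times> 'b0::finite) opr" and C :: "nat \<Rightarrow> nat \<Rightarrow> 'a opr" and W :: "nat \<Rightarrow> nat \<Rightarrow> ('b0 \<times> 'b1::finite) opr"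
  assumes C: "\<And>x y. x \<in> X \<Longrightarrow> y \<in> Y \<Longrightarrow> hermitian (C x y)"
    and le: "\<And>J. J \<in> psd UNIV \<Longrightarrow>
      Re (\<Sum>b\<in>UNIV. \<Sum>b'\<in>UNIV. \<Sum>a\<in>UNIV. \<Sum>a'\<in>UNIV. J (a, b) (a', b') * (\<Sum>x\<in>X. \<Sum>y\<in>Y. C x y a a' * W x y b b'))
      \<le> Re (\<Sum>p\<in>UNIV. \<Sum>q\<in>UNIV. ampl \<gamma> p q * J p q)"
  shows "(\<lambda>(a, b) (a', b'). ampl (herm \<gamma>) (a, b) (a', b') - (\<Sum>x\<in>X. \<Sum>y\<in>Y. C x y a a' * herm (W x y) b b')) \<in> psd UNIV"
proof -
  define S where "S = (\<lambda>(a, b) (a', b'). \<Sum>x\<in>X. \<Sum>y\<in>Y. C x y a a' * W x y b b')"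
  have "herm (\<lambda>p q. ampl \<gamma> p q - S p q) \<in> psd UNIV"
  proof (rule herm_psd)
    fix v :: "'a \<times> 'b0 \<times> 'b1 \<Rightarrow> complex"
    \<comment> \<open>The vector is conjugated because the bilinear pairing with J has to reproduce
      the sesquilinear form at v.\<close>
    define J where "J = rank1 (\<lambda>p. cnj (v p))"
    have J: "J \<in> psd UNIV" unfolding J_def by (rule psd_rank1) simp
    have q: "quad UNIV X v = (\<Sum>p\<in>UNIV. \<Sum>q\<in>UNIV. X p q * J p q)" for X
      by (simp add: quad_def J_def rank1_def mult_ac)
    have "(\<Sum>p\<in>UNIV. \<Sum>q\<in>UNIV. S p q * J p q) = (\<Sum>a\<in>UNIV. \<Sum>b\<in>UNIV. \<Sum>a'\<in>UNIV. \<Sum>b'\<in>UNIV. J (a, b) (a', b') * S (a, b) (a', b'))"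
      by (simp add: sum.cartesian_product'[of _ UNIV UNIV, simplified] mult.commute)
    also have "\<dots> = (\<Sum>b\<in>UNIV. \<Sum>a\<in>UNIV. \<Sum>a'\<in>UNIV. \<Sum>b'\<in>UNIV. J (a, b) (a', b') * S (a, b) (a', b'))"
      by (rule sum.swap)
    also have "\<dots> = (\<Sum>b\<in>UNIV. \<Sum>a\<in>UNIV. \<Sum>b'\<in>UNIV. \<Sum>a'\<in>UNIV. J (a, b) (a', b') * S (a, b) (a', b'))"
      by (intro sum.cong refl, rule sum.swap)
    also have "\<dots> = (\<Sum>b\<in>UNIV. \<Sum>b'\<in>UNIV. \<Sum>a\<in>UNIV. \<Sum>a'\<in>UNIV. J (a, b) (a', b') * S (a, b) (a', b'))"
      by (intro sum.cong refl, rule sum.swap)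
    finally show "0 \<le> Re (quad UNIV (\<lambda>p q. ampl \<gamma> p q - S p q) v)"
      using le[OF J] unfolding quad_diff q by (simp only: S_def split_conv minus_complex.sel diff_ge_0_iff_ge)
  qed
  also have "herm (\<lambda>p q. ampl \<gamma> p q - S p q) =
    (\<lambda>(a, b) (a', b'). ampl (herm \<gamma>) (a, b) (a', b') - (\<Sum>x\<in>X. \<Sum>y\<in>Y. C x y a a' * herm (W x y) b b'))"
  proof (intro ext, clarify)
    fix a b0 b1 a' b0' b1'
    have "cnj (S (a', (b0', b1')) (a, (b0, b1))) = (\<Sum>x\<in>X. \<Sum>y\<in>Y. C x y a a' * cnj (W x y (b0', b1') (b0, b1)))"
      by (simp add: S_def hermitian_cnj[OF C])
    moreover have "cnj (id_op b1' b1) = id_op b1 b1'"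
      by (simp add: id_op_def)
    moreover have "(\<Sum>x\<in>X. \<Sum>y\<in>Y. C x y a a' * herm (W x y) (b0, b1) (b0', b1')) =
      (S (a, (b0, b1)) (a', (b0', b1')) + (\<Sum>x\<in>X. \<Sum>y\<in>Y. C x y a a' * cnj (W x y (b0', b1') (b0, b1)))) / 2"
      by (simp add: S_def herm_def distrib_left add_divide_distrib sum.distrib sum_divide_distrib)
    ultimately show "herm (\<lambda>p q. ampl \<gamma> p q - S p q) (a, (b0, b1)) (a', (b0', b1')) =
      ampl (herm \<gamma>) (a, (b0, b1)) (a', (b0', b1')) - (\<Sum>x\<in>X. \<Sum>y\<in>Y. C x y a a' * herm (W x y) (b0, b1) (b0', b1'))"
      unfolding herm_def[of "\<lambda>p q. ampl \<gamma> p q - S p q"]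
      by (simp add: herm_def[of \<gamma>] ampl_def distrib_right add_divide_distrib diff_divide_distrib del: cnj_sum)
  qed
  finally show ?thesis .
qed

theorem theorem7:
  fixes \<Phi> :: "('r0::finite \<times> 'a0::finite) opr \<Rightarrow> ('r1::finite \<times> 'a1::finite) opr"
    and \<Psi> :: "('r0 \<times> 'b0::finite) opr \<Rightarrow> ('r1 \<times> 'b1::finite) opr"
    and \<phi> :: "nat \<Rightarrow> 'r0 \<Rightarrow> complex"
    and E :: "nat \<Rightarrow> 'r1 opr"
    and dX dY :: nat
  assumes "\<Phi> \<in> channels" and "\<Psi> \<in> channels"
    and "dX = CARD('r0)\<^sup>2" and "dY = CARD('r1)\<^sup>2"
    and "\<forall>x\<in>{1..dX}. normalized (\<phi> x)"
    and "op_basis \<real> {H. hermitian H} dX (\<lambda>x. rank1 (\<phi> x))"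
    and "povm dY E" and "informationally_complete dY E"
    and "op_basis UNIV UNIV dY E"
  shows "(\<exists>\<Theta> :: ('a0 opr \<Rightarrow> 'a1 opr) \<Rightarrow> ('b0 opr \<Rightarrow> 'b1 opr).
            superchannel \<Theta> \<and> \<Psi> = id_super UNIV \<Theta> \<Phi>) \<longleftrightarrow>
         (\<forall>\<Lambda> :: nat \<Rightarrow> nat \<Rightarrow> 'b0 opr \<Rightarrow> 'b1 opr. instrument_family dX dY \<Lambda> \<longrightarrow>
            Hmin_ext (paired_map dX dY (\<lambda>x y. cond_map \<Phi> (rank1 (\<phi> x)) (E y)) \<Lambda>)
            \<le> Hmin_ext (paired_map dX dY (\<lambda>x y. cond_map \<Psi> (rank1 (\<phi> x)) (E y)) \<Lambda>))"
proof -
  let ?F = "\<lambda>x y. cond_map \<Phi> (rank1 (\<phi> x)) (E y)" and ?G = "\<lambda>x y. cond_map \<Psi> (rank1 (\<phi> x)) (E y)"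
  have \<Phi>: "\<Phi> \<in> cp_maps UNIV UNIV" "\<Phi> \<in> linear_maps UNIV UNIV" "trace_preserving \<Phi>"
    and \<Psi>: "\<Psi> \<in> cp_maps UNIV UNIV" "\<Psi> \<in> linear_maps UNIV UNIV" "trace_preserving \<Psi>"
    using assms(1,2) by (auto simp: channels_def cp_maps_def)
  have P: "rank1 (\<phi> x) \<in> psd UNIV" for x
    by (rule psd_rank1) simp
  have E: "E y \<in> psd UNIV" if "y \<in> {1..dY}" for y
    using assms(7) that by (simp add: povm_def)
  have trP: "tr (rank1 (\<phi> x)) = 1" if "x \<in> {1..dX}" for x
  proof -
    have "tr (rank1 (\<phi> x)) = of_real (\<Sum>i\<in>UNIV. (cmod (\<phi> x i))\<^sup>2)"
      unfolding tr_def rank1_def of_real_sum complex_norm_square ..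
    moreover have "(\<Sum>i\<in>UNIV. (cmod (\<phi> x i))\<^sup>2) = 1"
      using assms(5) that by (simp add: normalized_def)
    ultimately show ?thesis by (simp only: of_real_1)
  qed
  have sumE: "(\<lambda>i j. \<Sum>y=1..dY. E y i j) = id_op"
    using assms(7) by (simp add: povm_def)
  have F: "?F x y \<in> cp_maps UNIV UNIV" and G: "?G x y \<in> cp_maps UNIV UNIV" if "y \<in> {1..dY}" for x y
    using cond_map_cp_maps[OF \<Phi>(1) P E[OF that]] cond_map_cp_maps[OF \<Psi>(1) P E[OF that]] by auto
  show ?thesis
  proof (intro iffI allI impI)
    fix \<Lambda> :: "nat \<Rightarrow> nat \<Rightarrow> 'b0 opr \<Rightarrow> 'b1 opr"
    assume "\<exists>\<Theta> :: ('a0 opr \<Rightarrow> 'a1 opr) \<Rightarrow> ('b0 opr \<Rightarrow> 'b1 opr). superchannel \<Theta> \<and> \<Psi> = id_super UNIV \<Theta> \<Phi>"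
    then obtain \<Theta> :: "('a0 opr \<Rightarrow> 'a1 opr) \<Rightarrow> ('b0 opr \<Rightarrow> 'b1 opr)"
      where \<Theta>: "superchannel \<Theta>" "\<Psi> = id_super UNIV \<Theta> \<Phi>" by blast
    assume \<Lambda>: "instrument_family dX dY \<Lambda>"
    show "Hmin_ext (paired_map dX dY ?F \<Lambda>) \<le> Hmin_ext (paired_map dX dY ?G \<Lambda>)"
    proof (rule superchannel_imp_Hmin_le[OF \<Theta>(1) F G])
      show "choi UNIV (?G x y) b b' = (\<Sum>a\<in>UNIV. \<Sum>a'\<in>UNIV. super_choi \<Theta> (a, b) (a', b') * choi UNIV (?F x y) a a')" for x y b b'
        unfolding \<Theta>(2) by (rule choi_cond_map_id_super) (use \<Theta>(1) \<Phi>(2) in \<open>auto simp: superchannel_def\<close>)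
    qed (use \<Lambda> in \<open>auto simp: instrument_family_def\<close>)
  next
    assume all: "\<forall>\<Lambda> :: nat \<Rightarrow> nat \<Rightarrow> 'b0 opr \<Rightarrow> 'b1 opr. instrument_family dX dY \<Lambda> \<longrightarrow>
      Hmin_ext (paired_map dX dY ?F \<Lambda>) \<le> Hmin_ext (paired_map dX dY ?G \<Lambda>)"
    show "\<exists>\<Theta> :: ('a0 opr \<Rightarrow> 'a1 opr) \<Rightarrow> ('b0 opr \<Rightarrow> 'b1 opr). superchannel \<Theta> \<and> \<Psi> = id_super UNIV \<Theta> \<Phi>"
    proof (rule ccontr)
      assume none: "\<not> ?thesis"
      \<comment> \<open>The index k = (r, r') runs over the matrix positions on R0 R1; in these
        coordinates the equation between \<Psi> and the image of \<Phi> is one contraction condition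
        for each k.\<close>
      define C where "C = (\<lambda>(r, r') a a'. regroup (choi UNIV \<Phi>) (r, a) (r', a'))"
      define D where "D = (\<lambda>(r, r') b b'. regroup (choi UNIV \<Psi>) (r, b) (r', b'))"
      have "\<not> (\<exists>\<Theta>. superchannel \<Theta> \<and>
        (\<forall>k b b'. (\<Sum>a\<in>UNIV. \<Sum>a'\<in>UNIV. super_choi \<Theta> (a, b) (a', b') * C k a a') = D k b b'))"
      proof
        assume "\<exists>\<Theta>. superchannel \<Theta> \<and>
          (\<forall>k b b'. (\<Sum>a\<in>UNIV. \<Sum>a'\<in>UNIV. super_choi \<Theta> (a, b) (a', b') * C k a a') = D k b b')"
        then obtain \<Theta> where \<Theta>: "superchannel \<Theta>"
          and eq: "\<And>k b b'. (\<Sum>a\<in>UNIV. \<Sum>a'\<in>UNIV. super_choi \<Theta> (a, b) (a', b') * C k a a') = D k b b'" by blast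
        have lin: "linear_super \<Theta>" using \<Theta> by (simp add: superchannel_def)
        have l: "id_super UNIV \<Theta> \<Phi> \<in> linear_maps UNIV UNIV"
          using id_super_linear[OF lin, of \<Phi> UNIV UNIV] \<Phi>(2) by simp
        have "choi UNIV (id_super UNIV \<Theta> \<Phi>) ((i, b0), (k, b1)) ((i', b0'), (k', b1')) =
          choi UNIV \<Psi> ((i, b0), (k, b1)) ((i', b0'), (k', b1'))" for i b0 k b1 i' b0' k' b1'
          using choi_id_super[OF lin, of \<Phi> UNIV UNIV i i' b0 k b1 b0' k' b1'] \<Phi>(2)
            eq[where b = "(b0, b1)" and k = "((i, k), (i', k'))" and b' = "(b0', b1')"]
          by (simp add: C_def D_def regroup_eq)
        then have "choi UNIV \<Psi> = choi UNIV (id_super UNIV \<Theta> \<Phi>)"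
          by (intro ext) (metis surj_pair)
        then have "\<Psi> = id_super UNIV \<Theta> \<Phi>"
          using linear_maps_eqI[OF \<Psi>(2) l finite] by (simp add: fun_eq_iff)
        with \<Theta> none show False by blast
      qed
      from superchannel_alternative[OF this] obtain \<gamma> W0 where
        marg: "\<And>a0 b0 a0' b0'. marg1 \<gamma> a0 b0 a0' b0' = id_op a0 a0' / of_nat CARD('a0) * marg0 \<gamma> b0 b0'"
        and le: "\<And>J. J \<in> psd UNIV \<Longrightarrow>
          (\<Sum>k\<in>UNIV. \<Sum>b\<in>UNIV. \<Sum>b'\<in>UNIV. Re (W0 k b b' * (\<Sum>a\<in>UNIV. \<Sum>a'\<in>UNIV. J (a, b) (a', b') * C k a a')))
          \<le> Re (\<Sum>p\<in>UNIV. \<Sum>q\<in>UNIV. ampl \<gamma> p q * J p q)"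
        and less: "Re (tr \<gamma>) / of_nat CARD('a0) < (\<Sum>k\<in>UNIV. \<Sum>b\<in>UNIV. \<Sum>b'\<in>UNIV. Re (W0 k b b' * D k b b'))"
        by blast
      have "\<exists>e. matrix_unit i j = (\<lambda>p q. \<Sum>y=1..dY. e y * E y p q)" for i j
        using assms(9) by (auto simp: op_basis_def)
      then obtain e where e: "\<And>i j. matrix_unit i j = (\<lambda>p q. \<Sum>y=1..dY. e i j y * E y p q)" by metis
      obtain c where c: "\<And>i j. matrix_unit i j = (\<lambda>p q. \<Sum>x=1..dX. c i j x * rank1 (\<phi> x) p q)"
        using matrix_unit_in_span[OF assms(6)] by metis
      \<comment> \<open>Coordinates of the matrix unit at position k in the products of the bases
        \<phi>_x and E_y; the R1 indices are reversed by the transposition in the effect.\<close>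
      define f where "f = (\<lambda>((r0, r1), (r0', r1')) x y. c r0 r0' x * e r1' r1 y)"
      have Cf: "C k a a' = (\<Sum>x=1..dX. \<Sum>y=1..dY. f k x y * choi UNIV (?F x y) a a')" for k a a'
        unfolding C_def f_def case_prod_unfold regroup_choi_cond_map[OF \<Phi>(2)] c e choi_cond_map_sum[OF \<Phi>(2)] ..
      have Df: "D k b b' = (\<Sum>x=1..dX. \<Sum>y=1..dY. f k x y * choi UNIV (?G x y) b b')" for k b b'
        unfolding D_def f_def case_prod_unfold regroup_choi_cond_map[OF \<Psi>(2)] c e choi_cond_map_sum[OF \<Psi>(2)] ..
      \<comment> \<open>The transposed change of coordinates carries the witness from matrix
        positions k to the labels (x, y), leaving its pairings with the channels unchanged.\<close>
      define W where "W = (\<lambda>x y b b'. \<Sum>k\<in>UNIV. f k x y * W0 k b b')"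
      have swap: "(\<Sum>k\<in>UNIV. W0 k b b' * (\<Sum>x=1..dX. \<Sum>y=1..dY. f k x y * z x y)) = (\<Sum>x=1..dX. \<Sum>y=1..dY. z x y * W x y b b')" for z b b'
      proof -
        have "(\<Sum>k\<in>UNIV. W0 k b b' * (\<Sum>x=1..dX. \<Sum>y=1..dY. f k x y * z x y)) =
          (\<Sum>x=1..dX. \<Sum>k\<in>UNIV. \<Sum>y=1..dY. W0 k b b' * (f k x y * z x y))"
          unfolding sum_distrib_left by (rule sum.swap)
        also have "\<dots> = (\<Sum>x=1..dX. \<Sum>y=1..dY. \<Sum>k\<in>UNIV. W0 k b b' * (f k x y * z x y))"
          by (intro sum.cong refl, rule sum.swap)
        finally show ?thesis
          by (simp add: W_def sum_distrib_left mult_ac)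
      qed
      have WC: "(\<Sum>k\<in>UNIV. W0 k b b' * C k a a') = (\<Sum>x=1..dX. \<Sum>y=1..dY. choi UNIV (?F x y) a a' * W x y b b')" for a a' b b'
        unfolding Cf by (rule swap)
      have WD: "(\<Sum>k\<in>UNIV. W0 k b b' * D k b b') = (\<Sum>x=1..dX. \<Sum>y=1..dY. choi UNIV (?G x y) b b' * W x y b b')" for b b'
        unfolding Df by (rule swap)
      have hF: "hermitian (choi UNIV (?F x y))" and hG: "hermitian (choi UNIV (?G x y))" if "y \<in> {1..dY}" for x y
        using F[OF that] G[OF that] by (simp_all add: cp_maps_choi psd_imp_hermitian)
      have d: "dX > 0" "dY > 0" using assms(3,4) by simp_all
      have "\<exists>\<Lambda> :: nat \<Rightarrow> nat \<Rightarrow> 'b0 opr \<Rightarrow> 'b1 opr. instrument_family dX dY \<Lambda> \<and>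
        \<not> Hmin_ext (paired_map dX dY ?F \<Lambda>) \<le> Hmin_ext (paired_map dX dY ?G \<Lambda>)"
      proof (rule instrument_violation[where \<gamma> = "herm \<gamma>" and W = "\<lambda>x y. herm (W x y)", OF F G _ _ d])
        show "(\<Sum>y=1..dY. \<Sum>a1\<in>UNIV. choi UNIV (?F x y) (a0, a1) (a0', a1)) = id_op a0 a0'" if "x \<in> {1..dX}" for x a0 a0'
          by (rule cond_map_trace[OF \<Phi>(2,3) trP[OF that] sumE])
        show "(\<Sum>y=1..dY. \<Sum>b1\<in>UNIV. choi UNIV (?G x y) (b0, b1) (b0', b1)) = id_op b0 b0'" if "x \<in> {1..dX}" for x b0 b0'
          by (rule cond_map_trace[OF \<Psi>(2,3) trP[OF that] sumE])
        show "marg1 (herm \<gamma>) a0 b0 a0' b0' = id_op a0 a0' / of_nat CARD('a0) * marg0 (herm \<gamma>) b0 b0'" for a0 b0 a0' b0'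
        proof -
          have "marg1 (herm \<gamma>) a0 b0 a0' b0' = (marg1 \<gamma> a0 b0 a0' b0' + cnj (marg1 \<gamma> a0' b0' a0 b0)) / 2"
            "marg0 (herm \<gamma>) b0 b0' = (marg0 \<gamma> b0 b0' + cnj (marg0 \<gamma> b0' b0)) / 2"
            by (simp_all add: marg1_def marg0_def herm_def sum.distrib sum_divide_distrib add_divide_distrib)
          then show ?thesis
            unfolding marg by (auto simp: id_op_def add_divide_distrib mult.commute)
        qed
        show "(\<lambda>(a, b) (a', b'). ampl (herm \<gamma>) (a, b) (a', b') -
          (\<Sum>x=1..dX. \<Sum>y=1..dY. choi UNIV (?F x y) a a' * herm (W x y) b b')) \<in> psd UNIV"
        proof (rule psd_alternative_hermitian[OF hF])
          fix J :: "(('a0 \<times> 'a1) \<times> ('b0 \<times> 'b1)) opr" assume J: "J \<in> psd UNIV"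
          have "(\<Sum>b\<in>UNIV. \<Sum>b'\<in>UNIV. \<Sum>a\<in>UNIV. \<Sum>a'\<in>UNIV. J (a, b) (a', b') *
              (\<Sum>x=1..dX. \<Sum>y=1..dY. choi UNIV (?F x y) a a' * W x y b b')) =
            (\<Sum>b\<in>UNIV. \<Sum>b'\<in>UNIV. \<Sum>a\<in>UNIV. \<Sum>a'\<in>UNIV. \<Sum>k\<in>UNIV. W0 k b b' * (J (a, b) (a', b') * C k a a'))"
            unfolding WC[symmetric] by (simp add: sum_distrib_left mult_ac)
          also have "\<dots> = (\<Sum>b\<in>UNIV. \<Sum>b'\<in>UNIV. \<Sum>a\<in>UNIV. \<Sum>k\<in>UNIV. \<Sum>a'\<in>UNIV. W0 k b b' * (J (a, b) (a', b') * C k a a'))"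
            by (intro sum.cong refl, rule sum.swap)
          also have "\<dots> = (\<Sum>b\<in>UNIV. \<Sum>b'\<in>UNIV. \<Sum>k\<in>UNIV. \<Sum>a\<in>UNIV. \<Sum>a'\<in>UNIV. W0 k b b' * (J (a, b) (a', b') * C k a a'))"
            by (intro sum.cong refl, rule sum.swap)
          also have "\<dots> = (\<Sum>b\<in>UNIV. \<Sum>k\<in>UNIV. \<Sum>b'\<in>UNIV. \<Sum>a\<in>UNIV. \<Sum>a'\<in>UNIV. W0 k b b' * (J (a, b) (a', b') * C k a a'))"
            by (intro sum.cong refl, rule sum.swap)
          also have "\<dots> = (\<Sum>k\<in>UNIV. \<Sum>b\<in>UNIV. \<Sum>b'\<in>UNIV. \<Sum>a\<in>UNIV. \<Sum>a'\<in>UNIV. W0 k b b' * (J (a, b) (a', b') * C k a a'))"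
            by (rule sum.swap)
          also have "Re \<dots> \<le> Re (\<Sum>p\<in>UNIV. \<Sum>q\<in>UNIV. ampl \<gamma> p q * J p q)"
            using le[OF J] unfolding sum_distrib_left Re_sum .
          finally show "Re (\<Sum>b\<in>UNIV. \<Sum>b'\<in>UNIV. \<Sum>a\<in>UNIV. \<Sum>a'\<in>UNIV. J (a, b) (a', b') *
              (\<Sum>x=1..dX. \<Sum>y=1..dY. choi UNIV (?F x y) a a' * W x y b b')) \<le> Re (\<Sum>p\<in>UNIV. \<Sum>q\<in>UNIV. ampl \<gamma> p q * J p q)" .
        qed
        show "Re (tr (herm \<gamma>)) / of_nat CARD('a0) <
          Re (\<Sum>x=1..dX. \<Sum>y=1..dY. \<Sum>b\<in>UNIV. \<Sum>b'\<in>UNIV. herm (W x y) b b' * choi UNIV (?G x y) b b')"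
        proof -
          have "(\<Sum>k\<in>UNIV. \<Sum>b\<in>UNIV. \<Sum>b'\<in>UNIV. W0 k b b' * D k b b') =
            (\<Sum>b\<in>UNIV. \<Sum>k\<in>UNIV. \<Sum>b'\<in>UNIV. W0 k b b' * D k b b')"
            by (rule sum.swap)
          also have "\<dots> = (\<Sum>b\<in>UNIV. \<Sum>b'\<in>UNIV. \<Sum>k\<in>UNIV. W0 k b b' * D k b b')"
            by (intro sum.cong refl, rule sum.swap)
          also have "\<dots> = (\<Sum>b\<in>UNIV. \<Sum>b'\<in>UNIV. \<Sum>x=1..dX. \<Sum>y=1..dY. W x y b b' * choi UNIV (?G x y) b b')"
            unfolding WD by (simp add: mult.commute)
          also have "\<dots> = (\<Sum>x=1..dX. \<Sum>y=1..dY. \<Sum>b\<in>UNIV. \<Sum>b'\<in>UNIV. W x y b b' * choi UNIV (?G x y) b b')"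
            by (rule sum_swap4)
          finally have "(\<Sum>k\<in>UNIV. \<Sum>b\<in>UNIV. \<Sum>b'\<in>UNIV. Re (W0 k b b' * D k b b')) =
            (\<Sum>x=1..dX. \<Sum>y=1..dY. Re (\<Sum>b\<in>UNIV. \<Sum>b'\<in>UNIV. W x y b b' * choi UNIV (?G x y) b b'))"
            unfolding Re_sum[symmetric] by simp
          also have "\<dots> = (\<Sum>x=1..dX. \<Sum>y=1..dY. Re (\<Sum>b\<in>UNIV. \<Sum>b'\<in>UNIV. herm (W x y) b b' * choi UNIV (?G x y) b b'))"
            by (intro sum.cong refl herm_pairing[symmetric] hG)
          finally have "(\<Sum>k\<in>UNIV. \<Sum>b\<in>UNIV. \<Sum>b'\<in>UNIV. Re (W0 k b b' * D k b b')) =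
            Re (\<Sum>x=1..dX. \<Sum>y=1..dY. \<Sum>b\<in>UNIV. \<Sum>b'\<in>UNIV. herm (W x y) b b' * choi UNIV (?G x y) b b')"
            unfolding Re_sum .
          moreover have "Re (tr (herm \<gamma>)) = Re (tr \<gamma>)"
            by (simp add: tr_def herm_def)
          ultimately show ?thesis using less by (simp only:)
        qed
      qed (assumption | rule hermitian_herm)+
      with all show False by blast
    qed
  qed
qed

end
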